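(* Let $v\in F_S$. Then there exist finitely many highest weight vectors $w_1,\dots,w_k\in M(v)$ such that each $M(w_i)$ is an irreducible $U_q(\mathfrak l_S)$-submodule of $M(v)$ and $$M(v)=\sum_{i=1}^kM(w_i).$$
   Context: Let $\mathfrak g$ be a complex semisimple Lie algebra with simple roots $\alpha_1,\dots,\alpha_r$, fundamental weights $\varpi_1,\dots,\varpi_r$, root lattice $Q$, integral weight lattice $P$, and Cartan matrix $(a_{ij})$. Let $\langle\cdot,\cdot\rangle$ be the bilinear pairing on $P\times P$ with $\langle \varpi_i,\alpha_j\rangle=\delta_{ij}d_i$ and $\langle\alpha_i,\alpha_j\rangle=d_ia_{ij}$, where the $d_i$ are positive integers symmetrizing the Cartan matrix. Let $k_0$ be a ground field of characteristic $0$ and $q\in k_0^\times$ not a root of unity; put $q_i=q^{d_i}$. $U_q(\mathfrak g)$ is the quantized enveloping algebra over $k_0$ with generators $E_i,F_i,K_i^{\pm1}$ ($1\le i\le r$) and relations: the $K_i$ are invertible and commute, $K_iE_jK_i^{-1}=q^{\langle\alpha_i,\alpha_j\rangle}E_j$, $K_iF_jK_i^{-1}=q^{-\langle\alpha_i,\alpha_j\rangle}F_j$, $E_iF_j-F_jE_i=\delta_{ij}(K_i-K_i^{-1})/(q_i-q_i^{-1})$, and the quantum Serre relations. It is a Hopf algebra with $\Delta(E_i)=E_i\otimes1+K_i\otimes E_i$, $\Delta(F_i)=F_i\otimes K_i^{-1}+1\otimes F_i$, $\Delta(K_i)=K_i\otimes K_i$, and antipode $S(E_i)=-K_i^{-1}E_i$,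 $S(F_i)=-F_iK_i$, $S(K_i)=K_i^{-1}$. The left adjoint action is $\operatorname{ad}_L(a)(b)=a_{(1)}\,b\,S(a_{(2)})$ (Sweedler notation). Fix a subset $S\subseteq\{1,\dots,r\}$ (same letter as the antipode, no confusion intended). The quantum Levi subalgebra $U_q(\mathfrak l_S)$ is the Hopf subalgebra generated by $E_i,F_i$ ($i\in S$) and $K_j^{\pm1}$ ($j=1,\dots,r$). It acts on $U_q(\mathfrak g)$ by $\operatorname{ad}_L$. Set $F_S=\{v\in U_q(\mathfrak g)\mid \dim \operatorname{ad}_L(U_q(\mathfrak l_S))\cdot v<\infty\}$ and, for $v\in F_S$, $M(v)=\operatorname{ad}_L(U_q(\mathfrak l_S))\cdot v=\{\operatorname{ad}_L(a)(v)\mid a\in U_q(\mathfrak l_S)\}$. A highest weight vector is a nonzero $w\in F_S$ with $\operatorname{ad}_L(E_i)(w)=0$ for all $i\in S$ and such that for some weight $\lambda\in P$ one has $\operatorname{ad}_L(K_j)(w)=q^{\langle\lambda,\alpha_j\rangle}w$ for all $j=1,\dots,r$. The empty sum ($k=0$) is $0$ and is allowed (it is only needed when $v=0$). *)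

theory Defs
  imports Complex_Main "HOL-Library.Poly_Mapping" "HOL-Library.Multiset"
begin

section \<open>Semisimple Lie algebras, simple roots and Cartan matrices\<close>

locale complex_lie_algebra = vector_space sc
  for sc :: "complex \<Rightarrow> 'g::ab_group_add \<Rightarrow> 'g" +
  fixes br :: "'g \<Rightarrow> 'g \<Rightarrow> 'g"
  assumes br_add_left: "br (x + y) z = br x z + br y z"
    and br_add_right: "br x (y + z) = br x y + br x z"
    and br_scale_left: "br (sc c x) y = sc c (br x y)"
    and br_scale_right: "br x (sc c y) = sc c (br x y)"
    and br_self: "br x x = 0"
    and jacobi: "br x (br y z) + br y (br z x) + br z (br x y) = 0"
begin

definition lie_product :: "'g set \<Rightarrow> 'g set \<Rightarrow> 'g set" where
  "lie_product X Y = span {br x y | x y. x \<in> X \<and> y \<in> Y}"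

definition lie_ideal :: "'g set \<Rightarrow> bool" where
  "lie_ideal I \<longleftrightarrow> subspace I \<and> (\<forall>x. \<forall>y\<in>I. br x y \<in> I)"

definition lie_subalgebra :: "'g set \<Rightarrow> bool" where
  "lie_subalgebra X \<longleftrightarrow> subspace X \<and> (\<forall>x\<in>X. \<forall>y\<in>X. br x y \<in> X)"

definition lie_solvable :: "'g set \<Rightarrow> bool" where
  "lie_solvable X \<longleftrightarrow> (\<exists>n. ((\<lambda>Y. lie_product Y Y) ^^ n) X = {0})"

definition lie_nilpotent :: "'g set \<Rightarrow> bool" where
  "lie_nilpotent X \<longleftrightarrow> (\<exists>n. (lie_product X ^^ n) X = {0})"

definition semisimple :: bool where
  "semisimple \<longleftrightarrow> (\<exists>B. finite B \<and> span B = UNIV) \<and>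
     (\<forall>I. lie_ideal I \<and> lie_solvable I \<longrightarrow> I = {0})"

definition cartan_subalgebra :: "'g set \<Rightarrow> bool" where
  "cartan_subalgebra H \<longleftrightarrow> lie_subalgebra H \<and> lie_nilpotent H \<and>
     {x. \<forall>h\<in>H. br x h \<in> H} = H"

text \<open>Functionals on \<open>H\<close> are functions on the whole type; only their values on \<open>H\<close> matter.\<close>

definition root_space :: "'g set \<Rightarrow> ('g \<Rightarrow> complex) \<Rightarrow> 'g set" where
  "root_space H \<beta> = {x. \<forall>h\<in>H. br h x = sc (\<beta> h) x}"

definition is_root :: "'g set \<Rightarrow> ('g \<Rightarrow> complex) \<Rightarrow> bool" where
  "is_root H \<beta> \<longleftrightarrow> (\<exists>h\<in>H. \<beta> h \<noteq> 0) \<and> root_space H \<beta> \<noteq> {0}"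

definition simple_roots :: "'g set \<Rightarrow> ('i::finite \<Rightarrow> 'g \<Rightarrow> complex) \<Rightarrow> bool" where
  "simple_roots H \<alpha> \<longleftrightarrow>
     (\<forall>i. is_root H (\<alpha> i)) \<and>
     (\<forall>c. (\<forall>h\<in>H. (\<Sum>i\<in>UNIV. c i * \<alpha> i h) = 0) \<longrightarrow> (\<forall>i. c i = 0)) \<and>
     (\<forall>\<beta>. is_root H \<beta> \<longrightarrow>
        (\<exists>n :: 'i \<Rightarrow> nat. (\<forall>h\<in>H. \<beta> h = (\<Sum>i\<in>UNIV. of_nat (n i) * \<alpha> i h)) \<or>
                          (\<forall>h\<in>H. \<beta> h = - (\<Sum>i\<in>UNIV. of_nat (n i) * \<alpha> i h))))"

text \<open>The coroot of \<open>\<beta>\<close> is the unique \<open>t \<in> [\<gg>\<^sub>\<beta>, \<gg>\<^bsub>-\<beta>\<^esub>]\<close> with \<open>\<beta>(t) = 2\<close>;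
  since root spaces are one-dimensional, this commutator space consists of single brackets.\<close>

definition is_coroot :: "'g set \<Rightarrow> ('g \<Rightarrow> complex) \<Rightarrow> 'g \<Rightarrow> bool" where
  "is_coroot H \<beta> t \<longleftrightarrow> t \<in> H \<and> \<beta> t = 2 \<and>
     (\<exists>e \<in> root_space H \<beta>. \<exists>f \<in> root_space H (\<lambda>h. - \<beta> h). br e f = t)"

definition is_cartan_matrix ::
    "'g set \<Rightarrow> ('i::finite \<Rightarrow> 'g \<Rightarrow> complex) \<Rightarrow> ('i \<Rightarrow> 'i \<Rightarrow> int) \<Rightarrow> bool" where
  "is_cartan_matrix H \<alpha> A \<longleftrightarrow>
     (\<forall>i. \<exists>t. is_coroot H (\<alpha> i) t \<and> (\<forall>j. \<alpha> j t = of_int (A i j)))"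

end

definition symmetrizes :: "('i \<Rightarrow> nat) \<Rightarrow> ('i \<Rightarrow> 'i \<Rightarrow> int) \<Rightarrow> bool" where
  "symmetrizes d A \<longleftrightarrow> (\<forall>i. d i > 0) \<and> (\<forall>i j. int (d i) * A i j = int (d j) * A j i)"

text \<open>A weight \<open>\<lambda> = (\<Sum>i. m\<^sub>i \<varpi>\<^sub>i)\<close> in \<open>P\<close> is given by its coordinates \<open>m\<close> in the basis of
  fundamental weights, so that \<open>\<langle>\<lambda>, \<alpha>\<^sub>j\<rangle> = d\<^sub>j m\<^sub>j\<close>. The simple root \<open>\<alpha>\<^sub>i\<close> has coordinates
  \<open>m\<^sub>k = a\<^bsub>ki\<^esub>\<close>, and its pairing with \<open>\<alpha>\<^sub>j\<close> is \<open>d\<^sub>j a\<^bsub>ji\<^esub> = d\<^sub>i a\<^bsub>ij\<^esub>\<close>.\<close>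

type_synonym 'i weight = "'i \<Rightarrow> int"

definition pair_simple :: "('i \<Rightarrow> nat) \<Rightarrow> 'i weight \<Rightarrow> 'i \<Rightarrow> int" where
  "pair_simple d m j = int (d j) * m j"

definition simple_root_weight :: "('i \<Rightarrow> 'i \<Rightarrow> int) \<Rightarrow> 'i \<Rightarrow> 'i weight" where
  "simple_root_weight A i = (\<lambda>k. A k i)"

lemma pair_simple_simple_root:
  assumes "symmetrizes d A"
  shows "pair_simple d (simple_root_weight A i) j = int (d i) * A i j"
  using assms by (simp add: pair_simple_def simple_root_weight_def symmetrizes_def)


section \<open>Free associative algebras and presentations\<close>

text \<open>Words under concatenation form the free monoid, so \<open>'a list \<Rightarrow>\<^sub>0 'k\<close> with its
  convolution product is the free unital associative \<open>'k\<close>-algebra on \<open>'a\<close>.\<close>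

instantiation list :: (type) monoid_add
begin

definition zero_list :: "'a list" where "zero_list = []"

definition plus_list :: "'a list \<Rightarrow> 'a list \<Rightarrow> 'a list" where "plus_list xs ys = xs @ ys"

instance by standard (simp_all add: zero_list_def plus_list_def)

end

type_synonym ('a, 'k) free_alg = "'a list \<Rightarrow>\<^sub>0 'k"

definition free_gen :: "'a \<Rightarrow> ('a, 'k::comm_ring_1) free_alg" where
  "free_gen x = Poly_Mapping.single [x] 1"

definition free_scale :: "'k::comm_ring_1 \<Rightarrow> ('a, 'k) free_alg \<Rightarrow> ('a, 'k) free_alg" where
  "free_scale c f = Poly_Mapping.single 0 c * f"

definition free_eval ::
    "('k::comm_ring_1 \<Rightarrow> 'u \<Rightarrow> 'u) \<Rightarrow> ('a \<Rightarrow> 'u::ring_1) \<Rightarrow> ('a, 'k) free_alg \<Rightarrow> 'u" where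
  "free_eval sc g f = (\<Sum>w\<in>Poly_Mapping.keys f. sc (Poly_Mapping.lookup f w) (prod_list (map g w)))"

inductive_set two_sided_ideal :: "'r::ring_1 set \<Rightarrow> 'r set" for R where
  gen: "x \<in> R \<Longrightarrow> x \<in> two_sided_ideal R"
| zero: "0 \<in> two_sided_ideal R"
| add: "x \<in> two_sided_ideal R \<Longrightarrow> y \<in> two_sided_ideal R \<Longrightarrow> x + y \<in> two_sided_ideal R"
| mult_left: "x \<in> two_sided_ideal R \<Longrightarrow> a * x \<in> two_sided_ideal R"
| mult_right: "x \<in> two_sided_ideal R \<Longrightarrow> x * a \<in> two_sided_ideal R"

definition is_algebra :: "('k::field \<Rightarrow> 'u::ring_1 \<Rightarrow> 'u) \<Rightarrow> bool" where
  "is_algebra sc \<longleftrightarrow> vector_space sc \<and>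
     (\<forall>c x y. sc c (x * y) = sc c x * y \<and> sc c (x * y) = x * sc c y)"

definition is_presented_by ::
    "('k::field \<Rightarrow> 'u::ring_1 \<Rightarrow> 'u) \<Rightarrow> ('a \<Rightarrow> 'u) \<Rightarrow> ('a, 'k) free_alg set \<Rightarrow> bool" where
  "is_presented_by sc g R \<longleftrightarrow> is_algebra sc \<and>
     (\<forall>u. \<exists>f. free_eval sc g f = u) \<and>
     (\<forall>f. free_eval sc g f = 0 \<longleftrightarrow> f \<in> two_sided_ideal R)"


section \<open>The relations of the quantized enveloping algebra\<close>

definition qint :: "'k::field \<Rightarrow> nat \<Rightarrow> 'k" where
  "qint p n = (p ^ n - inverse p ^ n) / (p - inverse p)"

definition qfact :: "'k::field \<Rightarrow> nat \<Rightarrow> 'k" where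
  "qfact p n = (\<Prod>k=1..n. qint p k)"

definition qbinom :: "'k::field \<Rightarrow> nat \<Rightarrow> nat \<Rightarrow> 'k" where
  "qbinom p n k = qfact p n / (qfact p k * qfact p (n - k))"

definition q_serre ::
    "('k::field \<Rightarrow> 'r::ring_1 \<Rightarrow> 'r) \<Rightarrow> 'k \<Rightarrow> nat \<Rightarrow> 'r \<Rightarrow> 'r \<Rightarrow> 'r" where
  "q_serre sc p n x y = (\<Sum>k\<le>n. sc ((- 1) ^ k * qbinom p n k) (x ^ (n - k) * y * x ^ k))"

datatype 'i gen_symbol = gE 'i | gF 'i | gK 'i | gKinv 'i

definition uq_relators ::
    "('i \<Rightarrow> 'i \<Rightarrow> int) \<Rightarrow> ('i \<Rightarrow> nat) \<Rightarrow> 'k::field \<Rightarrow> ('i gen_symbol, 'k) free_alg set" where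
  "uq_relators A d q =
    (let E = (\<lambda>i. free_gen (gE i)); F = (\<lambda>i. free_gen (gF i));
         K = (\<lambda>i. free_gen (gK i)); K' = (\<lambda>i. free_gen (gKinv i));
         form = (\<lambda>i j. pair_simple d (simple_root_weight A i) j)
     in {K i * K' i - 1 | i. True} \<union> {K' i * K i - 1 | i. True}
      \<union> {K i * K j - K j * K i | i j. True}
      \<union> {K i * E j * K' i - free_scale (q powi form i j) (E j) | i j. True}
      \<union> {K i * F j * K' i - free_scale (q powi (- form i j)) (F j) | i j. True}
      \<union> {E i * F i - F i * E i
           - free_scale (1 / (q ^ d i - inverse (q ^ d i))) (K i - K' i) | i. True}
      \<union> {E i * F j - F j * E i | i j. i \<noteq> j}
      \<union> {q_serre free_scale (q ^ d i) (nat (1 - A i j)) (E i) (E j) | i j. i \<noteq> j}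
      \<union> {q_serre free_scale (q ^ d i) (nat (1 - A i j)) (F i) (F j) | i j. i \<noteq> j})"


section \<open>Comultiplication and antipode\<close>

text \<open>An element \<open>\<Sum> x\<^sub>k \<otimes> y\<^sub>k\<close> of \<open>U \<otimes> U\<close> is represented by the list of the pairs
  \<open>(x\<^sub>k, y\<^sub>k)\<close>; two lists represent the same tensor iff they are related by the
  following congruence (the defining relations of the tensor product).\<close>

inductive tensor_eq ::
    "('k \<Rightarrow> 'u \<Rightarrow> 'u) \<Rightarrow> ('u::ring_1 \<times> 'u) list \<Rightarrow> ('u \<times> 'u) list \<Rightarrow> bool"
  for sc where
  perm: "mset s = mset t \<Longrightarrow> tensor_eq sc s t"
| sym: "tensor_eq sc s t \<Longrightarrow> tensor_eq sc t s"
| trans: "tensor_eq sc s t \<Longrightarrow> tensor_eq sc t u \<Longrightarrow> tensor_eq sc s u"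
| append: "tensor_eq sc s t \<Longrightarrow> tensor_eq sc (s @ u) (t @ u)"
| add_left: "tensor_eq sc [(x + x', y)] [(x, y), (x', y)]"
| add_right: "tensor_eq sc [(x, y + y')] [(x, y), (x, y')]"
| zero_left: "tensor_eq sc [(0, y)] []"
| zero_right: "tensor_eq sc [(x, 0)] []"
| balanced: "tensor_eq sc [(sc c x, y)] [(x, sc c y)]"

definition tensor_scale ::
    "('k \<Rightarrow> 'u \<Rightarrow> 'u) \<Rightarrow> 'k \<Rightarrow> ('u \<times> 'u) list \<Rightarrow> ('u \<times> 'u) list" where
  "tensor_scale sc c t = map (\<lambda>(x, y). (sc c x, y)) t"

definition tensor_mult ::
    "('u::ring_1 \<times> 'u) list \<Rightarrow> ('u \<times> 'u) list \<Rightarrow> ('u \<times> 'u) list" where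
  "tensor_mult s t = concat (map (\<lambda>(x, y). map (\<lambda>(x', y'). (x * x', y * y')) t) s)"

text \<open>The type \<open>'u\<close> carries the ring \<open>U\<^sub>q(\<gg>)\<close>; the record adds the remaining structure,
  with \<open>comult a\<close> a representative of the tensor \<open>\<Delta>(a)\<close>.\<close>

record ('i, 'k, 'u) quantum_algebra =
  scl :: "'k \<Rightarrow> 'u \<Rightarrow> 'u"
  gen :: "'i gen_symbol \<Rightarrow> 'u"
  comult :: "'u \<Rightarrow> ('u \<times> 'u) list"
  antipode :: "'u \<Rightarrow> 'u"

abbreviation Egen where "Egen U i \<equiv> gen U (gE i)"
abbreviation Fgen where "Fgen U i \<equiv> gen U (gF i)"
abbreviation Kgen where "Kgen U i \<equiv> gen U (gK i)"
abbreviation Kinv where "Kinv U i \<equiv> gen U (gKinv i)"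

text \<open>\<open>\<Delta>\<close> is a homomorphism and the antipode an antihomomorphism of unital algebras, so both
  are determined by their values on generators; the values on the \<open>K\<^sub>i\<inverse>\<close> and
  the remaining Hopf algebra axioms follow.\<close>

definition is_comult :: "('i, 'k, 'u::ring_1) quantum_algebra \<Rightarrow> bool" where
  "is_comult U \<longleftrightarrow> (let \<Delta> = comult U; eq = tensor_eq (scl U) in
     eq (\<Delta> 1) [(1, 1)] \<and>
     (\<forall>a b. eq (\<Delta> (a + b)) (\<Delta> a @ \<Delta> b)) \<and>
     (\<forall>c a. eq (\<Delta> (scl U c a)) (tensor_scale (scl U) c (\<Delta> a))) \<and>
     (\<forall>a b. eq (\<Delta> (a * b)) (tensor_mult (\<Delta> a) (\<Delta> b))) \<and>
     (\<forall>i. eq (\<Delta> (Egen U i)) [(Egen U i, 1), (Kgen U i, Egen U i)]) \<and>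
     (\<forall>i. eq (\<Delta> (Fgen U i)) [(Fgen U i, Kinv U i), (1, Fgen U i)]) \<and>
     (\<forall>i. eq (\<Delta> (Kgen U i)) [(Kgen U i, Kgen U i)]))"

definition is_antipode :: "('i, 'k, 'u::ring_1) quantum_algebra \<Rightarrow> bool" where
  "is_antipode U \<longleftrightarrow> (let \<sigma> = antipode U in
     \<sigma> 1 = 1 \<and>
     (\<forall>a b. \<sigma> (a + b) = \<sigma> a + \<sigma> b) \<and>
     (\<forall>c a. \<sigma> (scl U c a) = scl U c (\<sigma> a)) \<and>
     (\<forall>a b. \<sigma> (a * b) = \<sigma> b * \<sigma> a) \<and>
     (\<forall>i. \<sigma> (Egen U i) = - (Kinv U i * Egen U i)) \<and>
     (\<forall>i. \<sigma> (Fgen U i) = - (Fgen U i * Kgen U i)) \<and>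
     (\<forall>i. \<sigma> (Kgen U i) = Kinv U i))"

definition is_quantized_enveloping_algebra ::
    "('i \<Rightarrow> 'i \<Rightarrow> int) \<Rightarrow> ('i \<Rightarrow> nat) \<Rightarrow> 'k::field \<Rightarrow> ('i, 'k, 'u::ring_1) quantum_algebra \<Rightarrow> bool" where
  "is_quantized_enveloping_algebra A d q U \<longleftrightarrow>
     is_presented_by (scl U) (gen U) (uq_relators A d q) \<and> is_comult U \<and> is_antipode U"


section \<open>The Levi subalgebra and its adjoint action\<close>

definition adL :: "('i, 'k, 'u::ring_1) quantum_algebra \<Rightarrow> 'u \<Rightarrow> 'u \<Rightarrow> 'u" where
  "adL U a b = (\<Sum>(x, y)\<leftarrow>comult U a. x * b * antipode U y)"

definition hopf_subalgebra :: "('i, 'k::field, 'u::ring_1) quantum_algebra \<Rightarrow> 'u set \<Rightarrow> bool" where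
  "hopf_subalgebra U B \<longleftrightarrow> module.subspace (scl U) B \<and> 1 \<in> B \<and>
     (\<forall>a\<in>B. \<forall>b\<in>B. a * b \<in> B) \<and>
     (\<forall>a\<in>B. \<exists>t. set t \<subseteq> B \<times> B \<and> tensor_eq (scl U) (comult U a) t) \<and>
     (\<forall>a\<in>B. antipode U a \<in> B)"

definition levi :: "('i, 'k::field, 'u::ring_1) quantum_algebra \<Rightarrow> 'i set \<Rightarrow> 'u set" where
  "levi U S = \<Inter>{B. hopf_subalgebra U B \<and>
     Egen U ` S \<union> Fgen U ` S \<union> range (Kgen U) \<union> range (Kinv U) \<subseteq> B}"

definition adM :: "('i, 'k::field, 'u::ring_1) quantum_algebra \<Rightarrow> 'i set \<Rightarrow> 'u \<Rightarrow> 'u set" where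
  "adM U S v = {adL U a v | a. a \<in> levi U S}"

definition locally_finite_part ::
    "('i, 'k::field, 'u::ring_1) quantum_algebra \<Rightarrow> 'i set \<Rightarrow> 'u set" where
  "locally_finite_part U S = {v. \<exists>B. finite B \<and> module.span (scl U) B = adM U S v}"

definition highest_weight_vector ::
    "('i \<Rightarrow> nat) \<Rightarrow> 'k::field \<Rightarrow> ('i, 'k, 'u::ring_1) quantum_algebra \<Rightarrow> 'i set \<Rightarrow> 'u \<Rightarrow> bool" where
  "highest_weight_vector d q U S w \<longleftrightarrow> w \<in> locally_finite_part U S \<and> w \<noteq> 0 \<and>
     (\<forall>i\<in>S. adL U (Egen U i) w = 0) \<and>
     (\<exists>m :: 'i weight. \<forall>j. adL U (Kgen U j) w = scl U (q powi pair_simple d m j) w)"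

definition levi_submodule :: "('i, 'k::field, 'u::ring_1) quantum_algebra \<Rightarrow> 'i set \<Rightarrow> 'u set \<Rightarrow> bool" where
  "levi_submodule U S N \<longleftrightarrow> module.subspace (scl U) N \<and> (\<forall>a \<in> levi U S. \<forall>x\<in>N. adL U a x \<in> N)"

definition irreducible_levi_submodule ::
    "('i, 'k::field, 'u::ring_1) quantum_algebra \<Rightarrow> 'i set \<Rightarrow> 'u set \<Rightarrow> bool" where
  "irreducible_levi_submodule U S N \<longleftrightarrow> levi_submodule U S N \<and> N \<noteq> {0} \<and>
     (\<forall>N'. levi_submodule U S N' \<and> N' \<subseteq> N \<longrightarrow> N' = {0} \<or> N' = N)"

end

theory Submission
  imports Defs "HOL-Library.Function_Algebras"
begin

text \<open>
  Call a weight vector \<^emph>\<open>singular\<close> if it is killed by the \<open>E\<^sub>i\<close> with \<open>i \<in> S\<close>. The module \<open>M(v)\<close> is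
  finite-dimensional by the choice of \<open>v\<close>, and its weights lie in the root lattice because \<open>U\<close> is spanned by monomials
  in the generators, which are weight vectors for the adjoint action. Two statements about such a module prove the theorem: the
  submodule generated by a singular vector is irreducible (\<open>singular_irreducible\<close>, by way of
  \<open>singular_vector_in_highest_weight_module\<close>), and the singular vectors generate the module (\<open>generated_by_singular_vectors\<close>).

  Both follow from a quantum Casimir operator \<open>\<Omega>\<close>. It commutes with \<open>E\<^sub>i\<close> and \<open>F\<^sub>i\<close> up to explicit powers of \<open>q\<close>
  (\<open>omega_F\<close>, \<open>E_omega\<close>) and fixes singular vectors. If \<open>w\<close> is singular of weight \<open>\<eta>\<close>, it multiplies every vector
  of weight \<open>\<mu>\<close> in the module generated by \<open>w\<close> by \<open>q\<close> to the power \<open>c(\<mu>) - c(\<eta>)\<close>, where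
  \<open>c(\<mu>) = (\<mu>, \<mu> + 2 \<rho>)\<close>. Weights of singular vectors are dominant, and \<open>c(\<mu>) < c(\<eta>)\<close> for dominant weights such that
  \<open>\<eta> - \<mu>\<close> is a nonzero sum of simple roots from \<open>S\<close>. Since \<open>q\<close> is not a root of unity, a singular vector in the
  module generated by \<open>w\<close> must therefore be proportional to \<open>w\<close>. If \<open>u\<close> has maximal height among the weight
  vectors outside the submodule generated by the singular vectors, then \<open>E\<^sub>i u\<close> lies in that submodule and is a
  sum of eigenvectors of \<open>\<Omega>\<close> whose exponents differ from the value of \<open>c\<close> at the weight of \<open>u\<close>; a suitable
  polynomial in \<open>\<Omega>\<close> kills these eigenvectors and turns \<open>u\<close> into a singular vector outside the submodule, a contradiction.

  As in Lusztig's construction, \<open>\<Omega>\<close> is a sum of terms \<open>F\<^sub>a E\<^sub>c\<close> over words \<open>a\<close>, \<open>c\<close>, with coefficients from the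
  inverse of the Gram matrix of a bilinear form on the free algebra. The form may be degenerate, and a pseudo-inverse is used
  instead; this suffices because the radical of the form acts by zero on the modules at hand (\<open>radical_acts_by_zero\<close>).
  Namely, a radical element of least degree \<open>\<beta>\<close> commutes with all \<open>F\<^sub>i\<close>; positivity of \<open>(\<beta>, \<beta>)\<close> yields an \<open>i\<close>
  with \<open>(\<beta>, \<alpha>\<^sub>i) > 0\<close>, and a computation in rank one shows that an operator of weight \<open>\<beta>\<close> that commutes with
  \<open>F\<^sub>i\<close> is zero.

  The Lie algebra enters through the positivity of the symmetrized Cartan matrix
  (\<open>cartan_matrix_positive_definite\<close>), which is deduced from the invariance of the finite set of roots under the
  simple reflections.
\<close>

section \<open>Weight vectors of a family of operators\<close>

context vector_space
begin

text \<open>If \<open>T j\<close> separates the weights \<open>b\<close> and \<open>c\<close>, then \<open>T j - \<chi> c j\<close> removes the component of weight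
  \<open>c\<close> and multiplies the one of weight \<open>b\<close> by a nonzero scalar. This reduces the number of components.\<close>

lemma weight_components_in_stable_subspace:
  assumes N: "subspace N"
    and stable: "\<And>j x. j \<in> J \<Longrightarrow> x \<in> N \<Longrightarrow> T j x \<in> N"
    and lin: "\<And>j. j \<in> J \<Longrightarrow> Vector_Spaces.linear scale scale (T j)"
    and "finite X"
    and "\<And>a b. a \<in> X \<Longrightarrow> b \<in> X \<Longrightarrow> a \<noteq> b \<Longrightarrow> \<exists>j\<in>J. \<chi> a j \<noteq> \<chi> b j"
    and "\<And>a j. a \<in> X \<Longrightarrow> j \<in> J \<Longrightarrow> T j (x a) = scale (\<chi> a j) (x a)"
    and "(\<Sum>a\<in>X. x a) \<in> N"
    and "a \<in> X"
  shows "x a \<in> N"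
  using assms(4-)
proof (induction X arbitrary: x a rule: finite_induct)
  case empty
  then show ?case by simp
next
  case (insert c X)
  have X: "x b \<in> N" if b: "b \<in> X" for b
  proof -
    have "b \<noteq> c" using b insert.hyps by auto
    then obtain j where j: "j \<in> J" "\<chi> b j \<noteq> \<chi> c j"
      using insert.prems(1)[of b c] b by auto
    interpret T: Vector_Spaces.linear scale scale "T j" by (rule lin[OF j(1)])
    define y where "y = (\<lambda>b. scale (\<chi> b j - \<chi> c j) (x b))"
    define s where "s = (\<Sum>a\<in>insert c X. x a)"
    have "T j s = (\<Sum>a\<in>insert c X. scale (\<chi> a j) (x a))"
      unfolding s_def T.sum by (rule sum.cong) (auto simp: insert.prems(2) j(1))
    then have "T j s - scale (\<chi> c j) s = (\<Sum>a\<in>insert c X. y a)"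
      by (simp only: s_def y_def scale_sum_right scale_left_diff_distrib sum_subtractf)
    also have "\<dots> = (\<Sum>a\<in>X. y a)"
      using insert.hyps by (simp add: y_def)
    finally have *: "(\<Sum>a\<in>X. y a) = T j s - scale (\<chi> c j) s" ..
    have "s \<in> N" using insert.prems(3) by (simp add: s_def)
    then have sN: "(\<Sum>a\<in>X. y a) \<in> N"
      unfolding * using N j(1) stable by (simp add: subspace_diff subspace_scale)
    have "y b \<in> N"
    proof (rule insert.IH[OF _ _ sN b])
      show "\<exists>j\<in>J. \<chi> a j \<noteq> \<chi> b j" if "a \<in> X" "b \<in> X" "a \<noteq> b" for a b
        using insert.prems(1) that by auto
      show "T i (y a) = scale (\<chi> a i) (y a)" if "a \<in> X" "i \<in> J" for a i
      proof -
        interpret Ti: Vector_Spaces.linear scale scale "T i" by (rule lin[OF that(2)])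
        show ?thesis using that insert.prems(2)[of a i]
          by (simp add: y_def Ti.scale mult.commute)
      qed
    qed
    then have "scale (inverse (\<chi> b j - \<chi> c j)) (y b) \<in> N"
      by (rule subspace_scale[OF N])
    then show ?thesis using j(2) by (simp add: y_def)
  qed
  have "x c = (\<Sum>a\<in>insert c X. x a) - (\<Sum>a\<in>X. x a)"
    using insert.hyps by simp
  moreover have "(\<Sum>a\<in>insert c X. x a) - (\<Sum>a\<in>X. x a) \<in> N"
    by (rule subspace_diff[OF N insert.prems(3) subspace_sum[OF N X]])
  ultimately show ?case using X insert.prems(4) by auto
qed

text \<open>Nonzero vectors of different weights are linearly independent: apply the previous lemma with
  \<open>N = {0}\<close>.\<close>

lemma finite_weights:
  assumes lin: "\<And>j. j \<in> J \<Longrightarrow> Vector_Spaces.linear scale scale (T j)"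
    and sep: "\<And>a b. a \<noteq> b \<Longrightarrow> \<exists>j\<in>J. \<chi> a j \<noteq> \<chi> b j"
    and B: "finite B"
  shows "finite {a. \<exists>x\<in>span B. x \<noteq> 0 \<and> (\<forall>j\<in>J. T j x = scale (\<chi> a j) x)}" (is "finite ?X")
proof -
  have "\<forall>a\<in>?X. \<exists>x. x \<in> span B \<and> x \<noteq> 0 \<and> (\<forall>j\<in>J. T j x = scale (\<chi> a j) x)" by blast
  then obtain v where v: "\<And>a. a \<in> ?X \<Longrightarrow> v a \<in> span B \<and> v a \<noteq> 0 \<and> (\<forall>j\<in>J. T j (v a) = scale (\<chi> a j) (v a))"
    by (metis (no_types, lifting) bchoice)
  have inj: "inj_on v ?X"
  proof (rule inj_onI, rule ccontr)
    fix a b assume ab: "a \<in> ?X" "b \<in> ?X" "v a = v b" "a \<noteq> b"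
    obtain j where j: "j \<in> J" "\<chi> a j \<noteq> \<chi> b j" using sep ab(4) by blast
    have "scale (\<chi> a j) (v a) = scale (\<chi> b j) (v a)"
      using v[OF ab(1)] v[OF ab(2)] ab(3) j(1) by metis
    then show False using v[OF ab(1)] j(2) by simp
  qed
  have "independent (v ` ?X)"
  proof (rule ccontr)
    assume "\<not> independent (v ` ?X)"
    then obtain t u where t: "finite t" "t \<subseteq> v ` ?X" "(\<Sum>x\<in>t. scale (u x) x) = 0" "\<exists>x\<in>t. u x \<noteq> 0"
      unfolding dependent_explicit by auto
    obtain Y where Y: "Y \<subseteq> ?X" "t = v ` Y" using t(2) by (meson subset_imageE)
    have injY: "inj_on v Y" using inj Y(1) by (rule inj_on_subset)
    have finY: "finite Y" using t(1) Y(2) injY by (simp add: finite_image_iff)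
    have s: "(\<Sum>a\<in>Y. scale (u (v a)) (v a)) \<in> {0}"
      using t(3) unfolding Y(2) by (simp add: sum.reindex[OF injY])
    have "scale (u (v a)) (v a) \<in> {0}" if a: "a \<in> Y" for a
    proof (rule weight_components_in_stable_subspace[where T = T and J = J and \<chi> = \<chi> and X = Y
          and x = "\<lambda>a. scale (u (v a)) (v a)", OF subspace_single_0 _ lin finY _ _ s a])
      show "T j x \<in> {0}" if "j \<in> J" "x \<in> {0}" for j x
      proof -
        interpret Tj: Vector_Spaces.linear scale scale "T j" by (rule lin[OF that(1)])
        show ?thesis using that(2) by (simp add: Tj.zero)
      qed
      show "T j (scale (u (v a)) (v a)) = scale (\<chi> a j) (scale (u (v a)) (v a))"
        if "a \<in> Y" "j \<in> J" for a j
      proof -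
        interpret Tj: Vector_Spaces.linear scale scale "T j" by (rule lin[OF that(2)])
        have "a \<in> ?X" using that(1) Y(1) by blast
        then have "T j (v a) = scale (\<chi> a j) (v a)" using v that(2) by blast
        then show ?thesis by (simp add: Tj.scale mult.commute)
      qed
    qed (use sep in auto)
    moreover have "v a \<noteq> 0" if "a \<in> Y" for a using v that Y(1) by blast
    ultimately have "u (v a) = 0" if "a \<in> Y" for a using that by auto
    then show False using t(4) Y(2) by auto
  qed
  then have "finite (v ` ?X)"
    using independent_span_bound[OF B] v by blast
  then show ?thesis using inj by (simp add: finite_image_iff)
qed

end

section \<open>The symmetrized Cartan matrix is positive definite\<close>

text \<open>Put \<open>p\<^sub>i(n) = (\<Sum>j. A i j * n j)\<close>. The \<open>i\<close>-th reflection permutes \<open>R\<close> and changes the sign of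
  \<open>p\<^sub>i\<close>, whence \<open>2 * (\<Sum>n\<in>R. n k * p\<^sub>i(n))\<close> is \<open>\<kappa>\<^sub>i > 0\<close> for \<open>k = i\<close> and \<open>0\<close> otherwise. For the symmetric matrix
  \<open>Q = (d\<^sub>i A\<^sub>i\<^sub>j)\<close> and \<open>D = diag(d\<^sub>i \<kappa>\<^sub>i)\<close> it follows that twice the Gram matrix of the functions \<open>n \<mapsto> (Q n)\<^sub>i\<close>
  on \<open>R\<close> is \<open>Q D = D Q\<close>. So \<open>Q\<^sub>i\<^sub>j \<noteq> 0\<close> forces \<open>D\<^sub>i = D\<^sub>j\<close>, and after rescaling the coordinates of \<open>z\<close> by
  \<open>D\<^sub>i\<^bsup>-1/2\<^esup>\<close> the quadratic form of \<open>Q\<close> at \<open>z\<close> is twice a sum of squares over \<open>R\<close>.\<close>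

lemma positive_definite_if_reflection_stable:
  fixes A :: "'i::finite \<Rightarrow> 'i \<Rightarrow> int" and R :: "('i \<Rightarrow> int) set" and z :: "'i \<Rightarrow> int"
  assumes sym: "symmetrizes d A"
    and diag: "\<And>i. A i i = 2"
    and fin: "finite R"
    and simple: "\<And>i. (\<lambda>k. if k = i then 1 else 0) \<in> R"
    and stable: "\<And>i n. n \<in> R \<Longrightarrow> (\<lambda>k. n k - (if k = i then \<Sum>j\<in>UNIV. A i j * n j else 0)) \<in> R"
    and z: "z \<noteq> 0"
  shows "0 < (\<Sum>i\<in>UNIV. \<Sum>j\<in>UNIV. z i * z j * (int (d i) * A i j))"
proof -
  define p where "p = (\<lambda>i (n::'i \<Rightarrow> int). \<Sum>j\<in>UNIV. A i j * n j)"
  define s where "s = (\<lambda>i (n::'i \<Rightarrow> int) k. n k - (if k = i then p i n else 0))"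
  have p_s: "p i (s i n) = - p i n" for i n
  proof -
    have "p i (s i n) = (\<Sum>j\<in>UNIV. A i j * n j) - (\<Sum>j\<in>UNIV. if j = i then A i j * p i n else 0)"
      unfolding p_def[of ] s_def sum_subtractf[symmetric]
      by (rule sum.cong) (auto simp: algebra_simps)
    then show ?thesis by (simp add: diag p_def)
  qed
  have ss: "s i (s i n) = n" for i n
    by (rule ext) (use p_s[of i n] in \<open>simp add: s_def\<close>)
  have sR: "s i n \<in> R" if "n \<in> R" for i n
    using stable[OF that, of i] unfolding s_def p_def .
  define \<kappa> where "\<kappa> = (\<lambda>i. \<Sum>n\<in>R. p i n * p i n)"
  have gram: "2 * (\<Sum>n\<in>R. n k * p i n) = (if k = i then \<kappa> i else 0)" for i k
  proof -
    have "(\<Sum>n\<in>R. n k * p i n) = (\<Sum>n\<in>R. s i n k * p i (s i n))"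
      by (rule sum.reindex_bij_witness[where i = "s i" and j = "s i"]) (simp_all add: ss sR)
    also have "\<dots> = (\<Sum>n\<in>R. (if k = i then p i n * p i n else 0) - n k * p i n)"
      by (rule sum.cong) (simp_all add: p_s, simp add: s_def algebra_simps)
    also have "\<dots> = (if k = i then \<kappa> i else 0) - (\<Sum>n\<in>R. n k * p i n)"
      by (simp add: sum_subtractf \<kappa>_def)
    finally show ?thesis by simp
  qed
  have \<kappa>_pos: "\<kappa> i > 0" for i
  proof -
    have "p i (\<lambda>k. if k = i then 1 else 0) = 2"
      using diag by (simp add: p_def if_distrib sum.delta cong: if_cong)
    then show ?thesis unfolding \<kappa>_def
      using fin simple[of i] by (intro sum_pos2[of R "\<lambda>k. if k = i then 1 else 0"]) auto
  qed
  define Q where "Q = (\<lambda>i j. real (d i) * real_of_int (A i j))"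
  define D where "D = (\<lambda>i. real (d i) * real_of_int (\<kappa> i))"
  define P where "P = (\<lambda>i n. real (d i) * real_of_int (p i n))"
  have d_pos: "d i > 0" for i using sym by (simp add: symmetrizes_def)
  have D_pos: "D i > 0" for i using d_pos[of i] \<kappa>_pos[of i] by (simp add: D_def)
  have Q_sym: "Q i j = Q j i" for i j
  proof -
    have "real_of_int (int (d i) * A i j) = real_of_int (int (d j) * A j i)"
      using sym unfolding symmetrizes_def by metis
    then show ?thesis by (simp add: Q_def)
  qed
  have nP: "2 * (\<Sum>n\<in>R. real_of_int (n k) * P i n) = (if k = i then D i else 0)" for i k
  proof -
    have "2 * (\<Sum>n\<in>R. real_of_int (n k) * P i n) = real (d i) * real_of_int (2 * (\<Sum>n\<in>R. n k * p i n))"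
      by (simp add: P_def sum_distrib_left mult_ac)
    then show ?thesis unfolding gram by (simp add: D_def)
  qed
  have PP: "2 * (\<Sum>n\<in>R. P j n * P i n) = Q i j * D i" for i j
  proof -
    have "P j n = (\<Sum>k\<in>UNIV. Q j k * real_of_int (n k))" for n
      by (simp add: P_def Q_def p_def sum_distrib_left mult.assoc)
    then have "2 * (\<Sum>n\<in>R. P j n * P i n) = 2 * (\<Sum>n\<in>R. \<Sum>k\<in>UNIV. Q j k * (real_of_int (n k) * P i n))"
      by (simp add: sum_distrib_right mult.assoc)
    also have "\<dots> = (\<Sum>k\<in>UNIV. Q j k * (2 * (\<Sum>n\<in>R. real_of_int (n k) * P i n)))"
      by (subst sum.swap) (simp add: sum_distrib_left mult_ac)
    also have "\<dots> = Q j i * D i" unfolding nP by (simp add: if_distrib sum.delta cong: if_cong)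
    finally show ?thesis by (simp add: Q_sym)
  qed
  have QD: "Q i j * D i = Q i j * D j" for i j
  proof -
    have "Q i j * D i = 2 * (\<Sum>n\<in>R. P i n * P j n)" unfolding PP[symmetric] by (simp add: mult.commute)
    also have "\<dots> = Q i j * D j" unfolding PP by (simp add: Q_sym[of j i])
    finally show ?thesis .
  qed
  define y where "y = (\<lambda>i. real_of_int (z i) / sqrt (D i))"
  have eq: "2 * (\<Sum>n\<in>R. (\<Sum>i\<in>UNIV. y i * P i n)\<^sup>2)
      = (\<Sum>i\<in>UNIV. \<Sum>j\<in>UNIV. real_of_int (z i) * real_of_int (z j) * Q i j)"
  proof -
    have "(\<Sum>n\<in>R. (\<Sum>i\<in>UNIV. y i * P i n)\<^sup>2)
       = (\<Sum>n\<in>R. \<Sum>i\<in>UNIV. \<Sum>j\<in>UNIV. y i * y j * (P j n * P i n))"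
      unfolding power2_eq_square sum_product
      by (intro sum.cong refl) (simp_all add: mult_ac)
    also have "\<dots> = (\<Sum>i\<in>UNIV. \<Sum>n\<in>R. \<Sum>j\<in>UNIV. y i * y j * (P j n * P i n))"
      by (rule sum.swap)
    also have "\<dots> = (\<Sum>i\<in>UNIV. \<Sum>j\<in>UNIV. \<Sum>n\<in>R. y i * y j * (P j n * P i n))"
      by (rule sum.cong[OF refl], rule sum.swap)
    finally have "2 * (\<Sum>n\<in>R. (\<Sum>i\<in>UNIV. y i * P i n)\<^sup>2)
       = (\<Sum>i\<in>UNIV. \<Sum>j\<in>UNIV. y i * y j * (2 * (\<Sum>n\<in>R. P j n * P i n)))"
      by (simp add: sum_distrib_left mult_ac)
    also have "\<dots> = (\<Sum>i\<in>UNIV. \<Sum>j\<in>UNIV. real_of_int (z i) * real_of_int (z j) * Q i j)"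
    proof (intro sum.cong refl)
      fix i j
      show "y i * y j * (2 * (\<Sum>n\<in>R. P j n * P i n)) = real_of_int (z i) * real_of_int (z j) * Q i j"
      proof (cases "Q i j = 0")
        case False
        then have DD: "D j = D i" using QD[of i j] by simp
        have "sqrt (D i) * sqrt (D i) = D i" using D_pos[of i] by simp
        then show ?thesis unfolding PP y_def DD using D_pos[of i] by (simp add: field_simps)
      qed (simp add: PP)
    qed
    finally show ?thesis .
  qed
  have "(\<Sum>n\<in>R. (\<Sum>i\<in>UNIV. y i * P i n)\<^sup>2) \<noteq> 0"
  proof
    assume "(\<Sum>n\<in>R. (\<Sum>i\<in>UNIV. y i * P i n)\<^sup>2) = 0"
    then have 0: "(\<Sum>i\<in>UNIV. y i * P i n) = 0" if "n \<in> R" for n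
      using that fin by (simp add: sum_nonneg_eq_0_iff)
    have "z k = 0" for k
    proof -
      have "0 = 2 * (\<Sum>n\<in>R. real_of_int (n k) * (\<Sum>i\<in>UNIV. y i * P i n))"
        by (simp add: 0)
      also have "\<dots> = 2 * (\<Sum>n\<in>R. \<Sum>i\<in>UNIV. y i * (real_of_int (n k) * P i n))"
        by (simp add: sum_distrib_left mult_ac)
      also have "\<dots> = (\<Sum>i\<in>UNIV. y i * (2 * (\<Sum>n\<in>R. real_of_int (n k) * P i n)))"
        by (subst sum.swap) (simp add: sum_distrib_left mult_ac)
      also have "\<dots> = y k * D k" unfolding nP by (simp add: if_distrib sum.delta cong: if_cong)
      finally show ?thesis using D_pos[of k] by (simp add: y_def)
    qed
    then show False using z by (simp add: fun_eq_iff)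
  qed
  moreover have "(\<Sum>n\<in>R. (\<Sum>i\<in>UNIV. y i * P i n)\<^sup>2) \<ge> 0" by (rule sum_nonneg) simp
  ultimately have "0 < (\<Sum>i\<in>UNIV. \<Sum>j\<in>UNIV. real_of_int (z i) * real_of_int (z j) * Q i j)"
    using eq by linarith
  also have "\<dots> = real_of_int (\<Sum>i\<in>UNIV. \<Sum>j\<in>UNIV. z i * z j * (int (d i) * A i j))"
    by (simp add: Q_def)
  finally show ?thesis by linarith
qed

context complex_lie_algebra
begin

lemma br_linear: "Vector_Spaces.linear sc sc (br x)"
  by unfold_locales (simp_all add: br_add_right br_scale_right)

lemma br_zero_right: "br x 0 = 0"
  using br_add_right[of x 0 0] by simp

lemma br_antisym: "br x y = - br y x"
proof -
  have "br x y + br y x = 0"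
    using br_self[of "x + y"] unfolding br_add_left br_add_right br_self[of x] br_self[of y] by (simp add: add.commute)
  then show ?thesis by (simp only: eq_neg_iff_add_eq_0)
qed

lemma br_minus_right: "br x (- y) = - br x y"
  using br_add_right[of x y "- y"] by (simp add: br_zero_right eq_neg_iff_add_eq_0 add.commute)

lemma br_minus_left: "br (- x) y = - br x y"
  using br_antisym[of "- x" y] br_antisym[of x y] by (simp add: br_minus_right)

lemma br_leibniz: "br x (br y z) = br (br x y) z + br y (br x z)"
proof -
  have "br y (br z x) = - br y (br x z)"
    by (subst br_antisym[of z x]) (simp add: br_minus_right)
  moreover have "br z (br x y) = - br (br x y) z" by (rule br_antisym)
  ultimately show ?thesis using jacobi[of x y z] by (simp add: add_eq_0_iff algebra_simps)
qed

lemma br_root_space: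
  assumes "e \<in> root_space H \<gamma>" "x \<in> root_space H \<beta>"
  shows "br e x \<in> root_space H (\<lambda>h. \<beta> h + \<gamma> h)"
  using assms
  by (auto simp: root_space_def br_leibniz[of _ e x] br_scale_left br_scale_right scale_left_distrib)

lemma br_root_space_funpow:
  assumes "e \<in> root_space H \<gamma>" "x \<in> root_space H \<beta>"
  shows "(br e ^^ k) x \<in> root_space H (\<lambda>h. \<beta> h + of_nat k * \<gamma> h)"
proof (induction k)
  case (Suc k)
  from br_root_space[OF assms(1) Suc.IH] show ?case by (simp add: algebra_simps)
qed (simp add: assms)

lemma sl2_weight:
  assumes "br t e = sc c e" "br t x = sc a x"
  shows "br t ((br e ^^ k) x) = sc (a + of_nat k * c) ((br e ^^ k) x)"
proof (induction k)
  case (Suc k)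
  have "br t (br e ((br e ^^ k) x)) = br (br t e) ((br e ^^ k) x) + br e (br t ((br e ^^ k) x))"
    by (rule br_leibniz)
  also have "\<dots> = sc c ((br e ^^ Suc k) x) + sc (a + of_nat k * c) ((br e ^^ Suc k) x)"
    by (simp add: Suc.IH assms(1) br_scale_left br_scale_right)
  also have "\<dots> = sc (a + of_nat (Suc k) * c) ((br e ^^ Suc k) x)"
    by (simp add: scale_left_distrib[symmetric] distrib_right add_ac)
  finally show ?case by simp
qed (simp add: assms)

text \<open>Let \<open>y = e\<^sup>k x\<close> be the last nonzero vector of the string through \<open>x\<close>. It has weight \<open>p + 2 k\<close> for
  \<open>t\<close> and is killed by \<open>e\<close>, so \<open>f\<^sup>j y \<noteq> 0\<close> for all \<open>j \<le> p + 2 k\<close>; the vector \<open>f\<^bsup>p + k\<^esup> y\<close> has the reflected weight.\<close>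

lemma reflected_root_space_nonzero:
  assumes e: "e \<in> root_space H \<gamma>" and f: "f \<in> root_space H (\<lambda>h. - \<gamma> h)"
    and ef: "br e f = t" and te: "br t e = sc 2 e" and tf: "br t f = sc (-2) f"
    and x: "x \<in> root_space H \<beta>" "x \<noteq> 0" "br t x = sc (of_nat p) x"
    and nil: "(br e ^^ K) x = 0"
  shows "\<exists>y. y \<noteq> 0 \<and> y \<in> root_space H (\<lambda>h. \<beta> h - of_nat p * \<gamma> h)"
proof -
  define k where "k = (LEAST k. (br e ^^ Suc k) x = 0)"
  have "K \<noteq> 0" using nil x(2) by (metis funpow_0)
  then obtain K' where K': "(br e ^^ Suc K') x = 0" using nil not0_implies_Suc by metis
  then have k0: "(br e ^^ Suc k) x = 0" unfolding k_def by (rule LeastI)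
  define y where "y = (br e ^^ k) x"
  have y0: "y \<noteq> 0"
  proof (cases k)
    case (Suc k')
    then have "k' < (LEAST k. (br e ^^ Suc k) x = 0)" by (simp add: k_def)
    from not_less_Least[OF this] show ?thesis by (simp add: y_def Suc)
  qed (simp add: y_def x)
  have ey: "br e y = 0" using k0 by (simp add: y_def)
  have yr: "y \<in> root_space H (\<lambda>h. \<beta> h + of_nat k * \<gamma> h)"
    unfolding y_def by (rule br_root_space_funpow[OF e x(1)])
  define c where "c = p + 2 * k"
  have ty: "br t y = sc (of_nat c) y"
    using sl2_weight[OF te x(3), of k] by (simp add: y_def c_def mult.commute)
  have tfy: "br t ((br f ^^ j) y) = sc (of_nat c - 2 * of_nat j) ((br f ^^ j) y)" for j
    using sl2_weight[OF tf ty, of j] by (simp add: mult.commute)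
  have efy: "br e ((br f ^^ Suc j) y) = sc (of_nat (Suc j) * (of_nat c - of_nat j)) ((br f ^^ j) y)" for j
  proof (induction j)
    case 0
    show ?case using br_leibniz[of e f y] by (simp add: ef ey br_zero_right ty)
  next
    case (Suc j)
    have "br e ((br f ^^ Suc (Suc j)) y) = br t ((br f ^^ Suc j) y) + br f (br e ((br f ^^ Suc j) y))"
      using br_leibniz[of e f "(br f ^^ Suc j) y"] by (simp add: ef)
    also have "\<dots> = sc (of_nat c - 2 * of_nat (Suc j)) ((br f ^^ Suc j) y)
        + sc (of_nat (Suc j) * (of_nat c - of_nat j)) ((br f ^^ Suc j) y)"
      unfolding tfy Suc.IH br_scale_right by simp
    also have "\<dots> = sc (of_nat (Suc (Suc j)) * (of_nat c - of_nat (Suc j))) ((br f ^^ Suc j) y)"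
      unfolding scale_left_distrib[symmetric] by (rule arg_cong[where f = "\<lambda>c. sc c _"]) (simp add: ring_distribs)
    finally show ?case .
  qed
  have fy: "(br f ^^ j) y \<noteq> 0" if "j \<le> c" for j
    using that
  proof (induction j)
    case (Suc j)
    have "of_nat (Suc j) * (of_nat c - of_nat j) \<noteq> (0::complex)"
      unfolding mult_eq_0_iff right_minus_eq of_nat_eq_iff of_nat_eq_0_iff using Suc.prems by linarith
    moreover have "(br f ^^ j) y \<noteq> 0" using Suc by linarith
    ultimately have "br e ((br f ^^ Suc j) y) \<noteq> 0" unfolding efy scale_eq_0_iff by blast
    then show ?case by (metis br_zero_right)
  qed (simp add: y0)
  have "(br f ^^ (p + k)) y \<in> root_space H (\<lambda>h. \<beta> h - of_nat p * \<gamma> h)"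
    using br_root_space_funpow[OF f yr, of "p + k"] by (simp add: algebra_simps)
  moreover have "(br f ^^ (p + k)) y \<noteq> 0" by (rule fy) (simp add: c_def)
  ultimately show ?thesis by blast
qed

lemma cartan_matrix_coroot:
  "is_cartan_matrix H \<alpha> A \<Longrightarrow> \<exists>t. is_coroot H (\<alpha> i) t \<and> (\<forall>j. \<alpha> j t = of_int (A i j))"
  by (simp add: is_cartan_matrix_def)

lemma cartan_matrix_diagonal:
  assumes "is_cartan_matrix H \<alpha> A"
  shows "A i i = 2"
proof -
  have "of_int (A i i) = (2::complex)" using cartan_matrix_coroot[OF assms, of i] by (auto simp: is_coroot_def)
  then show ?thesis by (metis of_int_eq_iff of_int_numeral)
qed

text \<open>Functionals on \<open>H\<close> that are integer combinations of the simple roots are written as integer vectors;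
  \<open>R\<close> consists of those whose simultaneous eigenspace is nonzero. It is finite because the Lie algebra is
  finite-dimensional, and stable under the simple reflections by \<open>sl\<^sub>2\<close>-theory.\<close>

lemma cartan_matrix_positive_definite:
  fixes A :: "'i::finite \<Rightarrow> 'i \<Rightarrow> int" and z :: "'i \<Rightarrow> int"
  assumes fd: "finite B" "span B = UNIV"
    and simple: "simple_roots H \<alpha>" and cartan: "is_cartan_matrix H \<alpha> A"
    and sym: "symmetrizes d A" and z: "z \<noteq> 0"
  shows "0 < (\<Sum>i\<in>UNIV. \<Sum>j\<in>UNIV. z i * z j * (int (d i) * A i j))"
proof -
  define rt where "rt = (\<lambda>(n::'i \<Rightarrow> int) h. \<Sum>i\<in>UNIV. of_int (n i) * \<alpha> i h)"
  define R where "R = {n. \<exists>x. x \<noteq> 0 \<and> x \<in> root_space H (rt n)}"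
  have indep: "c i = 0" if "\<And>h. h \<in> H \<Longrightarrow> (\<Sum>i\<in>UNIV. c i * \<alpha> i h) = 0" for c i
    using simple that unfolding simple_roots_def by blast
  have "\<exists>h\<in>H. rt n h \<noteq> rt m h" if "n \<noteq> m" for n m
  proof (rule ccontr)
    assume a: "\<not> ?thesis"
    have "of_int (n i - m i) = (0::complex)" for i
    proof (rule indep)
      fix h assume "h \<in> H"
      then have "rt n h = rt m h" using a by blast
      then show "(\<Sum>i\<in>UNIV. of_int (n i - m i) * \<alpha> i h) = 0"
        by (simp add: rt_def algebra_simps sum_subtractf)
    qed
    then show False using that by (simp add: fun_eq_iff)
  qed
  from finite_weights[where J = H and T = br and \<chi> = rt, OF br_linear this fd(1)]
  have fin: "finite R" by (rule rev_finite_subset) (auto simp: R_def root_space_def fd(2))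
  have rt_simple: "rt (\<lambda>k. if k = i then 1 else 0) = \<alpha> i" for i
    by (rule ext) (simp add: rt_def if_distrib if_distribR sum.delta cong: if_cong)
  note coroot = cartan_matrix_coroot[OF cartan] and diag = cartan_matrix_diagonal[OF cartan]
  have sR: "(\<lambda>k. if k = i then 1 else 0) \<in> R" for i
  proof -
    have "is_root H (\<alpha> i)" using simple by (simp add: simple_roots_def)
    then have "root_space H (\<alpha> i) \<noteq> {0}" by (simp add: is_root_def)
    moreover have "0 \<in> root_space H (\<alpha> i)" by (simp add: root_space_def br_zero_right)
    ultimately show ?thesis by (auto simp: R_def rt_simple)
  qed
  have refl: "(\<lambda>k. n k - (if k = i then \<Sum>j\<in>UNIV. A i j * n j else 0)) \<in> R" if n: "n \<in> R" for i n
  proof -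
    obtain t e f where t: "t \<in> H" "\<alpha> i t = 2" "\<And>j. \<alpha> j t = of_int (A i j)"
      and e: "e \<in> root_space H (\<alpha> i)" and f: "f \<in> root_space H (\<lambda>h. - \<alpha> i h)" and ef: "br e f = t"
      using coroot[of i] by (auto simp: is_coroot_def)
    have te: "br t e = sc 2 e" using e t by (auto simp: root_space_def)
    have tf: "br t f = sc (-2) f" using f t by (auto simp: root_space_def)
    obtain x where x: "x \<noteq> 0" "x \<in> root_space H (rt n)" using n by (auto simp: R_def)
    define p where "p = (\<Sum>j\<in>UNIV. A i j * n j)"
    have tx: "br t x = sc (of_int p) x"
      using x(2) t(1) by (simp add: root_space_def rt_def p_def t(3) mult.commute)
    have shift: "(\<lambda>h. rt n h + of_int m * \<alpha> i h) = rt (\<lambda>k. n k + (if k = i then m else 0))" for m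
    proof
      fix h
      have "rt (\<lambda>k. n k + (if k = i then m else 0)) h
          = (\<Sum>k\<in>UNIV. of_int (n k) * \<alpha> k h + (if k = i then of_int m * \<alpha> i h else 0))"
        unfolding rt_def by (rule sum.cong) (simp_all add: distrib_right)
      then show "rt n h + of_int m * \<alpha> i h = rt (\<lambda>k. n k + (if k = i then m else 0)) h"
        by (simp add: sum.distrib rt_def)
    qed
    \<comment> \<open>the vectors obtained by repeated bracketing have pairwise distinct weights\<close>
    have nil: "\<exists>K. (br g ^^ K) x = 0"
      if g: "g \<in> root_space H (\<lambda>h. of_int s * \<alpha> i h)" and s: "s \<noteq> 0" for g s
    proof (rule ccontr)
      assume a: "\<not> ?thesis"
      have "(\<lambda>k. n k + (if k = i then int K * s else 0)) \<in> R" for K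
      proof -
        have "(br g ^^ K) x \<in> root_space H (\<lambda>h. rt n h + of_nat K * (of_int s * \<alpha> i h))"
          by (rule br_root_space_funpow[OF g x(2)])
        also have "(\<lambda>h. rt n h + of_nat K * (of_int s * \<alpha> i h)) = rt (\<lambda>k. n k + (if k = i then int K * s else 0))"
          unfolding shift[symmetric] by (simp add: mult.assoc)
        finally show ?thesis using a by (auto simp: R_def)
      qed
      then have "range (\<lambda>K k. n k + (if k = i then int K * s else 0)) \<subseteq> R" by auto
      then have "finite (range (\<lambda>K k. n k + (if k = i then int K * s else 0)))"
        using fin finite_subset by blast
      moreover have "inj (\<lambda>K k. n k + (if k = i then int K * s else 0))"
      proof (rule injI)
        fix K L assume "(\<lambda>k. n k + (if k = i then int K * s else 0)) = (\<lambda>k. n k + (if k = i then int L * s else 0))"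
        from fun_cong[OF this, of i] show "K = L" using s by simp
      qed
      ultimately show False using finite_imageD infinite_UNIV_nat by blast
    qed
    \<comment> \<open>for \<open>p < 0\<close> the triple \<open>(f, e, - t)\<close> reflects in the same way\<close>
    have "\<exists>y. y \<noteq> 0 \<and> y \<in> root_space H (\<lambda>h. rt n h + of_int (- p) * \<alpha> i h)"
    proof (cases "p \<ge> 0")
      case True
      then obtain m where m: "p = int m" by (metis nonneg_int_cases)
      obtain K where "(br e ^^ K) x = 0" using nil[of e 1] e by auto
      from reflected_root_space_nonzero[OF e f ef te tf x(2,1) _ this, of m] tx m
      show ?thesis by simp
    next
      case False
      then obtain m where m: "p = - int m" by (metis nonpos_int_cases linear)
      obtain K where K: "(br f ^^ K) x = 0" using nil[of f "-1"] f by auto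
      have fe: "br f e = - t" using br_antisym[of f e] ef by simp
      have "e \<in> root_space H (\<lambda>h. - (- \<alpha> i h))" using e by simp
      from reflected_root_space_nonzero[OF f this fe _ _ x(2,1) _ K, of m] tx m te tf
      show ?thesis by (simp add: br_minus_left)
    qed
    then have "(\<lambda>k. n k + (if k = i then - p else 0)) \<in> R" unfolding shift R_def by simp
    also have "(\<lambda>k. n k + (if k = i then - p else 0)) = (\<lambda>k. n k - (if k = i then p else 0))"
      by auto
    finally show ?thesis unfolding p_def .
  qed
  show ?thesis by (rule positive_definite_if_reflection_stable[OF sym diag fin sR refl z])
qed

end

section \<open>A bilinear form on words\<close>

text \<open>Finite formal linear combinations are represented by lists of pairs of a coefficient and an argument, with
  \<open>ev sc \<phi>\<close> for the linear extension of \<open>\<phi>\<close>. A combination has many representations; every statement below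
  is about values of \<open>ev\<close>, which do not see the difference.\<close>

definition ev :: "('k \<Rightarrow> 'v \<Rightarrow> 'v::ab_group_add) \<Rightarrow> ('w \<Rightarrow> 'v) \<Rightarrow> ('k \<times> 'w) list \<Rightarrow> 'v" where
  "ev sc \<phi> x = (\<Sum>(c, w)\<leftarrow>x. sc c (\<phi> w))"

definition lin_ext :: "('w \<Rightarrow> ('k::times \<times> 'v) list) \<Rightarrow> ('k \<times> 'w) list \<Rightarrow> ('k \<times> 'v) list" where
  "lin_ext D x = concat (map (\<lambda>(c, w). map (\<lambda>(a, v). (c * a, v)) (D w)) x)"

lemma ev_simps [simp]:
  "ev sc \<phi> [] = 0"
  "ev sc \<phi> ((c, w) # x) = sc c (\<phi> w) + ev sc \<phi> x"
  "ev sc \<phi> (x @ y) = ev sc \<phi> x + ev sc \<phi> y"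
  by (simp_all add: ev_def)

lemma ev_cong:
  "(\<And>c w. (c, w) \<in> set x \<Longrightarrow> \<phi> w = \<psi> w) \<Longrightarrow> ev sc \<phi> x = ev sc \<psi> x"
  unfolding ev_def by (intro arg_cong[where f = sum_list] map_cong) auto

lemma ev_zero:
  "(\<And>c. sc c 0 = 0) \<Longrightarrow> (\<And>c w. (c, w) \<in> set x \<Longrightarrow> \<phi> w = 0) \<Longrightarrow> ev sc \<phi> x = 0"
proof -
  assume 0: "\<And>c. sc c 0 = 0" and "\<And>c w. (c, w) \<in> set x \<Longrightarrow> \<phi> w = 0"
  then have "ev sc \<phi> x = ev sc (\<lambda>w. 0) x" by (intro ev_cong)
  also have "\<dots> = 0" by (induction x) (auto simp: 0)
  finally show ?thesis .
qed

lemma ev_linear_image: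
  assumes "Vector_Spaces.linear sc sc' f"
  shows "f (ev sc \<phi> x) = ev sc' (\<lambda>w. f (\<phi> w)) x"
proof -
  interpret f: Vector_Spaces.linear sc sc' f by fact
  show ?thesis by (induction x) (auto simp: f.zero f.add f.scale)
qed

lemma vector_space_mult: "vector_space ((*) :: 'k::field \<Rightarrow> 'k \<Rightarrow> 'k)"
  by unfold_locales (simp_all add: algebra_simps)

context vector_space
begin

lemma ev_zero_fun [simp]: "ev scale (\<lambda>w. 0) x = 0"
  by (rule ev_zero) simp_all

lemma ev_scale: "ev scale (\<lambda>w. scale c (\<phi> w)) x = scale c (ev scale \<phi> x)"
  by (induction x) (auto simp: scale_right_distrib mult.commute)

lemma ev_add: "ev scale (\<lambda>w. \<phi> w + \<psi> w) x = ev scale \<phi> x + ev scale \<psi> x"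
  by (induction x) (auto simp: scale_right_distrib)

lemma ev_diff: "ev scale (\<lambda>w. \<phi> w - \<psi> w) x = ev scale \<phi> x - ev scale \<psi> x"
  by (induction x) (auto simp: scale_right_diff_distrib)

lemma ev_map: "ev scale \<phi> (map (\<lambda>(c, v). (a * c, f v)) x) = scale a (ev scale (\<lambda>v. \<phi> (f v)) x)"
  by (induction x) (auto simp: scale_right_distrib)

lemma ev_map': "ev scale \<phi> (map (\<lambda>(c, v). (c, f v)) x) = ev scale (\<lambda>v. \<phi> (f v)) x"
  by (induction x) auto

lemma ev_lin_ext: "ev scale \<phi> (lin_ext D x) = ev scale (\<lambda>w. ev scale \<phi> (D w)) x"
  by (induction x) (auto simp: lin_ext_def ev_map[where f = "\<lambda>v. v"])

lemma ev_swap: "ev scale (\<lambda>u. ev scale (\<lambda>v. \<phi> u v) y) x = ev scale (\<lambda>v. ev scale (\<lambda>u. \<phi> u v) x) y"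
  by (induction x) (auto simp: ev_add ev_scale)

lemma ev_in_subspace:
  assumes "subspace N" "\<And>c w. (c, w) \<in> set x \<Longrightarrow> \<phi> w \<in> N"
  shows "ev scale \<phi> x \<in> N"
  using assms(2)
proof (induction x)
  case (Cons p x)
  obtain c w where p: "p = (c, w)" by (cases p)
  have "ev scale \<phi> x \<in> N" by (rule Cons.IH) (use Cons.prems in auto)
  moreover have "\<phi> w \<in> N" using Cons.prems[of c w] by (simp add: p)
  ultimately show ?case by (simp add: p subspace_add subspace_scale assms(1))
qed (simp add: subspace_0 assms(1))

end

text \<open>\<open>\<Theta>\<close> is the matrix of a linear right inverse of \<open>G\<close> over the range of \<open>G\<close>.\<close>

lemma matrix_pseudo_inverse:
  fixes G :: "'w \<Rightarrow> 'w \<Rightarrow> 'k::field"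
  assumes X: "finite X"
  shows "\<exists>\<Theta>. \<forall>a\<in>X. \<forall>c\<in>X. (\<Sum>b\<in>X. \<Sum>b'\<in>X. G a b * \<Theta> b b' * G b' c) = G a c"
proof -
  define s where "s = (\<lambda>(c::'k) (f::'w \<Rightarrow> 'k) x. c * f x)"
  interpret V: vector_space s
    by unfold_locales (auto simp: s_def fun_eq_iff algebra_simps)
  interpret P: vector_space_pair s s by unfold_locales
  define L where "L = (\<lambda>(f::'w \<Rightarrow> 'k) a. if a \<in> X then \<Sum>b\<in>X. G a b * f b else 0)"
  define \<delta> where "\<delta> = (\<lambda>(c::'w) a. if a = c then 1 else (0::'k))"
  have L: "Vector_Spaces.linear s s L"
    by unfold_locales
      (auto simp: L_def s_def fun_eq_iff algebra_simps sum.distrib sum_distrib_left)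
  from P.linear_exists_right_inverse_on[OF L V.subspace_UNIV] obtain g
    where g: "Vector_Spaces.linear s s g" "\<And>v. v \<in> range L \<Longrightarrow> L (g v) = v" by auto
  interpret g: Vector_Spaces.linear s s g by fact
  have "(\<Sum>b\<in>X. \<Sum>b'\<in>X. G a b * g (\<delta> b') b * G b' c) = G a c" if a: "a \<in> X" and c: "c \<in> X" for a c
  proof -
    have Lc: "L (\<delta> c) = (\<Sum>b'\<in>X. s (G b' c) (\<delta> b'))"
    proof
      fix x
      have "L (\<delta> c) x = (if x \<in> X then G x c else 0)"
        using X c by (simp add: L_def \<delta>_def if_distrib sum.delta cong: if_cong)
      also have "\<dots> = (\<Sum>b'\<in>X. if x = b' then G b' c else 0)" using X by (simp add: sum.delta)
      also have "\<dots> = (\<Sum>b'\<in>X. s (G b' c) (\<delta> b') x)"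
        by (rule sum.cong) (simp_all add: s_def \<delta>_def)
      also have "\<dots> = (\<Sum>b'\<in>X. s (G b' c) (\<delta> b')) x"
        using X by (induction X rule: finite_induct) simp_all
      finally show "L (\<delta> c) x = (\<Sum>b'\<in>X. s (G b' c) (\<delta> b')) x" .
    qed
    have eval: "(\<Sum>b'\<in>X. f b') x = (\<Sum>b'\<in>X. f b' x)" for f :: "'w \<Rightarrow> 'w \<Rightarrow> 'k" and x
      using X by (induction X rule: finite_induct) simp_all
    have "G a c = L (\<delta> c) a"
      using X a c by (simp add: L_def \<delta>_def if_distrib sum.delta cong: if_cong)
    also have "L (\<delta> c) = L (g (L (\<delta> c)))"
      using g(2)[of "L (\<delta> c)"] by simp
    also have "g (L (\<delta> c)) = (\<Sum>b'\<in>X. s (G b' c) (g (\<delta> b')))"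
      unfolding Lc g.sum g.scale ..
    also have "L \<dots> a = (\<Sum>b\<in>X. \<Sum>b'\<in>X. G a b * g (\<delta> b') b * G b' c)"
      using a by (simp add: L_def eval s_def sum_distrib_left mult_ac)
    finally show ?thesis ..
  qed
  then show ?thesis by (intro exI[of _ "\<lambda>b b'. g (\<delta> b') b"]) blast
qed

lemmas scalar_ev_map = vector_space.ev_map[OF vector_space_mult]
  and scalar_ev_map' = vector_space.ev_map'[OF vector_space_mult]
  and scalar_ev_add = vector_space.ev_add[OF vector_space_mult]
  and scalar_ev_scale = vector_space.ev_scale[OF vector_space_mult]
  and scalar_ev_swap = vector_space.ev_swap[OF vector_space_mult]
  and scalar_ev_zero_fun [simp] = vector_space.ev_zero_fun[OF vector_space_mult]

text \<open>Words are the monomials of a free algebra whose letters are the simple roots, paired by \<open>b\<close>.\<close>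

locale quantum_words =
  fixes q :: "'k::field" and b :: "'i \<Rightarrow> 'i \<Rightarrow> int"
  assumes q_nonzero: "q \<noteq> 0" and b_sym: "b i j = b j i"
begin

lemma powi_add: "q powi (m + n) = q powi m * q powi n"
  by (rule power_int_add) (simp add: q_nonzero)

definition wpair :: "'i list \<Rightarrow> 'i \<Rightarrow> int" where
  "wpair w i = (\<Sum>j\<leftarrow>w. b j i)"

lemma wpair_simps [simp]: "wpair [] i = 0" "wpair (j # w) i = b j i + wpair w i"
    "wpair (v @ w) i = wpair v i + wpair w i"
  by (simp_all add: wpair_def)

lemma wpair_mset: "mset v = mset w \<Longrightarrow> wpair v i = wpair w i"
  unfolding wpair_def by (metis mset_map sum_mset_sum_list)

text \<open>The two twisted derivations that delete a letter \<open>i\<close>: a deleted occurrence is weighted by \<open>q\<close> to the power of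
  the pairing of \<open>\<alpha>\<^sub>i\<close> with the part of the word to its left (\<open>lder\<close>) or to its right (\<open>rder\<close>). They appear in
  the commutator of a word in the \<open>E j\<close> with \<open>F i\<close>.\<close>

primrec lder :: "'i \<Rightarrow> 'i list \<Rightarrow> ('k \<times> 'i list) list" where
  "lder i [] = []"
| "lder i (j # w) = (if i = j then [(1, w)] else []) @ map (\<lambda>(c, v). (q powi b i j * c, j # v)) (lder i w)"

primrec rder :: "'i \<Rightarrow> 'i list \<Rightarrow> ('k \<times> 'i list) list" where
  "rder i [] = []"
| "rder i (j # w) = (if i = j then [(q powi wpair w i, w)] else []) @ map (\<lambda>(c, v). (c, j # v)) (rder i w)"

lemma mset_lder: "(c, v) \<in> set (lder i w) \<Longrightarrow> mset w = add_mset i (mset v)"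
  by (induction w arbitrary: c v) (auto split: if_splits)

lemma mset_rder: "(c, v) \<in> set (rder i w) \<Longrightarrow> mset w = add_mset i (mset v)"
  by (induction w arbitrary: c v) (auto split: if_splits)

text \<open>Lusztig's bilinear form on the free algebra (up to normalization), determined by the requirement that
  left multiplication by a letter is adjoint to \<open>lder\<close>.\<close>

primrec word_form :: "'i list \<Rightarrow> 'i list \<Rightarrow> 'k" where
  "word_form [] = (\<lambda>w. if w = [] then 1 else 0)"
| "word_form (i # a) = (\<lambda>w. ev (*) (word_form a) (lder i w))"

lemma word_form_eq_0: "mset a \<noteq> mset w \<Longrightarrow> word_form a w = 0"
proof (induction a arbitrary: w)
  case (Cons i a)
  show ?case unfolding word_form.simps
  proof (rule ev_zero)
    fix c v assume "(c, v) \<in> set (lder i w)"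
    from mset_lder[OF this] show "word_form a v = 0" using Cons by auto
  qed simp
qed auto

text \<open>A power of \<open>q\<close> involving both deleted letters arises only if \<open>j\<close> stands to the left of \<open>i\<close>, and then
  exactly once: it is contributed by the derivation that acts first.\<close>

lemma lder_rder_commute:
  "ev (*) (\<lambda>v. ev (*) \<phi> (lder i v)) (rder j w) = ev (*) (\<lambda>v. ev (*) \<phi> (rder j v)) (lder i w)"
proof (induction w arbitrary: \<phi>)
  case (Cons k w)
  have shift: "ev (*) (\<lambda>v. q powi wpair v j * \<phi> v) (lder i w)
      = q powi (wpair w j - b i j) * ev (*) \<phi> (lder i w)"
  proof -
    have "ev (*) (\<lambda>v. q powi wpair v j * \<phi> v) (lder i w)
        = ev (*) (\<lambda>v. q powi (wpair w j - b i j) * \<phi> v) (lder i w)"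
    proof (rule ev_cong)
      fix c v assume "(c, v) \<in> set (lder i w)"
      then have "wpair w j = wpair (i # v) j" by (intro wpair_mset) (simp add: mset_lder)
      then show "q powi wpair v j * \<phi> v = q powi (wpair w j - b i j) * \<phi> v" by simp
    qed
    then show ?thesis by (simp add: scalar_ev_scale)
  qed
  let ?\<psi> = "\<lambda>v. \<phi> (k # v)"
  have "ev (*) (\<lambda>v. ev (*) \<phi> (lder i v)) (rder j (k # w))
      = (if j = k then q powi wpair w j * ev (*) \<phi> (lder i w) else 0)
        + ev (*) (\<lambda>v. ev (*) \<phi> (lder i (k # v))) (rder j w)"
    by (simp add: scalar_ev_map' del: lder.simps)
  also have "ev (*) (\<lambda>v. ev (*) \<phi> (lder i (k # v))) (rder j w)
      = (if i = k then ev (*) \<phi> (rder j w) else 0)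
        + q powi b i k * ev (*) (\<lambda>v. ev (*) ?\<psi> (lder i v)) (rder j w)"
    by (simp add: scalar_ev_map scalar_ev_add scalar_ev_scale)
  finally have 1: "ev (*) (\<lambda>v. ev (*) \<phi> (lder i v)) (rder j (k # w))
      = (if j = k then q powi wpair w j * ev (*) \<phi> (lder i w) else 0)
        + ((if i = k then ev (*) \<phi> (rder j w) else 0)
        + q powi b i k * ev (*) (\<lambda>v. ev (*) ?\<psi> (lder i v)) (rder j w))"
    by simp
  have "ev (*) (\<lambda>v. ev (*) \<phi> (rder j v)) (lder i (k # w))
      = (if i = k then ev (*) \<phi> (rder j w) else 0)
        + q powi b i k * ev (*) (\<lambda>v. ev (*) \<phi> (rder j (k # v))) (lder i w)"
    by (simp add: scalar_ev_map del: rder.simps)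
  also have "ev (*) (\<lambda>v. ev (*) \<phi> (rder j (k # v))) (lder i w)
      = (if j = k then q powi (wpair w j - b i j) * ev (*) \<phi> (lder i w) else 0)
        + ev (*) (\<lambda>v. ev (*) ?\<psi> (rder j v)) (lder i w)"
    using shift by (auto simp: scalar_ev_map' scalar_ev_add)
  finally have 2: "ev (*) (\<lambda>v. ev (*) \<phi> (rder j v)) (lder i (k # w))
      = (if i = k then ev (*) \<phi> (rder j w) else 0)
        + q powi b i k * ((if j = k then q powi (wpair w j - b i j) * ev (*) \<phi> (lder i w) else 0)
        + ev (*) (\<lambda>v. ev (*) ?\<psi> (rder j v)) (lder i w))" .
  have pw: "q powi b i m * (q powi (n - b i m) * x) = q powi n * x" for m n x
    unfolding mult.assoc[symmetric] powi_add[symmetric] by simp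
  show ?case unfolding 1 2 Cons.IH[of ?\<psi>] by (simp add: distrib_left pw)
qed simp

text \<open>Right multiplication by a letter is adjoint to \<open>rder\<close>.\<close>

lemma word_form_snoc: "word_form (a @ [i]) w = ev (*) (word_form a) (rder i w)"
proof (induction a arbitrary: w)
  case Nil
  show ?case by (cases w) (auto simp: scalar_ev_map scalar_ev_map')
next
  case (Cons j a)
  have "word_form ((j # a) @ [i]) w = ev (*) (word_form (a @ [i])) (lder j w)" by simp
  also have "\<dots> = ev (*) (\<lambda>v. ev (*) (word_form a) (rder i v)) (lder j w)"
    by (rule ev_cong) (rule Cons.IH)
  also have "\<dots> = ev (*) (word_form (j # a)) (rder i w)"
    by (simp add: lder_rder_commute)
  finally show ?case .
qed

lemma word_form_cons_right: "word_form a (j # w) = ev (*) (\<lambda>v. word_form v w) (lder j a)"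
proof (induction a arbitrary: w j)
  case (Cons i a)
  have "ev (*) (\<lambda>v. word_form a (j # v)) (lder i w)
      = ev (*) (\<lambda>u. ev (*) (\<lambda>v. word_form u v) (lder i w)) (lder j a)"
    unfolding Cons.IH by (rule scalar_ev_swap)
  then show ?case
    by (auto simp: scalar_ev_map b_sym[of j i])
qed simp

lemma word_form_sym: "word_form a w = word_form w a"
proof (induction a arbitrary: w)
  case Nil
  show ?case by (cases w) auto
next
  case (Cons i a)
  have "word_form (i # a) w = ev (*) (\<lambda>v. word_form v a) (lder i w)"
    unfolding word_form.simps by (rule ev_cong) (rule Cons.IH)
  also have "\<dots> = word_form w (i # a)" by (rule word_form_cons_right[symmetric])
  finally show ?case .
qed

definition words :: "'i set \<Rightarrow> nat \<Rightarrow> 'i list set" where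
  "words S n = {w. set w \<subseteq> S \<and> length w = n}"

lemma finite_words: "finite S \<Longrightarrow> finite (words S n)"
  unfolding words_def by (rule finite_lists_length_eq)

text \<open>The form may be degenerate and then has no dual bases; a pseudo-inverse of its Gram matrix in each length takes
  their place. Words of different content are orthogonal, which allows \<open>\<Theta>\<close> to be block diagonal as well.\<close>

lemma pseudo_inverse_exists:
  assumes S: "finite S"
  shows "\<exists>\<Theta>. (\<forall>a c. mset a \<noteq> mset c \<longrightarrow> \<Theta> a c = 0) \<and>
    (\<forall>n. \<forall>a\<in>words S n. \<forall>c\<in>words S n.
      (\<Sum>x\<in>words S n. \<Sum>y\<in>words S n. word_form a x * \<Theta> x y * word_form y c) = word_form a c)"
proof -
  have "\<forall>n. \<exists>\<Theta>. \<forall>a\<in>words S n. \<forall>c\<in>words S n.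
      (\<Sum>x\<in>words S n. \<Sum>y\<in>words S n. word_form a x * \<Theta> x y * word_form y c) = word_form a c"
    using matrix_pseudo_inverse[OF finite_words[OF S]] by blast
  from choice[OF this] obtain T where T: "\<And>n a c. a \<in> words S n \<Longrightarrow> c \<in> words S n \<Longrightarrow>
      (\<Sum>x\<in>words S n. \<Sum>y\<in>words S n. word_form a x * T n x y * word_form y c) = word_form a c"
    by blast
  define \<Theta> where "\<Theta> = (\<lambda>x y. if mset x = mset y then T (length x) x y else 0)"
  have "(\<Sum>x\<in>words S n. \<Sum>y\<in>words S n. word_form a x * \<Theta> x y * word_form y c) = word_form a c"
    if "a \<in> words S n" "c \<in> words S n" for n a c
  proof (cases "mset a = mset c")
    case True
    have "(\<Sum>x\<in>words S n. \<Sum>y\<in>words S n. word_form a x * \<Theta> x y * word_form y c)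
        = (\<Sum>x\<in>words S n. \<Sum>y\<in>words S n. word_form a x * T n x y * word_form y c)"
    proof (intro sum.cong refl)
      fix x y assume "x \<in> words S n"
      then show "word_form a x * \<Theta> x y * word_form y c = word_form a x * T n x y * word_form y c"
        using True word_form_eq_0[of a x] word_form_eq_0[of y c]
        by (cases "mset a = mset x"; cases "mset y = mset c") (auto simp: \<Theta>_def words_def)
    qed
    then show ?thesis using T that by simp
  next
    case False
    then have "word_form a x * \<Theta> x y * word_form y c = 0" for x y
      using word_form_eq_0[of a x] word_form_eq_0[of y c]
      by (cases "mset a = mset x"; cases "mset y = mset c") (auto simp: \<Theta>_def)
    then show ?thesis using word_form_eq_0[OF False] by (simp only: sum.neutral_const)
  qed
  then show ?thesis by (intro exI[of _ \<Theta>]) (auto simp: \<Theta>_def)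
qed

end

section \<open>Weight modules\<close>

text \<open>Root lattice elements are integer vectors in the basis of the simple roots; this is \<open>m \<alpha>\<^sub>i\<close>.\<close>

definition nroot :: "'i \<Rightarrow> int \<Rightarrow> 'i \<Rightarrow> int" where
  "nroot i m = (\<lambda>j. if j = i then m else 0)"

text \<open>The weight of a word of simple roots.\<close>

definition content :: "'i list \<Rightarrow> 'i \<Rightarrow> int" where
  "content w = (\<lambda>i. int (count_list w i))"

definition height :: "('i::finite \<Rightarrow> int) \<Rightarrow> int" where
  "height z = (\<Sum>i\<in>UNIV. z i)"

text \<open>The numerator of the quantum integer \<open>[n]\<close>.\<close>

definition qdiff :: "'k::field \<Rightarrow> int \<Rightarrow> 'k" where
  "qdiff q n = q powi n - q powi (- n)"

text \<open>The pairing of the root lattice element \<open>z\<close> with \<open>\<alpha>\<^sub>i\<close>.\<close>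

definition root_pair :: "('i::finite \<Rightarrow> 'i \<Rightarrow> int) \<Rightarrow> ('i \<Rightarrow> int) \<Rightarrow> 'i \<Rightarrow> int" where
  "root_pair b z i = (\<Sum>j\<in>UNIV. z j * b j i)"

lemma nroot_0 [simp]: "nroot i 0 = 0"
  by (auto simp: nroot_def fun_eq_iff)

lemma content_simps: "content [] = 0" "content (j # w) = nroot j 1 + content w"
    "content (v @ w) = content v + content w"
  by (auto simp: content_def nroot_def fun_eq_iff count_list_append)

lemma content_mset: "content w i = int (count (mset w) i)"
  by (induction w) (simp_all add: content_def)

lemma content_cong: "mset v = mset w \<Longrightarrow> content v = content w"
  by (auto simp: content_mset fun_eq_iff)

lemma height_simps [simp]: "height (x + y) = height x + height y" "height (x - y) = height x - height y"
    "height (- x) = - height x" "height (nroot i m) = m" "height 0 = 0"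
  by (auto simp: height_def sum.distrib sum_subtractf sum_negf nroot_def sum.delta)

lemma height_content [simp]: "height (content w) = int (length w)"
  by (induction w) (simp_all only: content_simps height_simps list.size of_nat_Suc of_nat_0)

lemma root_pair_simps [simp]:
  "root_pair b (x + y) i = root_pair b x i + root_pair b y i"
  "root_pair b (x - y) i = root_pair b x i - root_pair b y i"
  "root_pair b (- x) i = - root_pair b x i"
  "root_pair b 0 i = 0"
  "root_pair b (nroot j m) i = m * b j i"
  by (auto simp: root_pair_def sum.distrib sum_subtractf sum_negf distrib_right left_diff_distrib nroot_def
      if_distribR if_distrib sum.delta cong: if_cong)

lemma qdiff_0 [simp]: "qdiff q 0 = 0"
  by (simp add: qdiff_def)

lemma qdiff_minus [simp]: "qdiff q (- n) = - qdiff q n"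
  by (simp add: qdiff_def)

lemma qdiff_eq_0_iff:
  assumes "q \<noteq> 0" "\<And>n::nat. n > 0 \<Longrightarrow> q ^ n \<noteq> 1"
  shows "qdiff q n = 0 \<longleftrightarrow> n = 0"
proof
  have *: False if "n > 0" "qdiff q n = 0" for n
  proof -
    have "q powi n = q powi (- n)" using that by (simp add: qdiff_def)
    then have "q powi n * q powi n = q powi (- n) * q powi n" by simp
    then have "q powi (n + n) = 1" using assms(1) by (simp add: power_int_add[symmetric])
    moreover have "q powi (n + n) = q ^ nat (n + n)"
      using that by (simp add: power_int_def)
    ultimately show False using assms(2)[of "nat (n + n)"] that by simp
  qed
  assume "qdiff q n = 0"
  then show "n = 0" using *[of n] *[of "- n"] by (cases n "0 :: int" rule: linorder_cases) auto
qed simp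

lemma powi_eq_iff:
  assumes "q \<noteq> 0" "\<And>n::nat. n > 0 \<Longrightarrow> q ^ n \<noteq> (1::'k::field)"
  shows "q powi m = q powi n \<longleftrightarrow> m = n"
proof
  have *: False if "m > n" "q powi m = q powi n" for m n
  proof -
    have "q powi (m - n) = 1" using that assms(1) by (simp add: power_int_diff)
    then show False using assms(2)[of "nat (m - n)"] that by (simp add: power_int_def)
  qed
  assume "q powi m = q powi n"
  then show "m = n" using *[of n m] *[of m n] by (cases m n rule: linorder_cases) auto
qed simp

text \<open>The sum telescopes, as \<open>qdiff q x * qdiff q y = C (x + y) - C (x - y)\<close> for \<open>C n = q powi n + q powi (- n)\<close>.
  With \<open>s = \<plusminus> d i\<close> these are the coefficients that occur when a power of \<open>E i\<close> is moved past \<open>F i\<close>, or conversely.\<close>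

lemma qdiff_sum:
  assumes q: "q \<noteq> 0"
  shows "(\<Sum>j<k. qdiff q (n + 2 * int j * s)) * qdiff q s = qdiff q (int k * s) * qdiff q (n + (int k - 1) * s)"
proof -
  define C where "C = (\<lambda>n. q powi n + q powi (- n))"
  have prod: "qdiff q x * qdiff q y = C (x + y) - C (x - y)" for x y
    using q by (simp add: C_def qdiff_def algebra_simps power_int_add[symmetric] power_int_diff)
  have "(\<Sum>j<k. qdiff q (n + 2 * int j * s)) * qdiff q s = C (n + 2 * int k * s - s) - C (n - s)"
  proof (induction k)
    case (Suc k)
    have e: "n + 2 * int (Suc k) * s - s = n + 2 * int k * s + s" by (simp add: algebra_simps)
    show ?case using Suc prod[of "n + 2 * int k * s" s] unfolding e by (simp add: distrib_right)
  qed simp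
  also have "C (n - s) = C (int k * s - (n + (int k - 1) * s))"
  proof -
    have "int k * s - (n + (int k - 1) * s) = - (n - s)" by (simp add: algebra_simps)
    then show ?thesis unfolding C_def by (simp only: minus_minus add.commute)
  qed
  also have "C (n + 2 * int k * s - s) = C (int k * s + (n + (int k - 1) * s))"
    by (rule arg_cong[where f = C]) (simp add: algebra_simps)
  finally show ?thesis by (simp only: prod)
qed

text \<open>A finite sum of weight spaces \<open>W z\<close>, \<open>z\<close> in the root lattice, on which \<open>E i\<close> and \<open>F i\<close> (\<open>i \<in> S\<close>) satisfy
  the commutation relations of the quantum group. The torus is encoded in the grading: \<open>K\<^sub>i\<close> would be the scalar
  \<open>q powi root_pair b z i\<close> on \<open>W z\<close>.\<close>

locale weight_module = vector_space scale + quantum_words q b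
  for scale :: "'k::field \<Rightarrow> 'v::ab_group_add \<Rightarrow> 'v" and q :: 'k and b :: "'i::finite \<Rightarrow> 'i \<Rightarrow> int" +
  fixes d :: "'i \<Rightarrow> nat" and S :: "'i set" and E F :: "'i \<Rightarrow> 'v \<Rightarrow> 'v"
    and W :: "('i \<Rightarrow> int) \<Rightarrow> 'v set"
  assumes q_not_root: "n > 0 \<Longrightarrow> q ^ n \<noteq> 1"
    and d_pos: "d i > 0"
    and b_diag: "b i i = 2 * int (d i)"
    and b_pos: "z \<noteq> 0 \<Longrightarrow> 0 < (\<Sum>i\<in>UNIV. \<Sum>j\<in>UNIV. z i * z j * b i j)"
    and E_linear: "Vector_Spaces.linear scale scale (E i)"
    and F_linear: "Vector_Spaces.linear scale scale (F i)"
    and W_subspace: "subspace (W z)"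
    and E_weight: "i \<in> S \<Longrightarrow> u \<in> W z \<Longrightarrow> E i u \<in> W (z + nroot i 1)"
    and F_weight: "i \<in> S \<Longrightarrow> u \<in> W z \<Longrightarrow> F i u \<in> W (z - nroot i 1)"
    and commutator: "i \<in> S \<Longrightarrow> j \<in> S \<Longrightarrow> u \<in> W z \<Longrightarrow> E i (F j u) - F j (E i u) =
      (if i = j then scale (qdiff q (root_pair b z i) / qdiff q (int (d i))) u else 0)"
    and W_finite: "finite {z. W z \<noteq> {0}}"
    and W_indep: "finite X \<Longrightarrow> (\<And>z. z \<in> X \<Longrightarrow> x z \<in> W z) \<Longrightarrow> (\<Sum>z\<in>X. x z) = 0 \<Longrightarrow> z \<in> X \<Longrightarrow> x z = 0"
begin

abbreviation pr where "pr \<equiv> root_pair b"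
abbreviation h where "h i \<equiv> qdiff q (int (d i))"

sublocale E: Vector_Spaces.linear scale scale "E i" for i by (rule E_linear)
sublocale F: Vector_Spaces.linear scale scale "F i" for i by (rule F_linear)

lemma qdiff_zero_iff: "qdiff q n = 0 \<longleftrightarrow> n = 0"
  by (rule qdiff_eq_0_iff[OF q_nonzero q_not_root])

lemma h_nonzero: "h i \<noteq> 0"
  using d_pos[of i] by (simp add: qdiff_zero_iff)

lemma pr_content [simp]: "pr (content w) i = wpair w i"
  by (induction w) (simp_all only: content_simps root_pair_simps wpair_simps mult_1)

lemma W_cong: "u \<in> W z \<Longrightarrow> (\<And>j. z j = z' j) \<Longrightarrow> u \<in> W z'"
  by (metis ext)

text \<open>The Chevalley involution: it turns each statement about words in \<open>E\<close> into one about words in \<open>F\<close>.\<close>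

lemma chevalley_swap: "weight_module scale q b d S F E (\<lambda>z. W (- z))"
proof
  show "F j u \<in> W (- (z + nroot j 1))" if "j \<in> S" "u \<in> W (- z)" for j u z
    using F_weight[OF that] by simp
  show "E j u \<in> W (- (z - nroot j 1))" if "j \<in> S" "u \<in> W (- z)" for j u z
    using E_weight[OF that] by (simp add: add.commute)
  show "F i (E j u) - E j (F i u) =
      (if i = j then scale (qdiff q (pr z i) / h i) u else 0)"
    if "i \<in> S" "j \<in> S" "u \<in> W (- z)" for i j u z
  proof -
    have "F i (E j u) - E j (F i u) = - (E j (F i u) - F i (E j u))" by simp
    then show ?thesis using commutator[OF that(2,1,3)] by auto
  qed
  show "finite {z. W (- z) \<noteq> {0}}"
    using finite_vimageI[OF W_finite, of uminus] by (simp add: vimage_def inj_on_def)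
  show "x z = 0" if "finite X" "\<And>z. z \<in> X \<Longrightarrow> x z \<in> W (- z)" "(\<Sum>z\<in>X. x z) = 0" "z \<in> X" for X x z
  proof -
    have "x (- (- z)) = 0"
      by (rule W_indep[of "uminus ` X" "\<lambda>z. x (- z)"]) (use that in \<open>auto simp: sum.reindex inj_on_def\<close>)
    then show ?thesis by simp
  qed
qed (fact q_not_root d_pos b_diag b_pos F.add F.scale E.add E.scale W_subspace)+

lemma height_bounded: "\<exists>B. \<forall>z. \<bar>height z\<bar> > B \<longrightarrow> W z = {0}"
proof (intro exI allI impI)
  fix z :: "'i \<Rightarrow> int" assume z: "\<bar>height z\<bar> > Max (insert 0 ((\<lambda>z. \<bar>height z\<bar>) ` {z. W z \<noteq> {0}}))"
  show "W z = {0}"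
  proof (rule ccontr)
    assume "W z \<noteq> {0}"
    then have "\<bar>height z\<bar> \<le> Max (insert 0 ((\<lambda>z. \<bar>height z\<bar>) ` {z. W z \<noteq> {0}}))"
      using W_finite by (intro Max_ge) auto
    then show False using z by simp
  qed
qed

lemma E_word_linear: "Vector_Spaces.linear scale scale (foldr E w)"
proof (induction w)
  case Nil
  show ?case by unfold_locales simp_all
next
  case (Cons i w)
  interpret Ew: Vector_Spaces.linear scale scale "foldr E w" by fact
  show ?case by unfold_locales (simp_all add: Ew.add Ew.scale E.add E.scale)
qed

lemma E_word_weight: "set w \<subseteq> S \<Longrightarrow> u \<in> W z \<Longrightarrow> foldr E w u \<in> W (z + content w)"
proof (induction w)
  case (Cons j w)
  then have "j \<in> S" "set w \<subseteq> S" by auto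
  from E_weight[OF this(1) Cons.IH[OF this(2) Cons.prems(2)]]
  have "E j (foldr E w u) \<in> W (z + content w + nroot j 1)" .
  then have "E j (foldr E w u) \<in> W (z + content (j # w))"
    by (rule W_cong) (simp add: content_simps)
  then show ?case unfolding foldr.simps o_apply .
next
  case Nil
  then show ?case unfolding content_simps add_0_right by simp
qed

text \<open>The powers of the adjoint action of \<open>E i\<close> on an operator \<open>X\<close> whose weight pairs to \<open>n\<close> with \<open>\<alpha>\<^sub>i\<close>.\<close>

primrec qcomm :: "'i \<Rightarrow> int \<Rightarrow> ('v \<Rightarrow> 'v) \<Rightarrow> nat \<Rightarrow> 'v \<Rightarrow> 'v" where
  "qcomm i n X 0 = X"
| "qcomm i n X (Suc k) = (\<lambda>u. E i (qcomm i n X k u) - scale (q powi (n + 2 * int k * int (d i))) (qcomm i n X k (E i u)))"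

lemma qcomm_linear:
  assumes "Vector_Spaces.linear scale scale X"
  shows "Vector_Spaces.linear scale scale (qcomm i n X k)"
proof (induction k)
  case (Suc k)
  interpret Y: Vector_Spaces.linear scale scale "qcomm i n X k" by fact
  show ?case
    by unfold_locales
      (simp_all add: E.add E.scale E.diff Y.add Y.scale scale_right_distrib scale_right_diff_distrib mult.commute)
qed (simp add: assms)

text \<open>The rank one identity for \<open>[F, E\<^sup>k]\<close>, applied to the adjoint action on operators: \<open>X\<close> is a lowest weight
  vector there, since it commutes with \<open>F i\<close>.\<close>

lemma qcomm_F:
  assumes i: "i \<in> S" and X: "Vector_Spaces.linear scale scale X"
    and "\<forall>z. \<forall>u\<in>W z. X u \<in> W (z + \<beta>)"
    and "\<forall>z. \<forall>u\<in>W z. X (F i u) = F i (X u)"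
    and n: "n = pr \<beta> i"
  shows "(\<forall>z. \<forall>u\<in>W z. qcomm i n X k u \<in> W (z + \<beta> + nroot i (int k))) \<and>
    (\<forall>z. \<forall>u\<in>W z. qcomm i n X k (F i u) = F i (qcomm i n X k u)
      + scale ((\<Sum>j<k. qdiff q (n + 2 * int j * int (d i))) / h i * q powi (- pr z i)) (qcomm i n X (k - 1) u))"
proof (induction k)
  case 0
  note weight = assms(3)[rule_format] and comm = assms(4)[rule_format]
  have "X u \<in> W (z + \<beta> + nroot i (int 0))" if "u \<in> W z" for z u
    by (rule W_cong[OF weight[OF that]]) (simp add: nroot_def)
  moreover have "qcomm i n X 0 (F i u) = F i (qcomm i n X 0 u)
      + scale ((\<Sum>j<0. qdiff q (n + 2 * int j * int (d i))) / h i * q powi (- pr z i)) (qcomm i n X (0 - 1) u)"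
    if "u \<in> W z" for z u
    using comm[OF that] by simp
  ultimately show ?case unfolding qcomm.simps by blast
next
  case (Suc k)
  let ?Y = "qcomm i n X"
  define c where "c = (\<Sum>j<k. qdiff q (n + 2 * int j * int (d i))) / h i"
  define e where "e = n + 2 * int k * int (d i)"
  interpret Y: Vector_Spaces.linear scale scale "?Y k" by (rule qcomm_linear[OF X])
  have W1: "?Y k u \<in> W (z + \<beta> + nroot i (int k))" if "u \<in> W z" for z u using Suc that by blast
  have IH: "?Y k (F i u) = F i (?Y k u) + scale (c * q powi (- pr z i)) (?Y (k - 1) u)" if "u \<in> W z" for z u
    using Suc that unfolding c_def by blast
  have "?Y (Suc k) u \<in> W (z + \<beta> + nroot i (int (Suc k)))" if u: "u \<in> W z" for z u
  proof -
    have "E i (?Y k u) \<in> W (z + \<beta> + nroot i (int k) + nroot i 1)" by (rule E_weight[OF i W1[OF u]])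
    moreover have "?Y k (E i u) \<in> W (z + nroot i 1 + \<beta> + nroot i (int k))" by (rule W1[OF E_weight[OF i u]])
    moreover have "z + nroot i 1 + \<beta> + nroot i (int k) = z + \<beta> + nroot i (int (Suc k))"
      "z + \<beta> + nroot i (int k) + nroot i 1 = z + \<beta> + nroot i (int (Suc k))"
      by (auto simp: nroot_def fun_eq_iff)
    ultimately show ?thesis by (simp add: subspace_diff subspace_scale W_subspace)
  qed
  moreover have "?Y (Suc k) (F i u) = F i (?Y (Suc k) u)
      + scale ((\<Sum>j<Suc k. qdiff q (n + 2 * int j * int (d i))) / h i * q powi (- pr z i)) (?Y k u)"
    if u: "u \<in> W z" for z u
  proof -
    define \<zeta> where "\<zeta> = pr z i"
    have EF: "E i (F i u) = F i (E i u) + scale (qdiff q \<zeta> / h i) u"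
      using commutator[OF i i u] by (simp add: \<zeta>_def diff_eq_eq add.commute)
    have EFY: "E i (F i (?Y k u)) = F i (E i (?Y k u)) + scale (qdiff q (\<zeta> + e) / h i) (?Y k u)"
      using commutator[OF i i W1[OF u]]
      by (simp add: \<zeta>_def e_def n diff_eq_eq add_ac b_diag mult_ac)
    have YFE: "?Y k (F i (E i u)) = F i (?Y k (E i u))
        + scale (c * q powi (- (\<zeta> + 2 * int (d i)))) (?Y (k - 1) (E i u))"
      using IH[OF E_weight[OF i u]] by (simp add: \<zeta>_def b_diag)
    have last: "scale (c * q powi (- \<zeta>)) (E i (?Y (k - 1) u))
        - scale (q powi e) (scale (c * q powi (- (\<zeta> + 2 * int (d i)))) (?Y (k - 1) (E i u)))
        = scale (c * q powi (- \<zeta>)) (?Y k u)"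
    proof (cases k)
      case 0
      then show ?thesis by (simp add: c_def)
    next
      case (Suc k')
      have "q powi e * q powi (- (\<zeta> + 2 * int (d i))) = q powi (- \<zeta>) * q powi (n + 2 * int k' * int (d i))"
        unfolding powi_add[symmetric]
        by (rule arg_cong[where f = "\<lambda>x. q powi x"]) (simp add: e_def Suc algebra_simps)
      then have "q powi e * (c * q powi (- (\<zeta> + 2 * int (d i)))) = c * q powi (- \<zeta>) * q powi (n + 2 * int k' * int (d i))"
        by (simp add: mult_ac)
      then show ?thesis by (simp add: Suc scale_right_diff_distrib)
    qed
    have coeff: "qdiff q (\<zeta> + e) / h i - q powi e * (qdiff q \<zeta> / h i) = qdiff q e / h i * q powi (- \<zeta>)"
    proof -
      have "qdiff q (\<zeta> + e) - q powi e * qdiff q \<zeta> = qdiff q e * q powi (- \<zeta>)"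
        using q_nonzero by (simp add: qdiff_def power_int_add power_int_minus power_int_diff field_simps)
      then show ?thesis using h_nonzero[of i] by (simp add: field_simps)
    qed
    have "?Y (Suc k) (F i u) = E i (?Y k (F i u)) - scale (q powi e) (?Y k (E i (F i u)))"
      by (simp add: e_def)
    also have "\<dots> = (F i (E i (?Y k u)) - scale (q powi e) (F i (?Y k (E i u))))
       + (scale (qdiff q (\<zeta> + e) / h i) (?Y k u) - scale (q powi e) (scale (qdiff q \<zeta> / h i) (?Y k u)))
       + (scale (c * q powi (- \<zeta>)) (E i (?Y (k - 1) u))
        - scale (q powi e) (scale (c * q powi (- (\<zeta> + 2 * int (d i)))) (?Y (k - 1) (E i u))))"
      unfolding IH[OF u] EF E.add E.scale EFY Y.add Y.scale YFE \<zeta>_def[symmetric] scale_right_distrib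
      by simp
    also have "\<dots> = F i (?Y (Suc k) u) + scale (qdiff q e / h i * q powi (- \<zeta>)) (?Y k u)
        + scale (c * q powi (- \<zeta>)) (?Y k u)"
      unfolding last
      unfolding scale_scale scale_left_diff_distrib[symmetric] coeff
      by (simp add: F.diff F.scale e_def)
    also have "\<dots> = F i (?Y (Suc k) u) + scale ((qdiff q e / h i + c) * q powi (- \<zeta>)) (?Y k u)"
      by (simp add: scale_left_distrib distrib_right)
    also have "qdiff q e / h i + c = (\<Sum>j<Suc k. qdiff q (n + 2 * int j * int (d i))) / h i"
      by (simp add: c_def e_def add_divide_distrib)
    finally show ?thesis by (simp add: \<zeta>_def)
  qed
  ultimately show ?case unfolding diff_Suc_1 by blast
qed

text \<open>Only finitely many weights occur, so the iterated commutators of \<open>X\<close> with \<open>E i\<close> eventually vanish. By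
  \<open>qcomm_F\<close> vanishing passes from the \<open>Suc k\<close>-th to the \<open>k\<close>-th one: the coefficient is a nonzero multiple of
  \<open>qdiff q (Suc k * d i) * qdiff q (n + k * d i)\<close>, and \<open>n > 0\<close>.\<close>

lemma raising_operator_commuting_with_F_is_zero:
  assumes i: "i \<in> S" and X: "Vector_Spaces.linear scale scale X"
    and weight: "\<And>z u. u \<in> W z \<Longrightarrow> X u \<in> W (z + \<beta>)"
    and comm: "\<And>z u. u \<in> W z \<Longrightarrow> X (F i u) = F i (X u)"
    and pos: "pr \<beta> i > 0" and u: "u \<in> W z"
  shows "X u = 0"
proof -
  define n where "n = pr \<beta> i"
  have "\<forall>z. \<forall>u\<in>W z. X u \<in> W (z + \<beta>)" "\<forall>z. \<forall>u\<in>W z. X (F i u) = F i (X u)"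
    using weight comm by blast+
  note Y = qcomm_F[OF i X this n_def]
  define c where "c = (\<lambda>k. (\<Sum>j<k. qdiff q (n + 2 * int j * int (d i))) / h i)"
  obtain B where B: "\<And>z. \<bar>height z\<bar> > B \<Longrightarrow> W z = {0}" using height_bounded by blast
  define K where "K = nat (2 * \<bar>B\<bar> + \<bar>height \<beta>\<bar> + 1)"
  have top: "qcomm i n X K u = 0" if "u \<in> W z" for z u
  proof (cases "\<bar>height z\<bar> > B")
    case True
    interpret YK: Vector_Spaces.linear scale scale "qcomm i n X K" by (rule qcomm_linear[OF X])
    show ?thesis using B[OF True] that by (simp add: YK.zero)
  next
    case False
    then have "W (z + \<beta> + nroot i (int K)) = {0}"
      by (intro B) (auto simp: K_def)
    moreover have "qcomm i n X K u \<in> W (z + \<beta> + nroot i (int K))"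
      using Y[where k = K, THEN conjunct1] that by blast
    ultimately show ?thesis by simp
  qed
  have step: "qcomm i n X k u = 0" if IH: "\<And>z u. u \<in> W z \<Longrightarrow> qcomm i n X (Suc k) u = 0"
    and u: "u \<in> W z" for k z u
  proof -
    have "qcomm i n X (Suc k) (F i u) = F i (qcomm i n X (Suc k) u)
       + scale (c (Suc k) * q powi (- pr z i)) (qcomm i n X (Suc k - 1) u)"
      using Y[where k = "Suc k"] u unfolding c_def by blast
    then have "scale (c (Suc k) * q powi (- pr z i)) (qcomm i n X k u) = 0"
      using IH[OF F_weight[OF i u]] IH[OF u] F.zero[of i] by (simp del: qcomm.simps)
    moreover have "c (Suc k) \<noteq> 0"
    proof
      assume "c (Suc k) = 0"
      then have "(\<Sum>j<Suc k. qdiff q (n + 2 * int j * int (d i))) = 0"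
        using h_nonzero[of i] by (simp add: c_def)
      then have "qdiff q (int (Suc k) * int (d i)) * qdiff q (n + (int (Suc k) - 1) * int (d i)) = 0"
        unfolding qdiff_sum[OF q_nonzero, symmetric] by simp
      moreover have "n + (int (Suc k) - 1) * int (d i) > 0"
        using pos by (simp add: n_def add_pos_nonneg)
      ultimately show False
        using d_pos[of i] by (simp add: qdiff_zero_iff)
    qed
    ultimately show ?thesis using q_nonzero by (simp add: power_int_eq_0_iff)
  qed
  have "\<forall>z. \<forall>u\<in>W z. qcomm i n X (K - m) u = 0" for m
  proof (induction m)
    case (Suc m)
    show ?case
    proof (cases "m < K")
      case True
      then have "K - m = Suc (K - Suc m)" by simp
      then show ?thesis using step[of "K - Suc m"] Suc by metis
    next
      case False
      then show ?thesis using Suc by simp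
    qed
  qed (use top in auto)
  from this[of K] u show ?thesis by simp
qed

lemma E_F_power:
  assumes i: "i \<in> S" and u: "u \<in> W z"
  shows "(F i ^^ k) u \<in> W (z - nroot i (int k)) \<and>
    E i ((F i ^^ k) u) = (F i ^^ k) (E i u)
      + scale ((\<Sum>j<k. qdiff q (pr z i + 2 * int j * (- int (d i)))) / h i) ((F i ^^ (k - 1)) u)"
proof (induction k)
  case 0
  then show ?case using u by simp
next
  case (Suc k)
  define x where "x = (F i ^^ k) u"
  define c where "c = (\<Sum>j<k. qdiff q (pr z i + 2 * int j * (- int (d i)))) / h i"
  have x: "x \<in> W (z - nroot i (int k))"
    and Ex: "E i x = (F i ^^ k) (E i u) + scale c ((F i ^^ (k - 1)) u)"
    using Suc unfolding x_def c_def by blast+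
  have "F i x \<in> W (z - nroot i (int k) - nroot i 1)" by (rule F_weight[OF i x])
  also have "z - nroot i (int k) - nroot i 1 = z - nroot i (int (Suc k))"
    by (auto simp: nroot_def fun_eq_iff)
  finally have 1: "(F i ^^ Suc k) u \<in> W (z - nroot i (int (Suc k)))"
    unfolding x_def funpow.simps o_apply .
  have k0: "scale c (F i ((F i ^^ (k - 1)) u)) = scale c x"
    by (cases k) (simp_all add: c_def x_def)
  have "E i (F i x) = F i (E i x) + scale (qdiff q (pr z i + 2 * int k * (- int (d i))) / h i) x"
    using commutator[OF i i x] by (simp add: diff_eq_eq add.commute b_diag mult_ac)
  also have "\<dots> = (F i ^^ Suc k) (E i u) + (scale c x + scale (qdiff q (pr z i + 2 * int k * (- int (d i))) / h i) x)"
    unfolding Ex F.add F.scale k0 by (simp add: add.assoc)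
  also have "\<dots> = (F i ^^ Suc k) (E i u) + scale ((\<Sum>j<Suc k. qdiff q (pr z i + 2 * int j * (- int (d i)))) / h i) x"
    unfolding scale_left_distrib[symmetric] c_def by (simp add: add_divide_distrib)
  finally have 2: "E i ((F i ^^ Suc k) u) = (F i ^^ Suc k) (E i u)
      + scale ((\<Sum>j<Suc k. qdiff q (pr z i + 2 * int j * (- int (d i)))) / h i) ((F i ^^ k) u)"
    by (simp add: x_def)
  show ?case unfolding diff_Suc_1 using 1 2 by blast
qed

text \<open>The least \<open>k\<close> with \<open>F\<^sup>k u \<in> N\<close> is positive, and applying \<open>E i\<close> to \<open>F\<^sup>k u\<close> shows that the coefficient of
  \<open>F\<^bsup>k-1\<^esup> u\<close> vanishes, which means \<open>pr z i = (k - 1) * d i\<close>. Working modulo a submodule \<open>N\<close> makes the lemma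
  applicable to highest weight vectors of quotients.\<close>

lemma relative_highest_weight_dominant:
  assumes i: "i \<in> S" and N: "subspace N" "\<And>x. x \<in> N \<Longrightarrow> E i x \<in> N" "\<And>x. x \<in> N \<Longrightarrow> F i x \<in> N"
    and u: "u \<in> W z" "u \<notin> N" "E i u \<in> N"
  shows "pr z i \<ge> 0"
proof -
  obtain B where B: "\<And>z. \<bar>height z\<bar> > B \<Longrightarrow> W z = {0}" using height_bounded by blast
  define K where "K = nat (\<bar>B\<bar> + \<bar>height z\<bar> + 1)"
  have "W (z - nroot i (int K)) = {0}" by (rule B) (auto simp: K_def)
  then have "(F i ^^ K) u = 0" using E_F_power[OF i u(1), of K] by simp
  then have ex: "\<exists>k. (F i ^^ k) u \<in> N" using subspace_0[OF N(1)] by metis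
  define k where "k = (LEAST k. (F i ^^ k) u \<in> N)"
  have kN: "(F i ^^ k) u \<in> N" unfolding k_def using ex by (rule LeastI_ex)
  have "k \<noteq> 0" using kN u(2) by (metis funpow_0)
  then obtain m where m: "k = Suc m" using not0_implies_Suc by blast
  then have mN: "(F i ^^ m) u \<notin> N" using not_less_Least[of m "\<lambda>k. (F i ^^ k) u \<in> N"] by (simp add: k_def)
  define c where "c = (\<Sum>j<Suc m. qdiff q (pr z i + 2 * int j * (- int (d i)))) / h i"
  have FN: "(F i ^^ j) (E i u) \<in> N" for j by (induction j) (use u N in auto)
  have "scale c ((F i ^^ m) u) = E i ((F i ^^ Suc m) u) - (F i ^^ Suc m) (E i u)"
    using E_F_power[OF i u(1), of "Suc m"] by (simp add: c_def)
  also have "\<dots> \<in> N"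
    using N(2)[OF kN] FN[of "Suc m"] unfolding m by (rule subspace_diff[OF N(1)])
  finally have cN: "scale c ((F i ^^ m) u) \<in> N" .
  have "c = 0"
  proof (rule ccontr)
    assume "c \<noteq> 0"
    then have "(F i ^^ m) u = scale (inverse c) (scale c ((F i ^^ m) u))" by simp
    then show False using subspace_scale[OF N(1) cN, of "inverse c"] mN by simp
  qed
  then have "(\<Sum>j<Suc m. qdiff q (pr z i + 2 * int j * (- int (d i)))) = 0"
    using h_nonzero[of i] by (simp add: c_def)
  then have "qdiff q (int (Suc m) * - int (d i)) * qdiff q (pr z i + (int (Suc m) - 1) * - int (d i)) = 0"
    unfolding qdiff_sum[OF q_nonzero, symmetric] by simp
  then have "pr z i = int m * int (d i)"
    using d_pos[of i] unfolding mult_eq_0_iff qdiff_zero_iff by auto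
  then show ?thesis by simp
qed

lemma E_word_F:
  assumes i: "i \<in> S" and w: "set w \<subseteq> S" and u: "u \<in> W z"
  shows "foldr E w (F i u) = F i (foldr E w u)
    + (scale (q powi pr z i / h i) (ev scale (\<lambda>v. foldr E v u) (rder i w))
     - scale (q powi (- (pr z i + wpair w i - b i i)) / h i) (ev scale (\<lambda>v. foldr E v u) (lder i w)))"
  using w
proof (induction w)
  case (Cons j w)
  define x where "x = foldr E w u"
  define \<zeta> where "\<zeta> = pr z i"
  define R where "R = ev scale (\<lambda>v. foldr E (j # v) u) (rder i w)"
  define L where "L = ev scale (\<lambda>v. foldr E (j # v) u) (lder i w)"
  have j: "j \<in> S" and w: "set w \<subseteq> S" using Cons.prems by auto
  have x: "x \<in> W (z + content w)" unfolding x_def by (rule E_word_weight[OF w u])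
  have EF: "E j (F i x) = F i (E j x) + (if i = j then scale (qdiff q (\<zeta> + wpair w i) / h i) x else 0)"
    using commutator[OF j i x] by (auto simp: diff_eq_eq add.commute \<zeta>_def)
  have Eev: "E j (ev scale (\<lambda>v. foldr E v u) y) = ev scale (\<lambda>v. foldr E (j # v) u) y" for y
    by (simp add: ev_linear_image[OF E_linear])
  have "foldr E (j # w) (F i u) = E j (F i x + (scale (q powi \<zeta> / h i) (ev scale (\<lambda>v. foldr E v u) (rder i w))
     - scale (q powi (- (\<zeta> + wpair w i - b i i)) / h i) (ev scale (\<lambda>v. foldr E v u) (lder i w))))"
    using Cons.IH[OF w] by (simp add: x_def \<zeta>_def)
  also have "\<dots> = F i (E j x) + (if i = j then scale (qdiff q (\<zeta> + wpair w i) / h i) x else 0)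
     + (scale (q powi \<zeta> / h i) R - scale (q powi (- (\<zeta> + wpair w i - b i i)) / h i) L)"
    by (simp add: E.add E.diff E.scale EF Eev R_def L_def)
  also have "(if i = j then scale (qdiff q (\<zeta> + wpair w i) / h i) x else 0)
     = (if i = j then scale (q powi \<zeta> / h i) (scale (q powi wpair w i) x)
          - scale (q powi (- (\<zeta> + wpair (j # w) i - b i i)) / h i) x else 0)"
    using q_nonzero by (auto simp: qdiff_def diff_divide_distrib scale_left_diff_distrib power_int_add)
  also have "scale (q powi (- (\<zeta> + wpair w i - b i i)) / h i) L
     = scale (q powi (- (\<zeta> + wpair (j # w) i - b i i)) / h i) (scale (q powi b i j) L)"
  proof -
    have "q powi (- (\<zeta> + wpair w i - b i i)) = q powi (- (\<zeta> + wpair (j # w) i - b i i)) * q powi b i j"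
      unfolding powi_add[symmetric]
      by (rule arg_cong[where f = "\<lambda>x. q powi x"]) (simp add: b_sym[of j i])
    then show ?thesis by simp
  qed
  finally have eq: "foldr E (j # w) (F i u) = F i (E j x)
      + (if i = j then scale (q powi \<zeta> / h i) (scale (q powi wpair w i) x)
          - scale (q powi (- (\<zeta> + wpair (j # w) i - b i i)) / h i) x else 0)
     + (scale (q powi \<zeta> / h i) R
       - scale (q powi (- (\<zeta> + wpair (j # w) i - b i i)) / h i) (scale (q powi b i j) L))" .
  have r: "ev scale (\<lambda>v. foldr E v u) (rder i (j # w)) = (if i = j then scale (q powi wpair w i) x else 0) + R"
    by (simp add: R_def x_def ev_map')
  have l: "ev scale (\<lambda>v. foldr E v u) (lder i (j # w)) = (if i = j then x else 0) + scale (q powi b i j) L"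
    by (simp add: L_def x_def ev_map)
  show ?case unfolding eq r l \<zeta>_def[symmetric] scale_right_distrib
    by (simp add: x_def)
qed simp

text \<open>Elements of the radical of the form act by zero. Their derivatives lie in the radical again, so inductively
  the operator \<open>X\<close> of such an element commutes with every \<open>F i\<close>. As the norm of its weight \<open>\<beta>\<close> is positive, some
  letter \<open>i\<close> of \<open>\<beta>\<close> pairs positively with \<open>\<beta>\<close>, and then \<open>X\<close> vanishes by the rank one argument.\<close>

lemma radical_acts_by_zero:
  assumes "\<And>c w. (c, w) \<in> set x \<Longrightarrow> mset w = \<nu>" "set_mset \<nu> \<subseteq> S"
    and "\<And>a. mset a = \<nu> \<Longrightarrow> ev (*) (word_form a) x = 0"
    and "u \<in> W z"
  shows "ev scale (\<lambda>w. foldr E w u) x = 0"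
  using assms
proof (induction "size \<nu>" arbitrary: \<nu> x u z)
  case 0
  then have w: "w = []" if "(c, w) \<in> set x" for c w using that by fastforce
  have "ev scale (\<lambda>w. foldr E w u) x = ev scale (\<lambda>w. scale (word_form [] w) u) x"
    by (rule ev_cong) (auto dest: w)
  also have "\<dots> = scale (ev (*) (word_form []) x) u"
    by (rule ev_linear_image[symmetric]) (unfold_locales, auto simp: algebra_simps)
  finally show ?case using 0 by simp
next
  case (Suc m)
  define \<beta> where "\<beta> = (\<lambda>i. int (count \<nu> i))"
  define X where "X = (\<lambda>u. ev scale (\<lambda>w. foldr E w u) x)"
  have ws: "set w \<subseteq> S" and content: "content w = \<beta>" and wp: "wpair w i = pr \<beta> i"
    if "(c, w) \<in> set x" for c w i
  proof -
    have w: "mset w = \<nu>" using Suc.prems(1) that .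
    show "set w \<subseteq> S" using Suc.prems(2) w by (metis set_mset_mset)
    show c: "content w = \<beta>" by (rule ext) (simp add: \<beta>_def content_mset w)
    show "wpair w i = pr \<beta> i" by (simp flip: c)
  qed
  have "\<beta> \<noteq> 0"
  proof
    assume "\<beta> = 0"
    then have "count \<nu> i = 0" for i by (auto simp: \<beta>_def fun_eq_iff)
    then have "\<nu> = {#}" by (simp add: multiset_eq_iff)
    then show False using Suc.hyps by simp
  qed
  \<comment> \<open>positivity of the norm of \<open>\<beta>\<close> yields a letter pairing positively with \<open>\<beta>\<close>\<close>
  then have "0 < (\<Sum>i\<in>UNIV. \<Sum>j\<in>UNIV. \<beta> i * \<beta> j * b i j)" by (rule b_pos)
  also have "\<dots> = (\<Sum>i\<in>UNIV. \<beta> i * pr \<beta> i)"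
    by (simp add: root_pair_def sum_distrib_left b_sym[of _ i for i] mult_ac)
  finally have "\<exists>i. 0 < \<beta> i * pr \<beta> i" by (meson not_le sum_nonpos)
  then obtain i where i: "0 < \<beta> i * pr \<beta> i" ..
  have "\<beta> i \<ge> 0" by (simp add: \<beta>_def)
  then have bi: "\<beta> i > 0" and pos: "pr \<beta> i > 0" using i by (auto simp: zero_less_mult_iff)
  then have "i \<in># \<nu>" by (simp add: \<beta>_def)
  then have iS: "i \<in> S" using Suc.prems(2) by auto
  have X_lin: "Vector_Spaces.linear scale scale X"
  proof
    fix u v c
    have l: "foldr E w (u + v) = foldr E w u + foldr E w v" "foldr E w (scale c u) = scale c (foldr E w u)" for w
    proof -
      interpret Ew: Vector_Spaces.linear scale scale "foldr E w" by (rule E_word_linear)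
      show "foldr E w (u + v) = foldr E w u + foldr E w v" "foldr E w (scale c u) = scale c (foldr E w u)"
        by (fact Ew.add Ew.scale)+
    qed
    show "X (u + v) = X u + X v" "X (scale c u) = scale c (X u)"
      by (simp_all add: X_def l ev_add ev_scale)
  qed
  have X_weight: "X u \<in> W (z + \<beta>)" if "u \<in> W z" for u z
    unfolding X_def
    by (rule ev_in_subspace[OF W_subspace]) (use E_word_weight[OF ws that] content in metis)
  have der0: "ev scale (\<lambda>w. ev scale (\<lambda>v. foldr E v u) (D w)) x = 0"
    if D: "\<And>c v w. (c, v) \<in> set (D w) \<Longrightarrow> mset w = add_mset i (mset v)"
      and G: "\<And>a w. word_form (C a) w = ev (*) (word_form a) (D w)"
      and C: "\<And>a. mset (C a) = add_mset i (mset a)"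
      and u: "u \<in> W z" for D C u z
  proof -
    have "ev scale (\<lambda>v. foldr E v u) (lin_ext D x) = 0"
    proof (rule Suc.hyps(1)[of "\<nu> - {#i#}"])
      show "m = size (\<nu> - {#i#})"
        using Suc.hyps(2) \<open>i \<in># \<nu>\<close> by (simp add: size_Diff_singleton)
      show "mset v = \<nu> - {#i#}" if "(c, v) \<in> set (lin_ext D x)" for c v
        using that D Suc.prems(1) by (fastforce simp: lin_ext_def)
      show "set_mset (\<nu> - {#i#}) \<subseteq> S" using Suc.prems(2) by (auto dest: in_diffD)
      show "ev (*) (word_form a) (lin_ext D x) = 0" if a: "mset a = \<nu> - {#i#}" for a
      proof -
        have "ev (*) (word_form a) (lin_ext D x) = ev (*) (word_form (C a)) x"
          unfolding vector_space.ev_lin_ext[OF vector_space_mult] by (simp add: G[symmetric])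
        then show ?thesis using Suc.prems(3)[of "C a"] \<open>i \<in># \<nu>\<close> by (simp add: C a)
      qed
    qed fact
    then show ?thesis by (simp add: ev_lin_ext)
  qed
  have comm: "X (F i u) = F i (X u)" if u: "u \<in> W z" for u z
  proof -
    have R: "ev scale (\<lambda>w. ev scale (\<lambda>v. foldr E v u) (rder i w)) x = 0"
      by (rule der0[where C = "\<lambda>a. a @ [i]", OF mset_rder word_form_snoc _ u]) auto
    have L: "ev scale (\<lambda>w. ev scale (\<lambda>v. foldr E v u) (lder i w)) x = 0"
      by (rule der0[where C = "\<lambda>a. i # a", OF mset_lder _ _ u]) auto
    have "X (F i u) = ev scale (\<lambda>w. F i (foldr E w u)
        + (scale (q powi pr z i / h i) (ev scale (\<lambda>v. foldr E v u) (rder i w))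
        - scale (q powi (- (pr z i + pr \<beta> i - b i i)) / h i) (ev scale (\<lambda>v. foldr E v u) (lder i w)))) x"
      unfolding X_def by (rule ev_cong) (simp add: E_word_F[OF iS ws u] wp)
    also have "\<dots> = F i (X u)"
      by (simp add: ev_add ev_diff ev_scale R L X_def ev_linear_image[OF F_linear])
    finally show ?thesis .
  qed
  have "X u = 0"
    by (rule raising_operator_commuting_with_F_is_zero[OF iS X_lin X_weight comm pos Suc.prems(4)])
  then show ?case by (simp add: X_def)
qed

end

section \<open>The quantum Casimir operator\<close>

lemma ev_graph_list:
  "distinct xs \<Longrightarrow> ev sc \<phi> (map (\<lambda>w. (f w, w)) xs) = (\<Sum>w\<in>set xs. sc (f w) (\<phi> w))"
  by (simp add: ev_def comp_def sum_list_distinct_conv_sum_set)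

context vector_space
begin

lemma ev_sum:
  "ev scale (\<lambda>w. \<Sum>x\<in>X. \<phi> x w) y = (\<Sum>x\<in>X. ev scale (\<phi> x) y)"
  by (induction y) (auto simp: scale_sum_right sum.distrib)

lemma ev_scalar_family: "ev scale (\<lambda>w. scale (f w) u) x = scale (ev (*) f x) u"
  by (induction x) (auto simp: scale_left_distrib)

end

lemma sum_swap4:
  "(\<Sum>a\<in>A. \<Sum>b\<in>B. \<Sum>x\<in>C. \<Sum>y\<in>D. f a b x y) = (\<Sum>y\<in>D. \<Sum>x\<in>C. \<Sum>a\<in>A. \<Sum>b\<in>B. (f a b x y :: 'v::comm_monoid_add))"
proof -
  have "(\<Sum>a\<in>A. \<Sum>b\<in>B. \<Sum>x\<in>C. \<Sum>y\<in>D. f a b x y) = (\<Sum>a\<in>A. \<Sum>b\<in>B. \<Sum>y\<in>D. \<Sum>x\<in>C. f a b x y)"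
    by (intro sum.cong refl sum.swap)
  also have "\<dots> = (\<Sum>a\<in>A. \<Sum>y\<in>D. \<Sum>b\<in>B. \<Sum>x\<in>C. f a b x y)"
    by (intro sum.cong refl sum.swap)
  also have "\<dots> = (\<Sum>y\<in>D. \<Sum>a\<in>A. \<Sum>b\<in>B. \<Sum>x\<in>C. f a b x y)"
    by (rule sum.swap)
  also have "\<dots> = (\<Sum>y\<in>D. \<Sum>a\<in>A. \<Sum>x\<in>C. \<Sum>b\<in>B. f a b x y)"
    by (intro sum.cong refl sum.swap)
  also have "\<dots> = (\<Sum>y\<in>D. \<Sum>x\<in>C. \<Sum>a\<in>A. \<Sum>b\<in>B. f a b x y)"
    by (intro sum.cong refl sum.swap)
  finally show ?thesis .
qed

context weight_module
begin

lemma finite_words_S: "finite (words S n)"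
  by (rule finite_words) simp

text \<open>Modulo the radical of the form, the word \<open>c\<close> is reproduced by the Gram matrix and its pseudo-inverse.\<close>

lemma word_reduction:
  assumes block: "\<And>a c. mset a \<noteq> mset c \<Longrightarrow> T a c = 0"
    and inv: "\<And>a c. a \<in> words S n \<Longrightarrow> c \<in> words S n \<Longrightarrow>
      (\<Sum>x\<in>words S n. \<Sum>y\<in>words S n. word_form a x * T x y * word_form y c) = word_form a c"
    and c: "c \<in> words S n" and u: "u \<in> W z"
  shows "foldr E c u = (\<Sum>x\<in>words S n. \<Sum>y\<in>words S n. scale (T x y * word_form y c) (foldr E x u))"
proof -
  define X where "X = {w \<in> words S n. mset w = mset c}"
  have "finite X" using finite_words_S by (simp add: X_def)
  then obtain xs where xs: "set xs = X" "distinct xs" using finite_distinct_list by blast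
  define k where "k = (\<lambda>w. \<Sum>y\<in>words S n. T w y * word_form y c)"
  have k0: "k w = 0" if "mset w \<noteq> mset c" for w
    unfolding k_def
  proof (rule sum.neutral, rule ballI)
    fix y
    show "T w y * word_form y c = 0"
      using block[of w y] word_form_eq_0[of y c] that by (cases "mset w = mset y") auto
  qed
  have "ev scale (\<lambda>w. foldr E w u) ((1, c) # map (\<lambda>w. (- k w, w)) xs) = 0"
  proof (rule radical_acts_by_zero[OF _ _ _ u])
    show "mset w = mset c" if "(r, w) \<in> set ((1, c) # map (\<lambda>w. (- k w, w)) xs)" for r w
      using that by (auto simp: xs X_def)
    show "set_mset (mset c) \<subseteq> S" using c by (simp add: words_def)
    show "ev (*) (word_form a) ((1, c) # map (\<lambda>w. (- k w, w)) xs) = 0" if a: "mset a = mset c" for a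
    proof -
      have aw: "a \<in> words S n" using c a by (metis (mono_tags, lifting) mem_Collect_eq set_mset_mset size_mset words_def)
      have "(\<Sum>w\<in>X. word_form a w * k w) = (\<Sum>w\<in>words S n. word_form a w * k w)"
        by (rule sum.mono_neutral_left[OF finite_words_S]) (auto simp: X_def k0)
      also have "\<dots> = word_form a c"
        unfolding inv[OF aw c, symmetric] k_def by (simp add: sum_distrib_left mult.assoc)
      finally show ?thesis
        by (simp add: ev_graph_list[OF xs(2)] xs(1) sum_negf mult.commute)
    qed
  qed
  then have "foldr E c u = (\<Sum>w\<in>X. scale (k w) (foldr E w u))"
    by (simp add: ev_graph_list[OF xs(2)] xs(1) sum_negf)
  also have "\<dots> = (\<Sum>w\<in>words S n. scale (k w) (foldr E w u))"
    by (rule sum.mono_neutral_left[OF finite_words_S]) (auto simp: X_def k0)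
  finally show ?thesis by (simp add: k_def scale_sum_left)
qed

definition gram_inverse :: "'i list \<Rightarrow> 'i list \<Rightarrow> 'k" where
  "gram_inverse = (SOME \<Theta>. (\<forall>a c. mset a \<noteq> mset c \<longrightarrow> \<Theta> a c = 0) \<and>
    (\<forall>n. \<forall>a\<in>words S n. \<forall>c\<in>words S n.
      (\<Sum>x\<in>words S n. \<Sum>y\<in>words S n. word_form a x * \<Theta> x y * word_form y c) = word_form a c))"

lemma gram_inverse_block: "mset a \<noteq> mset c \<Longrightarrow> gram_inverse a c = 0"
  and gram_inverse: "a \<in> words S n \<Longrightarrow> c \<in> words S n \<Longrightarrow>
      (\<Sum>x\<in>words S n. \<Sum>y\<in>words S n. word_form a x * gram_inverse x y * word_form y c) = word_form a c"
proof -
  have "finite S" by simp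
  from someI_ex[OF pseudo_inverse_exists[OF this], folded gram_inverse_def]
  show "mset a \<noteq> mset c \<Longrightarrow> gram_inverse a c = 0"
    "a \<in> words S n \<Longrightarrow> c \<in> words S n \<Longrightarrow>
      (\<Sum>x\<in>words S n. \<Sum>y\<in>words S n. word_form a x * gram_inverse x y * word_form y c) = word_form a c"
    by blast+
qed

lemma gram_inverse_transpose:
  assumes "a \<in> words S n" "c \<in> words S n"
  shows "(\<Sum>x\<in>words S n. \<Sum>y\<in>words S n. word_form a x * gram_inverse y x * word_form y c) = word_form a c"
proof -
  have "word_form a c = (\<Sum>x\<in>words S n. \<Sum>y\<in>words S n. word_form c x * gram_inverse x y * word_form y a)"
    using gram_inverse[OF assms(2,1)] word_form_sym by simp
  also have "\<dots> = (\<Sum>y\<in>words S n. \<Sum>x\<in>words S n. word_form a y * gram_inverse x y * word_form x c)"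
    by (subst sum.swap) (simp add: word_form_sym[of c] word_form_sym[of _ a] mult_ac)
  finally show ?thesis ..
qed

text \<open>The part of length \<open>n\<close> of \<open>\<Sum> g(c) T(a, c) F\<^sub>a E\<^sub>c\<close>, with \<open>\<Phi> a c\<close> for the value of \<open>F\<^sub>a E\<^sub>c\<close> at a fixed vector.
  The matrix \<open>T\<close> is a parameter in order to allow for transposition.\<close>

definition casimir_part :: "('i list \<Rightarrow> 'i list \<Rightarrow> 'k) \<Rightarrow> ('i list \<Rightarrow> 'k) \<Rightarrow> ('i list \<Rightarrow> 'i list \<Rightarrow> 'v) \<Rightarrow> nat \<Rightarrow> 'v" where
  "casimir_part T g \<Phi> n = (\<Sum>a\<in>words S n. \<Sum>c\<in>words S n. scale (g c * T a c) (\<Phi> a c))"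

lemma casimir_part_cong:
  assumes "\<And>a c. a \<in> words S n \<Longrightarrow> c \<in> words S n \<Longrightarrow> T a c \<noteq> 0 \<Longrightarrow> \<Phi> a c = \<Psi> a c"
  shows "casimir_part T g \<Phi> n = casimir_part T g \<Psi> n"
  unfolding casimir_part_def
proof (intro sum.cong refl)
  fix a c assume "a \<in> words S n" "c \<in> words S n"
  then show "scale (g c * T a c) (\<Phi> a c) = scale (g c * T a c) (\<Psi> a c)"
    using assms[of a c] by (cases "T a c = 0") auto
qed

lemma casimir_part_add: "casimir_part T g (\<lambda>a c. \<Phi> a c + \<Psi> a c) n = casimir_part T g \<Phi> n + casimir_part T g \<Psi> n"
  by (simp add: casimir_part_def scale_right_distrib sum.distrib)

lemma casimir_part_scale: "casimir_part T g (\<lambda>a c. scale (k * l c) (\<Phi> a c)) n = scale k (casimir_part T (\<lambda>c. g c * l c) \<Phi> n)"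
  by (simp add: casimir_part_def scale_sum_right mult_ac)

lemma casimir_part_linear:
  assumes "Vector_Spaces.linear scale scale f"
  shows "f (casimir_part T g \<Phi> n) = casimir_part T g (\<lambda>a c. f (\<Phi> a c)) n"
proof -
  interpret f: Vector_Spaces.linear scale scale f by fact
  show ?thesis by (simp add: casimir_part_def f.sum f.scale)
qed

lemma casimir_part_in_subspace:
  assumes "subspace N" "\<And>a c. a \<in> words S n \<Longrightarrow> c \<in> words S n \<Longrightarrow> T a c \<noteq> 0 \<Longrightarrow> \<Phi> a c \<in> N"
  shows "casimir_part T g \<Phi> n \<in> N"
  unfolding casimir_part_def
proof (intro subspace_sum[OF assms(1)])
  fix a c assume "a \<in> words S n" "c \<in> words S n"
  then show "scale (g c * T a c) (\<Phi> a c) \<in> N"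
    using assms(2)[of a c] by (cases "T a c = 0") (auto simp: subspace_0 subspace_scale assms(1))
qed

text \<open>For dual bases \<open>y\<^sub>b\<close>, \<open>x\<^sub>b\<close> of a form for which \<open>D\<close> is adjoint to \<open>C\<close> one has
  \<open>\<Sum> y\<^sub>b \<otimes> D x\<^sub>b = \<Sum> C y\<^sub>b \<otimes> x\<^sub>b\<close>. The hypotheses \<open>red1\<close> and \<open>red2\<close> say that \<open>\<Phi>\<close> factors through the
  quotient by the radical in both arguments, so that a pseudo-inverse of the Gram matrix may replace dual bases.\<close>

lemma casimir_part_shift:
  assumes i: "i \<in> S"
    and block: "\<And>a c. mset a \<noteq> mset c \<Longrightarrow> T a c = 0"
    and red1: "\<And>m c y. c \<in> words S m \<Longrightarrow> set y \<subseteq> S \<Longrightarrow>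
      \<Phi> c y = (\<Sum>x\<in>words S m. \<Sum>x'\<in>words S m. scale (T x x' * word_form x' c) (\<Phi> x y))"
    and red2: "\<And>m c y. c \<in> words S m \<Longrightarrow> set y \<subseteq> S \<Longrightarrow>
      \<Phi> y c = (\<Sum>x\<in>words S m. \<Sum>x'\<in>words S m. scale (T x' x * word_form x' c) (\<Phi> y x))"
    and D: "\<And>r v w. (r, v) \<in> set (D w) \<Longrightarrow> mset w = add_mset i (mset v)"
    and C: "\<And>a. mset (C a) = add_mset i (mset a)"
    and DC: "\<And>a w. word_form (C a) w = ev (*) (word_form a) (D w)"
    and g: "\<And>v w. mset w = add_mset i (mset v) \<Longrightarrow> g w = \<gamma> * g v"
  shows "casimir_part T g (\<lambda>a c. ev scale (\<Phi> a) (D c)) (Suc n) = scale \<gamma> (casimir_part T g (\<lambda>a c. \<Phi> (C a) c) n)"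
proof -
  let ?A = "words S (Suc n)" and ?B = "words S n"
  have Dw: "v \<in> ?B" if "(r, v) \<in> set (D c)" "c \<in> ?A" for r v c
  proof -
    have m: "mset c = add_mset i (mset v)" by (rule D[OF that(1)])
    have "set c = insert i (set v)" "length c = Suc (length v)"
      using arg_cong[OF m, of set_mset] arg_cong[OF m, of size] by simp_all
    then show ?thesis using that(2) by (auto simp: words_def)
  qed
  have Cw: "C a \<in> ?A" if "a \<in> ?B" for a
  proof -
    have "set (C a) = insert i (set a)" "length (C a) = Suc (length a)"
      using arg_cong[OF C[of a], of set_mset] arg_cong[OF C[of a], of size] by simp_all
    then show ?thesis using that i by (auto simp: words_def)
  qed
  have "casimir_part T g (\<lambda>a c. ev scale (\<Phi> a) (D c)) (Suc n)
      = (\<Sum>a\<in>?A. \<Sum>c\<in>?A. \<Sum>x\<in>?B. \<Sum>y\<in>?B. scale (g c * T a c * T y x * word_form (C y) c) (\<Phi> a x))"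
    unfolding casimir_part_def
  proof (intro sum.cong refl)
    fix a c assume a: "a \<in> ?A" and c: "c \<in> ?A"
    have "ev scale (\<Phi> a) (D c)
        = ev scale (\<lambda>v. \<Sum>x\<in>?B. \<Sum>y\<in>?B. scale (T y x * word_form y v) (\<Phi> a x)) (D c)"
      by (rule ev_cong, rule red2) (use a c Dw in \<open>auto simp: words_def\<close>)
    also have "\<dots> = (\<Sum>x\<in>?B. \<Sum>y\<in>?B. scale (T y x * word_form (C y) c) (\<Phi> a x))"
      by (simp add: ev_sum ev_scalar_family scalar_ev_scale DC)
    finally show "scale (g c * T a c) (ev scale (\<Phi> a) (D c))
        = (\<Sum>x\<in>?B. \<Sum>y\<in>?B. scale (g c * T a c * T y x * word_form (C y) c) (\<Phi> a x))"
      by (simp add: scale_sum_right mult.assoc)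
  qed
  also have "\<dots> = (\<Sum>y\<in>?B. \<Sum>x\<in>?B. \<Sum>a\<in>?A. \<Sum>c\<in>?A. scale (g c * T a c * T y x * word_form (C y) c) (\<Phi> a x))"
    by (rule sum_swap4)
  also have "\<dots> = (\<Sum>y\<in>?B. \<Sum>x\<in>?B. scale (\<gamma> * (g x * T y x)) (\<Phi> (C y) x))"
  proof (intro sum.cong refl)
    fix y x assume y: "y \<in> ?B" and x: "x \<in> ?B"
    have "\<Phi> (C y) x = (\<Sum>a\<in>?A. \<Sum>c\<in>?A. scale (T a c * word_form c (C y)) (\<Phi> a x))"
      by (rule red1[OF Cw[OF y]]) (use x in \<open>simp add: words_def\<close>)
    then have "scale (\<gamma> * (g x * T y x)) (\<Phi> (C y) x)
        = (\<Sum>a\<in>?A. \<Sum>c\<in>?A. scale (\<gamma> * (g x * T y x) * (T a c * word_form c (C y))) (\<Phi> a x))"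
      by (simp add: scale_sum_right)
    also have "\<dots> = (\<Sum>a\<in>?A. \<Sum>c\<in>?A. scale (g c * T a c * T y x * word_form (C y) c) (\<Phi> a x))"
    proof (intro sum.cong refl arg_cong2[where f = scale])
      fix a c
      show "\<gamma> * (g x * T y x) * (T a c * word_form c (C y)) = g c * T a c * T y x * word_form (C y) c"
      proof (cases "mset y = mset x \<and> mset (C y) = mset c")
        case True
        then have "g c = \<gamma> * g x" by (intro g) (metis C)
        then show ?thesis by (simp add: word_form_sym[of c])
      next
        case False
        then show ?thesis using block[of y x] word_form_eq_0[of "C y" c]
          by (auto simp: word_form_sym[of c])
      qed
    qed
    finally show "(\<Sum>a\<in>?A. \<Sum>c\<in>?A. scale (g c * T a c * T y x * word_form (C y) c) (\<Phi> a x))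
      = scale (\<gamma> * (g x * T y x)) (\<Phi> (C y) x)" ..
  qed
  also have "\<dots> = scale \<gamma> (casimir_part T g (\<lambda>a c. \<Phi> (C a) c) n)"
    by (simp add: casimir_part_def scale_sum_right)
  finally show ?thesis .
qed

lemma casimir_part_transpose:
  assumes "\<And>a c. mset a \<noteq> mset c \<Longrightarrow> T a c = 0" "\<And>v w. mset v = mset w \<Longrightarrow> g v = g w"
  shows "casimir_part T g \<Phi> n = casimir_part (\<lambda>a c. T c a) g (\<lambda>a c. \<Phi> c a) n"
proof -
  have *: "g c * T a c = g a * T a c" for a c using assms[of a c] by (cases "mset a = mset c") auto
  show ?thesis unfolding casimir_part_def
    by (subst sum.swap, intro sum.cong refl) (simp only: *)
qed

text \<open>This choice is forced: it makes the terms \<open>F\<^sub>a F\<^sub>i E\<^sub>c\<close> cancel when the Casimir operator is commuted with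
  \<open>F\<^sub>i\<close>.\<close>

definition letter_factor :: "('i \<Rightarrow> int) \<Rightarrow> 'i \<Rightarrow> 'k" where
  "letter_factor z i = - h i * q powi (- (pr z i + b i i))"

definition word_factor :: "('i \<Rightarrow> int) \<Rightarrow> 'i list \<Rightarrow> 'k" where
  "word_factor z w = prod_list (map (letter_factor z) w)"

lemma word_factor_mset: "mset v = mset w \<Longrightarrow> word_factor z v = word_factor z w"
  unfolding word_factor_def by (metis mset_map prod_mset_prod_list)

lemma word_factor_add: "mset w = add_mset i (mset v) \<Longrightarrow> word_factor z w = letter_factor z i * word_factor z v"
  using word_factor_mset[of w "i # v"] by (simp add: word_factor_def)

lemma powi_wpair_add: "mset w = add_mset i (mset v) \<Longrightarrow> q powi (- wpair w j) = q powi (- b i j) * q powi (- wpair v j)"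
  using wpair_mset[of w "i # v" j] powi_add[of "- b i j" "- wpair v j"] by simp

lemma word_factor_shift:
  "word_factor (z + nroot i 1) w = word_factor z w * q powi (- wpair w i)"
proof (induction w)
  case (Cons j w)
  have "letter_factor (z + nroot i 1) j = letter_factor z j * q powi (- b i j)"
    unfolding letter_factor_def mult.assoc powi_add[symmetric]
    by (simp add: algebra_simps)
  moreover have "q powi (- wpair (j # w) i) = q powi (- b i j) * q powi (- wpair w i)"
    using powi_wpair_add[of "j # w" j w i] by (simp add: b_sym[of j i])
  moreover have "word_factor y (j # w) = letter_factor y j * word_factor y w" for y
    by (simp add: word_factor_def)
  ultimately show ?case unfolding Cons.IH by (simp only: Cons.IH mult_ac)
qed (simp add: word_factor_def)

lemma E_words_nilpotent: "\<exists>N. \<forall>w z. \<forall>u\<in>W z. set w \<subseteq> S \<and> length w \<ge> N \<longrightarrow> foldr E w u = 0"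
proof -
  obtain B where B: "\<And>z. \<bar>height z\<bar> > B \<Longrightarrow> W z = {0}" using height_bounded by blast
  have "foldr E w u = 0" if u: "u \<in> W z" "set w \<subseteq> S" "length w \<ge> nat (2 * \<bar>B\<bar> + 1)" for w z u
  proof (cases "\<bar>height z\<bar> > B")
    case True
    interpret Ew: Vector_Spaces.linear scale scale "foldr E w" by (rule E_word_linear)
    show ?thesis using B[OF True] u(1) by (simp add: Ew.zero)
  next
    case False
    then have "W (z + content w) = {0}" using u(3) by (intro B) auto
    then show ?thesis using E_word_weight[OF u(2,1)] by simp
  qed
  then show ?thesis by blast
qed

text \<open>Words in \<open>E\<close> of this length or longer act by zero, so the Casimir operator is a finite sum.\<close>

definition word_bound :: nat where
  "word_bound = (SOME N. \<forall>w z. \<forall>u\<in>W z. set w \<subseteq> S \<and> length w \<ge> N \<longrightarrow> foldr E w u = 0)"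

lemma word_bound: "u \<in> W z \<Longrightarrow> c \<in> words S word_bound \<Longrightarrow> foldr E c u = 0"
  using someI_ex[OF E_words_nilpotent, folded word_bound_def] by (simp add: words_def)

abbreviation FE :: "'v \<Rightarrow> 'i list \<Rightarrow> 'i list \<Rightarrow> 'v" where
  "FE u a c \<equiv> foldr F a (foldr E c u)"

text \<open>The quantum Casimir operator on the weight space \<open>W z\<close>. The weight enters only through the coefficients.\<close>

definition omega :: "('i \<Rightarrow> int) \<Rightarrow> 'v \<Rightarrow> 'v" where
  "omega z u = (\<Sum>n\<le>word_bound. casimir_part gram_inverse (word_factor z) (FE u) n)"

lemma F_word_linear: "Vector_Spaces.linear scale scale (foldr F w)"
  by (rule weight_module.E_word_linear[OF chevalley_swap])

lemma F_word_weight: "set w \<subseteq> S \<Longrightarrow> u \<in> W z \<Longrightarrow> foldr F w u \<in> W (z - content w)"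
proof -
  assume w: "set w \<subseteq> S" and u: "u \<in> W z"
  have "u \<in> W (- (- z))" using u by simp
  from weight_module.E_word_weight[OF chevalley_swap w this] show ?thesis
    by (rule W_cong) simp
qed

lemma FE_reduce1:
  assumes u: "u \<in> W z" and c: "c \<in> words S m" and y: "set y \<subseteq> S"
  shows "FE u c y = (\<Sum>x\<in>words S m. \<Sum>x'\<in>words S m. scale (gram_inverse x x' * word_form x' c) (FE u x y))"
proof -
  have "foldr E y u \<in> W (- (- (z + content y)))" using E_word_weight[OF y u] by (rule W_cong) simp
  from weight_module.word_reduction[OF chevalley_swap gram_inverse_block gram_inverse c this]
  show ?thesis .
qed

lemma FE_reduce2:
  assumes u: "u \<in> W z" and c: "c \<in> words S m"
  shows "FE u y c = (\<Sum>x\<in>words S m. \<Sum>x'\<in>words S m. scale (gram_inverse x' x * word_form x' c) (FE u y x))"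
proof -
  interpret Fy: Vector_Spaces.linear scale scale "foldr F y" by (rule F_word_linear)
  have "foldr E c u = (\<Sum>x\<in>words S m. \<Sum>x'\<in>words S m. scale (gram_inverse x' x * word_form x' c) (foldr E x u))"
    by (rule word_reduction[OF _ gram_inverse_transpose c u]) (auto intro: gram_inverse_block)
  then show ?thesis by (simp add: Fy.sum Fy.scale)
qed

lemma sum_telescope_shift:
  fixes f1 f2 :: "nat \<Rightarrow> 'v"
  assumes "f2 0 = 0" "\<And>n. f2 (Suc n) = - f1 n" "f1 N = 0"
  shows "(\<Sum>n\<le>N. f1 n + f2 n) = 0"
proof -
  have "(\<Sum>n\<le>N. f2 n) = (\<Sum>n<N. - f1 n)"
    unfolding lessThan_Suc_atMost[symmetric] sum.lessThan_Suc_shift by (simp add: assms)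
  moreover have "(\<Sum>n\<le>N. f1 n) = (\<Sum>n<N. f1 n)"
    unfolding lessThan_Suc_atMost[symmetric] by (simp add: assms)
  ultimately show ?thesis by (simp add: sum.distrib sum_negf)
qed

lemma sum_shift:
  fixes f1 f2 :: "nat \<Rightarrow> 'v"
  assumes "f2 0 = 0" "\<And>n. f2 (Suc n) = f1 n" "f1 N = 0"
  shows "(\<Sum>n\<le>N. f2 n) = (\<Sum>n\<le>N. f1 n)"
proof -
  have "(\<Sum>n\<le>N. f2 n) = (\<Sum>n<N. f1 n)"
    unfolding lessThan_Suc_atMost[symmetric] sum.lessThan_Suc_shift by (simp add: assms)
  then show ?thesis unfolding lessThan_Suc_atMost[symmetric] by (simp add: assms)
qed

lemma words_0 [simp]: "words S 0 = {[]}"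
  by (auto simp: words_def)

lemma FE_bound:
  assumes "u \<in> W z" "c \<in> words S word_bound"
  shows "FE u a c = 0"
proof -
  interpret Fa: Vector_Spaces.linear scale scale "foldr F a" by (rule F_word_linear)
  show ?thesis unfolding word_bound[OF assms] by (rule Fa.zero)
qed

text \<open>Moving \<open>F i\<close> past the words in \<open>E\<close> produces three sums. By adjointness (\<open>casimir_part_shift\<close>) the part of
  length \<open>n + 1\<close> of \<open>f2\<close> cancels the part of length \<open>n\<close> of \<open>f1\<close>, and up to a power of \<open>q\<close> the
  sum \<open>f3\<close> is \<open>F i\<close> times the Casimir operator, with lengths shifted by one.\<close>

lemma omega_F:
  assumes i: "i \<in> S" and u: "u \<in> W z"
  shows "omega (z - nroot i 1) (F i u) = scale (q powi (- 2 * pr z i)) (F i (omega z u))"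
proof -
  define z' where "z' = z - nroot i 1"
  define \<zeta> where "\<zeta> = pr z i"
  define T where "T = gram_inverse"
  define g' where "g' = word_factor z'"
  have zz': "z = z' + nroot i 1" by (simp add: z'_def)
  have gz: "g' c * q powi (- wpair c i) = word_factor z c" for c
    unfolding zz' word_factor_shift g'_def ..
  have \<gamma>': "letter_factor z' i = - h i * q powi (- \<zeta>)"
    by (simp add: letter_factor_def z'_def \<zeta>_def)
  define f1 where "f1 = (\<lambda>n. casimir_part T g' (\<lambda>a c. FE u (a @ [i]) c) n)"
  define f2 where "f2 = (\<lambda>n. scale (q powi \<zeta> / h i) (casimir_part T g' (\<lambda>a c. ev scale (FE u a) (rder i c)) n))"
  define f3 where "f3 = (\<lambda>n. scale (- (q powi (- (\<zeta> - b i i)) / h i))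
      (casimir_part T (\<lambda>c. g' c * q powi (- wpair c i)) (\<lambda>a c. ev scale (FE u a) (lder i c)) n))"
  have summand: "casimir_part T g' (FE (F i u)) n = (f1 n + f2 n) + f3 n" for n
  proof -
    have "FE (F i u) a c = FE u (a @ [i]) c + scale (q powi \<zeta> / h i * 1) (ev scale (FE u a) (rder i c))
       + scale (- (q powi (- (\<zeta> - b i i)) / h i) * q powi (- wpair c i)) (ev scale (FE u a) (lder i c))"
      if c: "c \<in> words S n" for a c
    proof -
      interpret Fa: Vector_Spaces.linear scale scale "foldr F a" by (rule F_word_linear)
      have "set c \<subseteq> S" using c by (simp add: words_def)
      note EF = E_word_F[OF i this u, folded \<zeta>_def]
      have e: "q powi (- (\<zeta> + wpair c i - b i i)) = q powi (- (\<zeta> - b i i)) * q powi (- wpair c i)"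
        unfolding powi_add[symmetric] by (simp add: algebra_simps)
      show ?thesis unfolding EF e Fa.add Fa.diff Fa.scale ev_linear_image[OF F_word_linear]
        by (simp add: mult_ac)
    qed
    then have "casimir_part T g' (FE (F i u)) n = casimir_part T g' (\<lambda>a c. FE u (a @ [i]) c
       + scale (q powi \<zeta> / h i * 1) (ev scale (FE u a) (rder i c))
       + scale (- (q powi (- (\<zeta> - b i i)) / h i) * q powi (- wpair c i)) (ev scale (FE u a) (lder i c))) n"
      by (intro casimir_part_cong) auto
    also have "\<dots> = (f1 n + f2 n) + f3 n"
      unfolding casimir_part_add casimir_part_scale by (simp add: f1_def f2_def f3_def)
    finally show ?thesis .
  qed
  note shift = casimir_part_shift[of i gram_inverse "FE u", OF i gram_inverse_block FE_reduce1[OF u] FE_reduce2[OF u]]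
  have f2_Suc: "f2 (Suc n) = - f1 n" for n
  proof -
    have "casimir_part T g' (\<lambda>a c. ev scale (FE u a) (rder i c)) (Suc n)
        = scale (letter_factor z' i) (casimir_part T g' (\<lambda>a c. FE u (a @ [i]) c) n)"
      unfolding T_def
      by (rule shift[where C = "\<lambda>a. a @ [i]"])
        (auto simp: g'_def word_form_snoc intro: mset_rder word_factor_add)
    moreover have "q powi \<zeta> / h i * letter_factor z' i = - 1"
      unfolding \<gamma>' using h_nonzero[of i] q_nonzero by (simp add: power_int_minus field_simps)
    ultimately show ?thesis by (simp add: f2_def f1_def)
  qed
  have f3_Suc: "f3 (Suc n) = scale (q powi (- 2 * \<zeta>)) (F i (casimir_part T (word_factor z) (FE u) n))" for n
  proof -
    have "casimir_part T (\<lambda>c. g' c * q powi (- wpair c i)) (\<lambda>a c. ev scale (FE u a) (lder i c)) (Suc n)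
        = scale (letter_factor z' i * q powi (- b i i))
            (casimir_part T (\<lambda>c. g' c * q powi (- wpair c i)) (\<lambda>a c. FE u (i # a) c) n)"
      unfolding T_def
      by (rule shift[where C = "\<lambda>a. i # a"])
        (auto simp: g'_def word_factor_add powi_wpair_add mult_ac intro: mset_lder)
    also have "(\<lambda>c. g' c * q powi (- wpair c i)) = word_factor z" by (rule ext) (rule gz)
    also have "casimir_part T (word_factor z) (\<lambda>a c. FE u (i # a) c) n = F i (casimir_part T (word_factor z) (FE u) n)"
      by (simp add: casimir_part_linear[OF F_linear])
    finally have "f3 (Suc n) = scale (- (q powi (- (\<zeta> - b i i)) / h i) * (letter_factor z' i * q powi (- b i i)))
       (F i (casimir_part T (word_factor z) (FE u) n))"
      by (simp add: f3_def gz)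
    also have "- (q powi (- (\<zeta> - b i i)) / h i) * (letter_factor z' i * q powi (- b i i))
        = q powi (- (\<zeta> - b i i)) * q powi (- \<zeta>) * q powi (- b i i)"
      unfolding \<gamma>' using h_nonzero[of i] by (simp add: field_simps)
    also have "\<dots> = q powi (- 2 * \<zeta>)"
      unfolding powi_add[symmetric] by simp
    finally show ?thesis .
  qed
  have "omega z' (F i u) = (\<Sum>n\<le>word_bound. f1 n + f2 n) + (\<Sum>n\<le>word_bound. f3 n)"
    unfolding omega_def g'_def[symmetric] T_def[symmetric] summand by (rule sum.distrib)
  also have "(\<Sum>n\<le>word_bound. f1 n + f2 n) = 0"
  proof (rule sum_telescope_shift[of f2 f1, OF _ f2_Suc])
    show "f2 0 = 0" by (simp add: f2_def casimir_part_def)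
    show "f1 word_bound = 0" by (simp add: f1_def casimir_part_def FE_bound[OF u] del: foldr_append)
  qed
  also have "(\<Sum>n\<le>word_bound. f3 n) = (\<Sum>n\<le>word_bound. scale (q powi (- 2 * \<zeta>)) (F i (casimir_part T (word_factor z) (FE u) n)))"
  proof (rule sum_shift[of f3, OF _ f3_Suc])
    show "f3 0 = 0" by (simp add: f3_def casimir_part_def)
    have "casimir_part T (word_factor z) (FE u) word_bound = 0" by (simp add: casimir_part_def FE_bound[OF u])
    then show "scale (q powi (- 2 * \<zeta>)) (F i (casimir_part T (word_factor z) (FE u) word_bound)) = 0"
      by (simp add: F.zero)
  qed
  finally show ?thesis
    unfolding z'_def \<zeta>_def T_def omega_def[of z] F.sum scale_sum_right by (simp only: add_0_left)
qed

text \<open>The mirror image of the previous proof, with \<open>E i\<close> moved past the words in \<open>F\<close>.\<close>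

lemma E_omega:
  assumes i: "i \<in> S" and u: "u \<in> W z"
  shows "E i (omega z u) = scale (q powi (- 2 * (pr z i + b i i))) (omega (z + nroot i 1) (E i u))"
proof -
  define \<zeta> where "\<zeta> = pr z i"
  define T where "T = gram_inverse"
  define g where "g = word_factor z"
  have gz: "g c * q powi (- wpair c i) = word_factor (z + nroot i 1) c" for c
    unfolding word_factor_shift g_def ..
  have \<gamma>: "letter_factor z i = - h i * q powi (- (\<zeta> + b i i))"
    by (simp add: letter_factor_def \<zeta>_def)
  define f1 where "f1 = (\<lambda>n. casimir_part T g (\<lambda>a c. FE u a (i # c)) n)"
  define f2 where "f2 = (\<lambda>n. scale (q powi (\<zeta> + b i i) / h i) (casimir_part T g (\<lambda>a c. ev scale (\<lambda>v. FE u v c) (lder i a)) n))"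
  define f3 where "f3 = (\<lambda>n. scale (- (q powi (- \<zeta>) / h i))
      (casimir_part T (\<lambda>c. g c * q powi (- wpair c i)) (\<lambda>a c. ev scale (\<lambda>v. FE u v c) (rder i a)) n))"
  have summand: "E i (casimir_part T g (FE u) n) = (f1 n + f2 n) + f3 n" for n
  proof -
    have "E i (FE u a c) = FE u a (i # c) + scale (q powi (\<zeta> + b i i) / h i * 1) (ev scale (\<lambda>v. FE u v c) (lder i a))
       + scale (- (q powi (- \<zeta>) / h i) * q powi (- wpair c i)) (ev scale (\<lambda>v. FE u v c) (rder i a))"
      if a: "a \<in> words S n" and c: "c \<in> words S n" and "T a c \<noteq> 0" for a c
    proof -
      have m: "mset a = mset c" using that(3) gram_inverse_block[of a c] by (auto simp: T_def)
      have S: "set a \<subseteq> S" "set c \<subseteq> S" using a c by (auto simp: words_def)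
      define y where "y = foldr E c u"
      have "y \<in> W (z + content c)" unfolding y_def by (rule E_word_weight[OF S(2) u])
      then have y: "y \<in> W (- (- (z + content c)))" by (rule W_cong) simp
      have e: "q powi (- (- pr (z + content c) i + wpair a i - b i i)) = q powi (\<zeta> + b i i)"
        using wpair_mset[OF m] by (simp add: \<zeta>_def add.commute)
      have e': "q powi (- pr (z + content c) i) = q powi (- \<zeta>) * q powi (- wpair c i)"
        unfolding powi_add[symmetric] by (simp add: \<zeta>_def)
      have "foldr F a (E i y) = E i (foldr F a y)
        + (scale (q powi (- \<zeta>) * q powi (- wpair c i) / h i) (ev scale (\<lambda>v. foldr F v y) (rder i a))
         - scale (q powi (\<zeta> + b i i) / h i) (ev scale (\<lambda>v. foldr F v y) (lder i a)))"
        using weight_module.E_word_F[OF chevalley_swap i S(1) y] unfolding root_pair_simps(3) e e' .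
      then show ?thesis by (simp add: y_def algebra_simps)
    qed
    then have "E i (casimir_part T g (FE u) n) = casimir_part T g (\<lambda>a c. FE u a (i # c)
       + scale (q powi (\<zeta> + b i i) / h i * 1) (ev scale (\<lambda>v. FE u v c) (lder i a))
       + scale (- (q powi (- \<zeta>) / h i) * q powi (- wpair c i)) (ev scale (\<lambda>v. FE u v c) (rder i a))) n"
      unfolding casimir_part_linear[OF E_linear] by (intro casimir_part_cong) auto
    also have "\<dots> = (f1 n + f2 n) + f3 n"
      unfolding casimir_part_add casimir_part_scale by (simp add: f1_def f2_def f3_def)
    finally show ?thesis .
  qed
  have shift: "casimir_part T g (\<lambda>a c. ev scale (\<lambda>v. FE u v c) (D a)) (Suc n) = scale \<gamma> (casimir_part T g (\<lambda>a c. FE u a (C c)) n)"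
    if D: "\<And>r v w. (r, v) \<in> set (D w) \<Longrightarrow> mset w = add_mset i (mset v)"
      and C: "\<And>a. mset (C a) = add_mset i (mset a)"
      and DC: "\<And>a w. word_form (C a) w = ev (*) (word_form a) (D w)"
      and g: "\<And>v w. mset w = add_mset i (mset v) \<Longrightarrow> g w = \<gamma> * g v"
      and gm: "\<And>v w. mset v = mset w \<Longrightarrow> g v = g w" for D C g \<gamma> n
  proof -
    have block: "T a c = 0" if "mset a \<noteq> mset c" for a c
      unfolding T_def by (rule gram_inverse_block[OF that])
    have "casimir_part T g (\<lambda>a c. ev scale (\<lambda>v. FE u v c) (D a)) (Suc n)
        = casimir_part (\<lambda>a c. T c a) g (\<lambda>a c. ev scale (\<lambda>v. FE u v a) (D c)) (Suc n)"
      by (rule casimir_part_transpose[OF block gm])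
    also have "casimir_part (\<lambda>a c. T c a) g (\<lambda>a c. ev scale (\<lambda>v. FE u v a) (D c)) (Suc n)
        = scale \<gamma> (casimir_part (\<lambda>a c. T c a) g (\<lambda>a c. FE u c (C a)) n)"
    proof (rule casimir_part_shift[of i "\<lambda>a c. T c a" "\<lambda>a c. FE u c a"])
      show "T c a = 0" if "mset a \<noteq> mset c" for a c
        using block that by metis
      show "FE u y c = (\<Sum>x\<in>words S m. \<Sum>x'\<in>words S m. scale (T x' x * word_form x' c) (FE u y x))"
        if "c \<in> words S m" for m c y
        unfolding T_def by (rule FE_reduce2[OF u that])
      show "FE u c y = (\<Sum>x\<in>words S m. \<Sum>x'\<in>words S m. scale (T x x' * word_form x' c) (FE u x y))"
        if "c \<in> words S m" "set y \<subseteq> S" for m c y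
        unfolding T_def by (rule FE_reduce1[OF u that])
    qed (fact i D C DC g)+
    also have "casimir_part (\<lambda>a c. T c a) g (\<lambda>a c. FE u c (C a)) n = casimir_part T g (\<lambda>a c. FE u a (C c)) n"
      by (rule casimir_part_transpose[OF block gm, symmetric])
    finally show ?thesis .
  qed
  have f2_Suc: "f2 (Suc n) = - f1 n" for n
  proof -
    have "casimir_part T g (\<lambda>a c. ev scale (\<lambda>v. FE u v c) (lder i a)) (Suc n)
        = scale (letter_factor z i) (casimir_part T g (\<lambda>a c. FE u a (i # c)) n)"
      by (rule shift[where C = "\<lambda>a. i # a"])
        (auto simp: g_def intro: mset_lder word_factor_add word_factor_mset)
    moreover have "q powi (\<zeta> + b i i) / h i * letter_factor z i = - 1"
    proof -
      have "y / h i * (- h i * y') = - (y * y')" for y y'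
        using h_nonzero[of i] by simp
      moreover have "q powi (\<zeta> + b i i) * q powi (- (\<zeta> + b i i)) = 1"
        using q_nonzero by (simp only: power_int_minus) simp
      ultimately show ?thesis unfolding \<gamma> by simp
    qed
    ultimately show ?thesis by (simp add: f2_def f1_def)
  qed
  have f3_Suc: "f3 (Suc n) = scale (q powi (- 2 * (\<zeta> + b i i)))
      (casimir_part T (word_factor (z + nroot i 1)) (FE (E i u)) n)" for n
  proof -
    have "casimir_part T (\<lambda>c. g c * q powi (- wpair c i)) (\<lambda>a c. ev scale (\<lambda>v. FE u v c) (rder i a)) (Suc n)
        = scale (letter_factor z i * q powi (- b i i))
            (casimir_part T (\<lambda>c. g c * q powi (- wpair c i)) (\<lambda>a c. FE u a (c @ [i])) n)"
    proof (rule shift[where C = "\<lambda>a. a @ [i]"])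
      show "g v * q powi - wpair v i = g w * q powi - wpair w i" if "mset v = mset w" for v w
        using word_factor_mset[OF that] wpair_mset[OF that] by (simp add: g_def)
    qed (auto simp: g_def word_factor_add powi_wpair_add mult_ac word_form_snoc intro: mset_rder)
    then have "f3 (Suc n) = scale (- (q powi (- \<zeta>) / h i) * (letter_factor z i * q powi (- b i i)))
       (casimir_part T (word_factor (z + nroot i 1)) (FE (E i u)) n)"
      by (simp add: f3_def gz)
    also have "- (q powi (- \<zeta>) / h i) * (letter_factor z i * q powi (- b i i))
        = q powi (- \<zeta>) * q powi (- (\<zeta> + b i i)) * q powi (- b i i)"
      unfolding \<gamma> using h_nonzero[of i] by (simp add: field_simps)
    also have "\<dots> = q powi (- 2 * (\<zeta> + b i i))"
      unfolding powi_add[symmetric] by (simp add: algebra_simps)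
    finally show ?thesis .
  qed
  have "E i (omega z u) = (\<Sum>n\<le>word_bound. f1 n + f2 n) + (\<Sum>n\<le>word_bound. f3 n)"
    unfolding omega_def E.sum g_def[symmetric] T_def[symmetric] summand by (rule sum.distrib)
  also have "(\<Sum>n\<le>word_bound. f1 n + f2 n) = 0"
  proof (rule sum_telescope_shift[of f2 f1, OF _ f2_Suc])
    show "f2 0 = 0" by (simp add: f2_def casimir_part_def)
    have "FE u a (i # c) = 0" if "c \<in> words S word_bound" for a c
    proof -
      interpret Fa: Vector_Spaces.linear scale scale "foldr F a" by (rule F_word_linear)
      show ?thesis by (simp add: word_bound[OF u that] E.zero Fa.zero)
    qed
    then show "f1 word_bound = 0" by (simp add: f1_def casimir_part_def del: foldr.simps)
  qed
  also have "(\<Sum>n\<le>word_bound. f3 n) = (\<Sum>n\<le>word_bound. scale (q powi (- 2 * (\<zeta> + b i i)))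
      (casimir_part T (word_factor (z + nroot i 1)) (FE (E i u)) n))"
  proof (rule sum_shift[of f3, OF _ f3_Suc])
    show "f3 0 = 0" by (simp add: f3_def casimir_part_def)
    have "casimir_part T g (FE (E i u)) word_bound = 0" for g by (simp add: casimir_part_def FE_bound[OF E_weight[OF i u]])
    then show "scale (q powi (- 2 * (\<zeta> + b i i))) (casimir_part T (word_factor (z + nroot i 1)) (FE (E i u)) word_bound) = 0"
      by simp
  qed
  finally show ?thesis
    by (simp add: \<zeta>_def omega_def T_def scale_sum_right)
qed

lemma omega_linear: "Vector_Spaces.linear scale scale (omega z)"
proof
  fix u v r
  have l: "FE (u + v) a c = FE u a c + FE v a c" "FE (scale r u) a c = scale r (FE u a c)" for a c
  proof -
    interpret Ec: Vector_Spaces.linear scale scale "foldr E c" by (rule E_word_linear)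
    interpret Fa: Vector_Spaces.linear scale scale "foldr F a" by (rule F_word_linear)
    show "FE (u + v) a c = FE u a c + FE v a c" "FE (scale r u) a c = scale r (FE u a c)"
      by (simp_all add: Ec.add Ec.scale Fa.add Fa.scale)
  qed
  show "omega z (u + v) = omega z u + omega z v"
    unfolding omega_def l casimir_part_add sum.distrib ..
  show "omega z (scale r u) = scale r (omega z u)"
    unfolding omega_def l using casimir_part_scale[where l = "\<lambda>_. 1"] by (simp add: scale_sum_right)
qed

lemma omega_weight:
  assumes u: "u \<in> W z"
  shows "omega z u \<in> W z"
  unfolding omega_def
proof (intro subspace_sum[OF W_subspace] casimir_part_in_subspace[OF W_subspace])
  fix n a c assume a: "a \<in> words S n" and c: "c \<in> words S n" and "gram_inverse a c \<noteq> 0"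
  then have m: "content a = content c" using gram_inverse_block[of a c] content_cong by blast
  have S: "set a \<subseteq> S" "set c \<subseteq> S" using a c by (auto simp: words_def)
  show "FE u a c \<in> W z"
    by (rule W_cong[OF F_word_weight[OF S(1) E_word_weight[OF S(2) u]]]) (simp add: m)
qed

text \<open>Every term of positive length applies some \<open>E i\<close> to \<open>u\<close> first.\<close>

lemma omega_relative_singular:
  assumes N: "subspace N" "\<And>i x. i \<in> S \<Longrightarrow> x \<in> N \<Longrightarrow> E i x \<in> N" "\<And>i x. i \<in> S \<Longrightarrow> x \<in> N \<Longrightarrow> F i x \<in> N"
    and u: "\<And>i. i \<in> S \<Longrightarrow> E i u \<in> N"
  shows "omega z u - u \<in> N"
proof -
  have EN: "foldr E w x \<in> N" if "x \<in> N" "set w \<subseteq> S" for w x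
    using that(2) by (induction w) (auto simp: that(1) N)
  have FN: "foldr F w x \<in> N" if "x \<in> N" "set w \<subseteq> S" for w x
    using that(2) by (induction w) (auto simp: that(1) N)
  have "gram_inverse [] [] = 1" using gram_inverse[of "[]" 0 "[]"] by simp
  then have 0: "casimir_part gram_inverse (word_factor z) (FE u) 0 = u"
    by (simp add: casimir_part_def word_factor_def)
  have "casimir_part gram_inverse (word_factor z) (FE u) (Suc n) \<in> N" for n
  proof (rule casimir_part_in_subspace[OF N(1)])
    fix a c assume a: "a \<in> words S (Suc n)" and c: "c \<in> words S (Suc n)"
    have "c \<noteq> []" using c by (auto simp: words_def)
    then obtain v j where v: "c = v @ [j]" by (metis rev_exhaust)
    have "foldr E c u \<in> N" unfolding v using EN[of "E j u" v] u[of j] c by (auto simp: words_def v)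
    then show "FE u a c \<in> N" using FN a by (simp add: words_def)
  qed
  moreover have "omega z u - u = (\<Sum>n<word_bound. casimir_part gram_inverse (word_factor z) (FE u) (Suc n))"
    unfolding omega_def lessThan_Suc_atMost[symmetric] sum.lessThan_Suc_shift 0 by simp
  ultimately show ?thesis by (simp add: subspace_sum N(1))
qed

end

section \<open>Complete reducibility of weight modules\<close>

lemma sum_content:
  fixes f :: "'i::finite \<Rightarrow> int"
  shows "(\<Sum>i\<in>UNIV. content w i * f i) = (\<Sum>i\<leftarrow>w. f i)"
proof (induction w)
  case (Cons j w)
  have "content (j # w) i * f i = (if i = j then f j else 0) + content w i * f i" for i
    by (simp add: content_simps nroot_def distrib_right)
  then show ?case using Cons by (simp add: sum.distrib sum.delta)
qed (simp add: content_simps)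

context weight_module
begin

text \<open>The square length of \<open>z + \<rho>\<close> minus that of \<open>\<rho>\<close>, as \<open>2 \<rho>\<close> pairs to \<open>b i i\<close> with \<open>\<alpha>\<^sub>i\<close>.\<close>

definition casimir_exponent :: "('i \<Rightarrow> int) \<Rightarrow> int" where
  "casimir_exponent z = (\<Sum>i\<in>UNIV. z i * (pr z i + b i i))"

lemma pr_sym: "(\<Sum>i\<in>UNIV. x i * pr y i) = (\<Sum>i\<in>UNIV. y i * pr x i)"
proof -
  have "(\<Sum>i\<in>UNIV. x i * pr y i) = (\<Sum>i\<in>UNIV. \<Sum>j\<in>UNIV. y j * (x i * b i j))"
    by (simp add: root_pair_def sum_distrib_left b_sym[of _ i for i] mult_ac)
  also have "\<dots> = (\<Sum>j\<in>UNIV. \<Sum>i\<in>UNIV. y j * (x i * b i j))" by (rule sum.swap)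
  finally show ?thesis by (simp add: root_pair_def sum_distrib_left)
qed

lemma casimir_exponent_diff:
  "casimir_exponent x - casimir_exponent y = (\<Sum>i\<in>UNIV. (x - y) i * (pr x i + pr y i + b i i))"
proof -
  have "(\<Sum>i\<in>UNIV. (x - y) i * (pr x i + pr y i + b i i))
     = (\<Sum>i\<in>UNIV. x i * (pr x i + b i i)) - (\<Sum>i\<in>UNIV. y i * (pr y i + b i i))
       + ((\<Sum>i\<in>UNIV. x i * pr y i) - (\<Sum>i\<in>UNIV. y i * pr x i))"
    by (simp add: sum_subtractf[symmetric] sum.distrib[symmetric] algebra_simps)
  then show ?thesis unfolding pr_sym[of x y] by (simp add: casimir_exponent_def)
qed

lemma casimir_exponent_minus_root: "casimir_exponent (z - nroot i 1) = casimir_exponent z - 2 * pr z i"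
proof -
  have "casimir_exponent z - casimir_exponent (z - nroot i 1)
     = (\<Sum>j\<in>UNIV. nroot i 1 j * (pr z j + (pr z j - b i j) + b j j))"
    unfolding casimir_exponent_diff by simp
  also have "\<dots> = (\<Sum>j\<in>UNIV. if j = i then 2 * pr z i else 0)"
    by (rule sum.cong) (simp_all add: nroot_def)
  finally show ?thesis by simp
qed

text \<open>The difference of the two exponents is the pairing of \<open>\<eta> - \<mu>\<close>, a sum of simple roots from \<open>S\<close>, with
  \<open>\<eta> + \<mu> + 2 \<rho>\<close>; each letter contributes a positive summand.\<close>

lemma casimir_exponent_less:
  assumes "\<And>i. i \<in> S \<Longrightarrow> pr \<eta> i \<ge> 0" "\<And>i. i \<in> S \<Longrightarrow> pr \<mu> i \<ge> 0"
    and a: "set a \<subseteq> S" "a \<noteq> []" and eq: "\<eta> - content a = \<mu>"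
  shows "casimir_exponent \<mu> < casimir_exponent \<eta>"
proof -
  have "(\<eta> - \<mu>) i = content a i" for i using eq by auto
  then have "casimir_exponent \<eta> - casimir_exponent \<mu> = (\<Sum>i\<leftarrow>a. pr \<eta> i + pr \<mu> i + b i i)"
    unfolding casimir_exponent_diff by (simp only: sum_content)
  also have "\<dots> > 0"
  proof -
    have *: "pr \<eta> i + pr \<mu> i + b i i > 0" if "i \<in> S" for i
      using assms(1,2)[OF that] d_pos[of i] b_diag[of i] by linarith
    have "0 < (\<Sum>i\<leftarrow>a. f i)" if "\<And>i. i \<in> S \<Longrightarrow> f i > 0" for f :: "'i \<Rightarrow> int"
      using a(2,1) by (induction a rule: list_nonempty_induct) (auto intro!: add_pos_pos that)
    from this[OF *] show ?thesis .
  qed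
  finally show ?thesis by simp
qed

definition singular :: "('i \<Rightarrow> int) \<Rightarrow> 'v \<Rightarrow> bool" where
  "singular z w \<longleftrightarrow> w \<in> W z \<and> w \<noteq> 0 \<and> (\<forall>i\<in>S. E i w = 0)"

lemma singular_dominant: "singular z w \<Longrightarrow> i \<in> S \<Longrightarrow> pr z i \<ge> 0"
  by (rule relative_highest_weight_dominant[of i "{0}" w])
    (auto simp: singular_def E.zero F.zero subspace_single_0)

text \<open>The Casimir operator fixes \<open>w\<close>, and \<open>omega_F\<close> gives the change of the eigenvalue for each letter.\<close>

lemma omega_F_word:
  assumes w: "singular \<eta> w" and a: "set a \<subseteq> S"
  shows "omega (\<eta> - content a) (foldr F a w)
    = scale (q powi (casimir_exponent (\<eta> - content a) - casimir_exponent \<eta>)) (foldr F a w)"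
  using a
proof (induction a)
  case Nil
  have "omega \<eta> w - w \<in> {0}"
    by (rule omega_relative_singular) (use w in \<open>auto simp: singular_def E.zero F.zero subspace_single_0\<close>)
  then show ?case unfolding content_simps diff_0_right by simp
next
  case (Cons i a)
  define z where "z = \<eta> - content a"
  define u where "u = foldr F a w"
  have i: "i \<in> S" and a: "set a \<subseteq> S" using Cons.prems by auto
  have u: "u \<in> W z" unfolding u_def z_def
    by (rule F_word_weight[OF a]) (use w in \<open>simp add: singular_def\<close>)
  have z': "\<eta> - content (i # a) = z - nroot i 1"
    unfolding z_def content_simps by (simp only: diff_diff_eq add.commute)
  have "omega (z - nroot i 1) (F i u) = scale (q powi (- 2 * pr z i) * q powi (casimir_exponent z - casimir_exponent \<eta>)) (F i u)"
    unfolding omega_F[OF i u] Cons.IH[OF a, folded z_def u_def] F.scale scale_scale ..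
  also have "q powi (- 2 * pr z i) * q powi (casimir_exponent z - casimir_exponent \<eta>)
      = q powi (casimir_exponent (z - nroot i 1) - casimir_exponent \<eta>)"
    unfolding powi_add[symmetric] casimir_exponent_minus_root
    by (simp add: algebra_simps)
  finally show ?case unfolding z' foldr.simps o_apply u_def .
qed

lemma graded_component:
  assumes N: "\<And>z. subspace (N z)" "\<And>z. N z \<subseteq> W z"
    and x: "x \<in> span (\<Union>z. N z)" "x \<in> W \<mu>"
  shows "x \<in> N \<mu>"
proof -
  define P where "P = {z. W z \<noteq> {0}}"
  have P: "finite P" unfolding P_def by (rule W_finite)
  have N0: "x = 0" if "x \<in> N z" "z \<notin> P" for x z using that N(2)[of z] by (auto simp: P_def)
  have "\<exists>f. (\<forall>z. f z \<in> N z) \<and> x = (\<Sum>z\<in>P. f z)"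
    using x(1)
  proof (induction rule: span_induct)
    case base
    show ?case
      unfolding subspace_def mem_Collect_eq
    proof (intro conjI ballI allI)
      show "\<exists>f. (\<forall>z. f z \<in> N z) \<and> 0 = (\<Sum>z\<in>P. f z)"
        by (rule exI[of _ "\<lambda>_. 0"]) (simp add: subspace_0 N(1))
    next
      fix x y assume "x \<in> {x. \<exists>f. (\<forall>z. f z \<in> N z) \<and> x = (\<Sum>z\<in>P. f z)}"
        and "y \<in> {x. \<exists>f. (\<forall>z. f z \<in> N z) \<and> x = (\<Sum>z\<in>P. f z)}"
      then obtain f g where "\<And>z. f z \<in> N z" "x = (\<Sum>z\<in>P. f z)" "\<And>z. g z \<in> N z" "y = (\<Sum>z\<in>P. g z)"
        by blast
      then show "\<exists>f. (\<forall>z. f z \<in> N z) \<and> x + y = (\<Sum>z\<in>P. f z)"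
        by (intro exI[of _ "\<lambda>z. f z + g z"]) (simp add: subspace_add N(1) sum.distrib)
    next
      fix c x assume "x \<in> {x. \<exists>f. (\<forall>z. f z \<in> N z) \<and> x = (\<Sum>z\<in>P. f z)}"
      then obtain f where "\<And>z. f z \<in> N z" "x = (\<Sum>z\<in>P. f z)" by blast
      then show "\<exists>f. (\<forall>z. f z \<in> N z) \<and> scale c x = (\<Sum>z\<in>P. f z)"
        by (intro exI[of _ "\<lambda>z. scale c (f z)"]) (simp add: subspace_scale N(1) scale_sum_right)
    qed
  next
    case (step x)
    then obtain z where z: "x \<in> N z" by blast
    have "x = (\<Sum>y\<in>P. if y = z then x else 0)" using N0[OF z] P by (simp add: sum.delta)
    then show ?case
      by (intro exI[of _ "\<lambda>y. if y = z then x else 0"]) (use z N(1) in \<open>auto simp: subspace_0\<close>)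
  qed
  then obtain f where f: "\<And>z. f z \<in> N z" "x = (\<Sum>z\<in>P. f z)" by blast
  show ?thesis
  proof (cases "\<mu> \<in> P")
    case True
    have "f \<mu> - (if \<mu> = \<mu> then x else 0) = 0"
    proof (rule W_indep[of P "\<lambda>z. f z - (if z = \<mu> then x else 0)" \<mu>, OF P _ _ True])
      show "f z - (if z = \<mu> then x else 0) \<in> W z" for z
        using f(1)[of z] N(2)[of z] x(2) W_subspace[of z] by (auto simp: subspace_0 intro!: subspace_diff)
      show "(\<Sum>z\<in>P. f z - (if z = \<mu> then x else 0)) = 0"
        using True P f(2) by (simp add: sum_subtractf sum.delta)
    qed
    then show ?thesis using f(1)[of \<mu>] by simp
  next
    case False
    then have "x = 0" using x(2) by (auto simp: P_def)
    then show ?thesis using subspace_0[OF N(1)] by simp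
  qed
qed

lemma omega_span_eigen:
  assumes "\<And>x. x \<in> X \<Longrightarrow> omega z x = scale c x" "u \<in> span X"
  shows "omega z u = scale c u"
proof -
  interpret O: Vector_Spaces.linear scale scale "omega z" by (rule omega_linear)
  have "subspace {u. omega z u = scale c u}"
    by (auto simp: subspace_def O.zero O.add O.scale scale_right_distrib mult.commute)
  from span_minimal[OF _ this, of X] assms show ?thesis by blast
qed

text \<open>A singular vector \<open>u\<close> is fixed by the Casimir operator, but as an element of weight \<open>\<mu>\<close> of the module
  generated by \<open>w\<close> it is multiplied by \<open>q\<close> to the power of the difference of the two exponents. Hence the
  exponents agree, and \<open>casimir_exponent_less\<close> leaves the empty word only.\<close>

theorem singular_vector_in_highest_weight_module:
  assumes w: "singular \<eta> w" and u: "singular \<mu> u"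
    and mem: "u \<in> span {foldr F a w | a. set a \<subseteq> S}"
  shows "u \<in> span {w}"
proof -
  define X where "X = (\<lambda>z. {foldr F a w | a. set a \<subseteq> S \<and> \<eta> - content a = z})"
  have wW: "w \<in> W \<eta>" using w by (simp add: singular_def)
  have "foldr F a w \<in> W z" if "set a \<subseteq> S" "\<eta> - content a = z" for a z
    using F_word_weight[OF that(1) wW] that(2) by simp
  then have XW: "X z \<subseteq> W z" for z by (auto simp: X_def)
  have "span {foldr F a w | a. set a \<subseteq> S} \<subseteq> span (\<Union>z. span (X z))"
    by (rule span_mono) (auto simp: X_def intro!: span_base)
  then have uX: "u \<in> span (X \<mu>)"
    using graded_component[of "\<lambda>z. span (X z)" u \<mu>] mem u XW span_minimal[OF _ W_subspace]
    by (auto simp: singular_def)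
  have "omega \<mu> u = scale (q powi (casimir_exponent \<mu> - casimir_exponent \<eta>)) u"
    by (rule omega_span_eigen[OF _ uX]) (auto simp: X_def dest: omega_F_word[OF w])
  moreover have "omega \<mu> u - u \<in> {0}"
    by (rule omega_relative_singular) (use u in \<open>auto simp: singular_def E.zero F.zero subspace_single_0\<close>)
  ultimately have "scale (q powi (casimir_exponent \<mu> - casimir_exponent \<eta>)) u = scale (q powi 0) u" by simp
  then have "q powi (casimir_exponent \<mu> - casimir_exponent \<eta>) = q powi 0"
    using u unfolding scale_cancel_right singular_def by blast
  then have eq: "casimir_exponent \<mu> = casimir_exponent \<eta>"
    using powi_eq_iff[OF q_nonzero q_not_root, of "casimir_exponent \<mu> - casimir_exponent \<eta>" 0] by simp
  have "X \<mu> \<subseteq> {w}"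
  proof
    fix x assume "x \<in> X \<mu>"
    then obtain a where a: "x = foldr F a w" "set a \<subseteq> S" "\<eta> - content a = \<mu>" by (auto simp: X_def)
    have "a = []"
    proof (rule ccontr)
      assume "a \<noteq> []"
      from casimir_exponent_less[OF singular_dominant[OF w] singular_dominant[OF u] a(2) this a(3)] eq
      show False by simp
    qed
    then show "x \<in> {w}" using a by simp
  qed
  then show ?thesis using span_mono uX by blast
qed

definition singular_span :: "'v set" where
  "singular_span = span {foldr F a w | a w \<eta>. set a \<subseteq> S \<and> singular \<eta> w}"

lemma E_F_word_in_span:
  assumes i: "i \<in> S" and w: "singular \<eta> w" and a: "set a \<subseteq> S"
  shows "E i (foldr F a w) \<in> span {foldr F a w | a. set a \<subseteq> S}"
proof -
  let ?N = "span {foldr F a w | a. set a \<subseteq> S}"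
  have wW: "w \<in> W (- (- \<eta>))" and Ew: "E i w = 0" using w i by (simp_all add: singular_def)
  interpret Fa: Vector_Spaces.linear scale scale "foldr F a" by (rule F_word_linear)
  have N: "ev scale (\<lambda>v. foldr F v w) y \<in> ?N"
    if "\<And>r v. (r, v) \<in> set y \<Longrightarrow> mset a = add_mset i (mset v)" for y
  proof (rule ev_in_subspace[OF subspace_span])
    fix r v assume "(r, v) \<in> set y"
    then have "set v \<subseteq> S" using a arg_cong[OF that, of r v set_mset] by auto
    then show "foldr F v w \<in> ?N" by (auto intro!: span_base)
  qed
  define R where "R = ev scale (\<lambda>v. foldr F v w) (rder i a)"
  define L where "L = ev scale (\<lambda>v. foldr F v w) (lder i a)"
  have "R \<in> ?N" "L \<in> ?N" unfolding R_def L_def by (rule N, erule mset_rder mset_lder)+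
  moreover obtain r l where "0 = E i (foldr F a w) + (scale r R - scale l L)"
    using weight_module.E_word_F[OF chevalley_swap i a wW, folded R_def L_def] unfolding Ew Fa.zero by blast
  then have "E i (foldr F a w) = scale l L - scale r R"
    by (simp add: eq_neg_iff_add_eq_0 algebra_simps)
  ultimately show ?thesis by (auto intro: span_diff span_scale)
qed

lemma singular_span_stable:
  assumes i: "i \<in> S" and x: "x \<in> singular_span"
  shows "E i x \<in> singular_span" "F i x \<in> singular_span"
proof -
  let ?X = "{foldr F a w | a w \<eta>. set a \<subseteq> S \<and> singular \<eta> w}"
  have gen: "E i y \<in> span ?X \<and> F i y \<in> span ?X" if yX: "y \<in> ?X" for y
  proof -
    obtain a w \<eta> where y: "y = foldr F a w" and a: "set a \<subseteq> S" and w: "singular \<eta> w"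
      using yX by blast
    have "span {foldr F a w | a. set a \<subseteq> S} \<subseteq> span ?X"
      by (rule span_mono) (use w in blast)
    moreover have "F i y = foldr F (i # a) w \<and> set (i # a) \<subseteq> S \<and> singular \<eta> w"
      using a w i y by simp
    then have "F i y \<in> span ?X" by (intro span_base) blast
    ultimately show ?thesis using E_F_word_in_span[OF i w a] y by blast
  qed
  have "E i ` span ?X \<subseteq> span ?X" "F i ` span ?X \<subseteq> span ?X"
    unfolding E.span_image[symmetric] F.span_image[symmetric]
    by (rule span_minimal[OF _ subspace_span], use gen in blast)+
  then show "E i x \<in> singular_span" "F i x \<in> singular_span" using x unfolding singular_span_def by blast+
qed

text \<open>The vectors \<open>E i u\<close> are sums of eigenvectors of the Casimir operator with exponents from \<open>\<Lambda>\<close>. Passing from \<open>u\<close>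
  to \<open>omega \<mu> u - \<gamma> u\<close> with \<open>\<gamma> = q powi (casimir_exponent \<mu> - e)\<close> eliminates the exponent \<open>e\<close>, and modulo
  \<open>singular_span\<close> it only multiplies \<open>u\<close> by \<open>1 - \<gamma> \<noteq> 0\<close>. Once \<open>\<Lambda>\<close> is exhausted, \<open>u\<close> is singular or zero.\<close>

lemma mem_singular_span_by_eigenvalues:
  assumes "finite \<Lambda>" and "\<And>e. e \<in> \<Lambda> \<Longrightarrow> e \<noteq> casimir_exponent \<mu>" and "u \<in> W \<mu>"
    and "\<And>i. i \<in> S \<Longrightarrow> E i u \<in> span {x \<in> singular_span. \<exists>e\<in>\<Lambda>.
      omega (\<mu> + nroot i 1) x = scale (q powi (casimir_exponent (\<mu> + nroot i 1) - e)) x}"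
  shows "u \<in> singular_span"
  using assms
proof (induction \<Lambda> arbitrary: u rule: finite_induct)
  case empty
  then have "E i u = 0" if "i \<in> S" for i using that by auto
  then have "u = 0 \<or> singular \<mu> u" using empty.prems by (auto simp: singular_def)
  then show ?case
  proof
    assume s: "singular \<mu> u"
    have "u = foldr F [] u \<and> set [] \<subseteq> S \<and> singular \<mu> u" using s by simp
    then show ?thesis unfolding singular_span_def by (intro span_base) blast
  qed (simp add: singular_span_def span_zero)
next
  case (insert e \<Lambda>)
  let ?X = "\<lambda>\<Lambda> i. {x \<in> singular_span. \<exists>e\<in>\<Lambda>.
      omega (\<mu> + nroot i 1) x = scale (q powi (casimir_exponent (\<mu> + nroot i 1) - e)) x}"
  define \<gamma> where "\<gamma> = q powi (casimir_exponent \<mu> - e)"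
  define u' where "u' = omega \<mu> u - scale \<gamma> u"
  have \<gamma>: "\<gamma> \<noteq> 1"
    using insert.prems(1)[of e] powi_eq_iff[OF q_nonzero q_not_root, of "casimir_exponent \<mu> - e" 0]
    by (auto simp: \<gamma>_def)
  have "u' \<in> singular_span"
  proof (rule insert.IH)
    show "u' \<in> W \<mu>" unfolding u'_def
      by (intro subspace_diff subspace_scale W_subspace omega_weight insert.prems)
    show "E i u' \<in> span (?X \<Lambda> i)" if i: "i \<in> S" for i
    proof -
      interpret O: Vector_Spaces.linear scale scale "omega (\<mu> + nroot i 1)" by (rule omega_linear)
      define \<kappa> where "\<kappa> = q powi (- 2 * (pr \<mu> i + b i i))"
      define L where "L = (\<lambda>x. scale \<kappa> (omega (\<mu> + nroot i 1) x) - scale \<gamma> x)"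
      have \<kappa>: "\<kappa> * q powi (casimir_exponent (\<mu> + nroot i 1) - e) = \<gamma>"
      proof -
        have "\<mu> = (\<mu> + nroot i 1) - nroot i 1" by simp
        then have "casimir_exponent \<mu> = casimir_exponent (\<mu> + nroot i 1) - 2 * (pr \<mu> i + b i i)"
          using casimir_exponent_minus_root[of "\<mu> + nroot i 1" i] by simp
        then have "- 2 * (pr \<mu> i + b i i) + (casimir_exponent (\<mu> + nroot i 1) - e) = casimir_exponent \<mu> - e"
          by linarith
        then show ?thesis unfolding \<kappa>_def \<gamma>_def powi_add[symmetric]
          by (simp only:)
      qed
      have L: "Vector_Spaces.linear scale scale L"
        by unfold_locales (simp_all add: L_def O.add O.scale scale_right_distrib scale_right_diff_distrib mult.commute)
      interpret L: Vector_Spaces.linear scale scale L by (rule L)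
      have "L x \<in> span (?X \<Lambda> i)" if xX: "x \<in> ?X (insert e \<Lambda>) i" for x
      proof (cases "omega (\<mu> + nroot i 1) x = scale (q powi (casimir_exponent (\<mu> + nroot i 1) - e)) x")
        case True
        then have "L x = 0" by (simp add: L_def \<kappa>)
        then show ?thesis by (simp add: span_zero)
      next
        case False
        then obtain e' where e': "e' \<in> \<Lambda>"
          "omega (\<mu> + nroot i 1) x = scale (q powi (casimir_exponent (\<mu> + nroot i 1) - e')) x"
          using xX by auto
        then have "x \<in> span (?X \<Lambda> i)" using xX by (intro span_base) blast
        moreover have "L x = scale (\<kappa> * q powi (casimir_exponent (\<mu> + nroot i 1) - e') - \<gamma>) x"
          by (simp add: L_def e'(2) scale_left_diff_distrib)
        ultimately show ?thesis by (simp add: span_scale)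
      qed
      then have "L ` span (?X (insert e \<Lambda>) i) \<subseteq> span (?X \<Lambda> i)"
        unfolding L.span_image[symmetric] by (intro span_minimal subspace_span) auto
      then have "L (E i u) \<in> span (?X \<Lambda> i)" using insert.prems(3)[OF i] by blast
      moreover have "E i u' = L (E i u)"
        by (simp add: u'_def E.diff E.scale E_omega[OF i insert.prems(2)] L_def \<kappa>_def)
      ultimately show ?thesis by (simp only:)
    qed
  qed (use insert.prems in auto)
  moreover have "omega \<mu> u - u \<in> singular_span"
  proof (rule omega_relative_singular)
    show "E i u \<in> singular_span" if "i \<in> S" for i
    proof -
      have "span (?X (insert e \<Lambda>) i) \<subseteq> singular_span"
        unfolding singular_span_def by (rule span_minimal[OF _ subspace_span]) auto
      then show ?thesis using insert.prems(3)[OF that] by blast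
    qed
    show "subspace singular_span" by (simp add: singular_span_def)
  qed (rule singular_span_stable, assumption+)+
  ultimately have "(omega \<mu> u - scale \<gamma> u) - (omega \<mu> u - u) \<in> singular_span"
    unfolding u'_def singular_span_def by (rule span_diff)
  also have "(omega \<mu> u - scale \<gamma> u) - (omega \<mu> u - u) = scale (1 - \<gamma>) u"
    by (simp add: scale_left_diff_distrib)
  finally have "scale (inverse (1 - \<gamma>)) (scale (1 - \<gamma>) u) \<in> singular_span"
    unfolding singular_span_def by (rule span_scale)
  then show ?case using \<gamma> by simp
qed

text \<open>Among the weights whose weight space is not contained in the span let \<open>\<mu>\<close> have maximal height. A vector \<open>u\<close> of
  weight \<open>\<mu>\<close> outside the span is singular modulo it, so \<open>\<mu>\<close> is dominant; hence the exponents occurring in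
  \<open>E i u\<close> are larger than that of \<open>\<mu>\<close> and the previous lemma applies.\<close>

theorem generated_by_singular_vectors: "W z \<subseteq> singular_span"
proof (rule ccontr)
  assume "\<not> W z \<subseteq> singular_span"
  define Z where "Z = {z. \<not> W z \<subseteq> singular_span}"
  have "0 \<in> singular_span" by (simp add: singular_span_def span_zero)
  then have "Z \<subseteq> {z. W z \<noteq> {0}}" by (auto simp: Z_def)
  then have "finite Z" using W_finite finite_subset by blast
  moreover have "Z \<noteq> {}" using \<open>\<not> W z \<subseteq> singular_span\<close> by (auto simp: Z_def)
  ultimately have "Max (height ` Z) \<in> height ` Z" by (intro Max_in) auto
  then obtain \<mu> where \<mu>1: "\<mu> \<in> Z" "Max (height ` Z) = height \<mu>" by blast
  have \<mu>: "\<mu> \<in> Z" "\<And>z. z \<in> Z \<Longrightarrow> height z \<le> height \<mu>"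
    unfolding \<mu>1(2)[symmetric] using \<open>finite Z\<close> \<mu>1(1) by auto
  obtain u where u: "u \<in> W \<mu>" "u \<notin> singular_span" using \<mu>(1) by (auto simp: Z_def)
  have up: "W (\<mu> + nroot i 1) \<subseteq> singular_span" for i
  proof (rule ccontr)
    assume "\<not> ?thesis"
    then have "height (\<mu> + nroot i 1) \<le> height \<mu>" by (intro \<mu>(2)) (simp add: Z_def)
    then show False by simp
  qed
  have Eu: "E i u \<in> singular_span" if "i \<in> S" for i
    using E_weight[OF that u(1)] up by blast
  have dom: "pr \<mu> i \<ge> 0" if i: "i \<in> S" for i
    by (rule relative_highest_weight_dominant[OF i _ _ _ u(1,2) Eu[OF i]])
      (simp_all add: singular_span_stable[OF i], simp add: singular_span_def)
  define \<Lambda> where "\<Lambda> = {e \<in> casimir_exponent ` {z. W z \<noteq> {0}}. e \<noteq> casimir_exponent \<mu>}"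
  have "u \<in> singular_span"
  proof (rule mem_singular_span_by_eigenvalues[of \<Lambda> \<mu> u])
    show "finite \<Lambda>" unfolding \<Lambda>_def using W_finite by simp
    show "e \<noteq> casimir_exponent \<mu>" if "e \<in> \<Lambda>" for e using that by (simp add: \<Lambda>_def)
    show "u \<in> W \<mu>" by fact
    fix i assume i: "i \<in> S"
    let ?\<nu> = "\<mu> + nroot i 1"
    define X where "X = (\<lambda>z. {foldr F a w | a w \<eta>. set a \<subseteq> S \<and> singular \<eta> w \<and> \<eta> - content a = z})"
    have "foldr F a w \<in> W z" if "set a \<subseteq> S" "singular \<eta> w" "\<eta> - content a = z" for a w \<eta> z
      using F_word_weight[OF that(1), of w \<eta>] that(2,3) by (simp add: singular_def)
    then have XW: "X z \<subseteq> W z" for z unfolding X_def by blast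
    have "singular_span \<subseteq> span (\<Union>z. span (X z))"
      unfolding singular_span_def by (rule span_mono) (auto simp: X_def intro!: span_base)
    then have EX: "E i u \<in> span (X ?\<nu>)"
      using graded_component[of "\<lambda>z. span (X z)" "E i u" ?\<nu>] Eu[OF i] E_weight[OF i u(1)] XW
        span_minimal[OF _ W_subspace] by blast
    have "X ?\<nu> \<subseteq> {x \<in> singular_span. \<exists>e\<in>\<Lambda>. omega ?\<nu> x = scale (q powi (casimir_exponent ?\<nu> - e)) x}"
    proof
      fix x assume "x \<in> X ?\<nu>"
      then obtain a w \<eta> where a: "x = foldr F a w" "set a \<subseteq> S" "singular \<eta> w" "\<eta> - content a = ?\<nu>"
        unfolding X_def by blast
      have eq: "\<eta> - content (a @ [i]) = \<mu>"
      proof -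
        have "\<eta> - content (a @ [i]) = (\<eta> - content a) - nroot i 1"
          unfolding content_simps by (simp only: add_0_right diff_diff_eq)
        then show ?thesis unfolding a(4) by simp
      qed
      have "casimir_exponent \<mu> < casimir_exponent \<eta>"
        by (rule casimir_exponent_less[OF singular_dominant[OF a(3)] dom _ _ eq]) (use a i in auto)
      moreover have "W \<eta> \<noteq> {0}" using a(3) by (auto simp: singular_def)
      ultimately have "casimir_exponent \<eta> \<in> \<Lambda>" by (auto simp: \<Lambda>_def)
      moreover have "x \<in> singular_span"
        unfolding singular_span_def by (rule span_base) (use a in blast)
      ultimately show "x \<in> {x \<in> singular_span. \<exists>e\<in>\<Lambda>. omega ?\<nu> x = scale (q powi (casimir_exponent ?\<nu> - e)) x}"
        using omega_F_word[OF a(3,2)] unfolding a(1) a(4) by blast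
    qed
    from span_mono[OF this] EX
    show "E i u \<in> span {x \<in> singular_span. \<exists>e\<in>\<Lambda>. omega ?\<nu> x = scale (q powi (casimir_exponent ?\<nu> - e)) x}"
      by blast
  qed
  then show False using u(2) by contradiction
qed

end

section \<open>The adjoint action of the quantized enveloping algebra\<close>

lemma poly_mapping_sum_single:
  "(\<Sum>w\<in>Poly_Mapping.keys f. Poly_Mapping.single w (Poly_Mapping.lookup f w)) = f"
proof (rule poly_mapping_eqI)
  fix v
  have "Poly_Mapping.lookup (\<Sum>w\<in>X. Poly_Mapping.single w (Poly_Mapping.lookup f w)) v
      = (if v \<in> X then Poly_Mapping.lookup f v else 0)" if "finite X" for X
    using that by (induction X rule: finite_induct) (auto simp: lookup_add lookup_single when_def)
  then show "Poly_Mapping.lookup (\<Sum>w\<in>Poly_Mapping.keys f. Poly_Mapping.single w (Poly_Mapping.lookup f w)) v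
      = Poly_Mapping.lookup f v" by (simp add: in_keys_iff)
qed

lemma free_eval_superset:
  assumes "vector_space sc" "finite X" "Poly_Mapping.keys f \<subseteq> X"
  shows "free_eval sc g f = (\<Sum>w\<in>X. sc (Poly_Mapping.lookup f w) (prod_list (map g w)))"
proof -
  interpret vector_space sc by fact
  show ?thesis unfolding free_eval_def
    by (rule sum.mono_neutral_left[OF assms(2,3)]) (auto simp: in_keys_iff)
qed

lemma free_eval_add:
  assumes "vector_space sc"
  shows "free_eval sc g (f + f') = free_eval sc g f + free_eval sc g f'"
proof -
  interpret vector_space sc by fact
  have "finite (Poly_Mapping.keys f \<union> Poly_Mapping.keys f')" by simp
  note e = free_eval_superset[OF assms this]
  show ?thesis
    unfolding e[OF Poly_Mapping.keys_add] e[OF Un_upper1] e[OF Un_upper2]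
    by (simp add: lookup_add scale_left_distrib sum.distrib)
qed

lemma free_eval_single:
  assumes "vector_space sc"
  shows "free_eval sc g (Poly_Mapping.single w c) = sc c (prod_list (map g w))"
  by (subst free_eval_superset[OF assms, of "{w}"]) (auto simp: lookup_single)

lemma free_eval_sum:
  assumes "vector_space sc"
  shows "free_eval sc g (\<Sum>x\<in>X. f x) = (\<Sum>x\<in>X. free_eval sc g (f x))"
proof -
  have "free_eval sc g 0 = 0" by (simp add: free_eval_def)
  then show ?thesis
    by (induction X rule: infinite_finite_induct) (simp_all add: free_eval_add[OF assms])
qed

lemma free_eval_mult:
  assumes "is_algebra sc"
  shows "free_eval sc g (f * f') = free_eval sc g f * free_eval sc g f'"
proof -
  have vs: "vector_space sc" and m: "sc c x * y = sc c (x * y)" "x * sc c y = sc c (x * y)" for c x y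
    using assms unfolding is_algebra_def by metis+
  interpret vector_space sc by fact
  let ?s = "\<lambda>f w. Poly_Mapping.single w (Poly_Mapping.lookup f w)"
  have "f * f' = (\<Sum>v\<in>Poly_Mapping.keys f. ?s f v) * (\<Sum>w\<in>Poly_Mapping.keys f'. ?s f' w)"
    by (simp only: poly_mapping_sum_single)
  also have "\<dots> = (\<Sum>v\<in>Poly_Mapping.keys f. \<Sum>w\<in>Poly_Mapping.keys f'.
      Poly_Mapping.single (v @ w) (Poly_Mapping.lookup f v * Poly_Mapping.lookup f' w))"
    by (simp add: sum_product mult_single plus_list_def)
  finally have "free_eval sc g (f * f') = (\<Sum>v\<in>Poly_Mapping.keys f. \<Sum>w\<in>Poly_Mapping.keys f'.
      sc (Poly_Mapping.lookup f v * Poly_Mapping.lookup f' w) (prod_list (map g v) * prod_list (map g w)))"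
    by (simp only: free_eval_sum[OF vs] free_eval_single[OF vs] map_append prod_list.append)
  then show ?thesis by (simp add: free_eval_def sum_product m mult.commute)
qed

lemma free_eval_simps:
  assumes "is_algebra sc"
  shows "free_eval sc g (f - f') = free_eval sc g f - free_eval sc g f'"
    and "free_eval sc g 1 = 1"
    and "free_eval sc g (free_gen x) = g x"
    and "free_eval sc g (free_scale c f) = sc c (free_eval sc g f)"
proof -
  have vs: "vector_space sc" and m: "sc c x * y = sc c (x * y)" for c x y
    using assms unfolding is_algebra_def by metis+
  interpret vector_space sc by fact
  show "free_eval sc g (f - f') = free_eval sc g f - free_eval sc g f'"
    using free_eval_add[OF vs, of g "f - f'" f'] by simp
  show "free_eval sc g 1 = 1"
    unfolding single_one[symmetric] by (simp add: free_eval_single[OF vs] zero_list_def)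
  show "free_eval sc g (free_gen x) = g x"
    by (simp add: free_gen_def free_eval_single[OF vs])
  show "free_eval sc g (free_scale c f) = sc c (free_eval sc g f)"
    by (simp add: free_scale_def free_eval_mult[OF assms] free_eval_single[OF vs] zero_list_def m)
qed

lemma tensor_eq_refl: "tensor_eq sc s s"
  by (rule tensor_eq.perm) simp

lemma tensor_eq_append2: "tensor_eq sc s s' \<Longrightarrow> tensor_eq sc t t' \<Longrightarrow> tensor_eq sc (s @ t) (s' @ t')"
proof -
  assume s: "tensor_eq sc s s'" and t: "tensor_eq sc t t'"
  have "tensor_eq sc (s' @ t) (t @ s')" "tensor_eq sc (t' @ s') (s' @ t')"
    by (rule tensor_eq.perm; simp)+
  then show ?thesis
    using tensor_eq.append[OF s, of t] tensor_eq.append[OF t, of s'] tensor_eq.trans by metis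
qed

locale algebra_tensor =
  fixes sc :: "'k::field \<Rightarrow> 'u::ring_1 \<Rightarrow> 'u"
  assumes alg: "is_algebra sc"
begin

sublocale vector_space sc using alg by (simp add: is_algebra_def)

lemma sc_mult: "sc c x * y = sc c (x * y)" "x * sc c y = sc c (x * y)"
  using alg unfolding is_algebra_def by metis+

lemma tensor_eq_map_mult_left:
  "tensor_eq sc s t \<Longrightarrow> tensor_eq sc (map (\<lambda>(x, y). (a * x, b * y)) s) (map (\<lambda>(x, y). (a * x, b * y)) t)"
proof (induction rule: tensor_eq.induct)
  case (perm s t)
  then show ?case by (intro tensor_eq.perm) simp
qed (auto simp: distrib_left sc_mult intro: tensor_eq.intros)

lemma tensor_eq_map_mult_right:
  "tensor_eq sc s t \<Longrightarrow> tensor_eq sc (map (\<lambda>(x, y). (x * a, y * b)) s) (map (\<lambda>(x, y). (x * a, y * b)) t)"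
proof (induction rule: tensor_eq.induct)
  case (perm s t)
  then show ?case by (intro tensor_eq.perm) simp
qed (auto simp: distrib_right sc_mult intro: tensor_eq.intros)

lemma tensor_mult_cong2:
  assumes "tensor_eq sc t t'"
  shows "tensor_eq sc (tensor_mult s t) (tensor_mult s t')"
  unfolding tensor_mult_def
proof (induction s)
  case (Cons p s)
  obtain x y where p: "p = (x, y)" by (cases p)
  show ?case using tensor_eq_append2[OF tensor_eq_map_mult_left[OF assms, of x y] Cons] by (simp add: p)
qed (simp add: tensor_eq_refl)

lemma tensor_mult_swap:
  "mset (tensor_mult s t) = mset (concat (map (\<lambda>(x', y'). map (\<lambda>(x, y). (x * x', y * y')) s) t))"
  unfolding tensor_mult_def
proof (induction s)
  case Nil
  show ?case by (induction t) auto
next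
  case (Cons p s)
  obtain x y where p: "p = (x, y)" by (cases p)
  have "mset (concat (map (\<lambda>(x', y'). map (\<lambda>(x, y). (x * x', y * y')) ((x, y) # s)) t))
     = mset (map (\<lambda>(x', y'). (x * x', y * y')) t)
       + mset (concat (map (\<lambda>(x', y'). map (\<lambda>(x, y). (x * x', y * y')) s) t))"
    by (induction t) auto
  then show ?case using Cons by (simp add: p)
qed

text \<open>Up to the order of the summands, a product is also a concatenation of right multiples of the first factor.\<close>

lemma tensor_mult_cong1:
  assumes "tensor_eq sc s s'"
  shows "tensor_eq sc (tensor_mult s t) (tensor_mult s' t)"
proof -
  let ?f = "\<lambda>s t. concat (map (\<lambda>(x', y'). map (\<lambda>(x, y). (x * x', y * y')) s) t)"
  have "tensor_eq sc (?f s t) (?f s' t)"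
  proof (induction t)
    case (Cons p t)
    obtain x y where p: "p = (x, y)" by (cases p)
    show ?case using tensor_eq_append2[OF tensor_eq_map_mult_right[OF assms, of x y] Cons] by (simp add: p)
  qed (simp add: tensor_eq_refl)
  moreover have "tensor_eq sc (tensor_mult s t) (?f s t)" "tensor_eq sc (?f s' t) (tensor_mult s' t)"
    by (rule tensor_eq.perm; simp add: tensor_mult_swap)+
  ultimately show ?thesis by (blast intro: tensor_eq.trans)
qed

lemma tensor_scale_eq_mult: "tensor_scale sc c s = tensor_mult [(sc c 1, 1)] s"
  by (auto simp: tensor_scale_def tensor_mult_def sc_mult)

end

locale quantum_group =
  fixes A :: "'i::finite \<Rightarrow> 'i \<Rightarrow> int" and d :: "'i \<Rightarrow> nat" and q :: "'k::field"
    and U :: "('i, 'k, 'u::ring_1) quantum_algebra"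
  assumes qea: "is_quantized_enveloping_algebra A d q U"
    and symm: "symmetrizes d A"
    and q0: "q \<noteq> 0"
begin

abbreviation sc where "sc \<equiv> scl U"
abbreviation \<sigma> where "\<sigma> \<equiv> antipode U"

definition form :: "'i \<Rightarrow> 'i \<Rightarrow> int" where
  "form i j = int (d i) * A i j"

lemma presented: "is_presented_by sc (gen U) (uq_relators A d q)"
  and is_comult: "is_comult U" and is_antipode: "is_antipode U"
  using qea by (auto simp: is_quantized_enveloping_algebra_def)

sublocale algebra_tensor sc
  by unfold_locales (use presented in \<open>simp add: is_presented_by_def\<close>)

lemma form_sym: "form i j = form j i"
  using symm by (simp add: form_def symmetrizes_def)

lemma eval_relator: "r \<in> uq_relators A d q \<Longrightarrow> free_eval sc (gen U) r = 0"
  using presented by (simp add: is_presented_by_def two_sided_ideal.gen)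

lemmas eval_simps = free_eval_mult[OF alg] free_eval_simps[OF alg]

lemma pair_form: "pair_simple d (simple_root_weight A i) j = form i j"
  by (simp add: pair_simple_simple_root[OF symm] form_def)

lemma powi_add: "q powi (m + n) = q powi m * q powi n"
  by (rule power_int_add) (simp add: q0)

lemma K_Kinv [simp]: "Kgen U i * Kinv U i = 1"
proof -
  have "(free_gen (gK i) * free_gen (gKinv i) - 1 :: ('i gen_symbol, 'k) free_alg) \<in> uq_relators A d q"
    unfolding uq_relators_def Let_def by blast
  from eval_relator[OF this] show ?thesis by (simp add: eval_simps)
qed

lemma Kinv_K [simp]: "Kinv U i * Kgen U i = 1"
proof -
  have "(free_gen (gKinv i) * free_gen (gK i) - 1 :: ('i gen_symbol, 'k) free_alg) \<in> uq_relators A d q"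
    unfolding uq_relators_def Let_def by blast
  from eval_relator[OF this] show ?thesis by (simp add: eval_simps)
qed

lemma K_comm: "Kgen U i * Kgen U j = Kgen U j * Kgen U i"
proof -
  have "(free_gen (gK i) * free_gen (gK j) - free_gen (gK j) * free_gen (gK i) :: ('i gen_symbol, 'k) free_alg)
      \<in> uq_relators A d q"
    unfolding uq_relators_def Let_def by blast
  from eval_relator[OF this] show ?thesis by (simp add: eval_simps)
qed

lemma K_E: "Kgen U i * Egen U j * Kinv U i = sc (q powi form i j) (Egen U j)"
proof -
  have "(free_gen (gK i) * free_gen (gE j) * free_gen (gKinv i) - free_scale (q powi form i j) (free_gen (gE j)))
      \<in> uq_relators A d q"
    unfolding uq_relators_def Let_def pair_form by blast
  from eval_relator[OF this] show ?thesis by (simp add: eval_simps)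
qed

lemma K_F: "Kgen U i * Fgen U j * Kinv U i = sc (q powi (- form i j)) (Fgen U j)"
proof -
  have "(free_gen (gK i) * free_gen (gF j) * free_gen (gKinv i) - free_scale (q powi (- form i j)) (free_gen (gF j)))
      \<in> uq_relators A d q"
    unfolding uq_relators_def Let_def pair_form by blast
  from eval_relator[OF this] show ?thesis by (simp add: eval_simps)
qed

lemma E_F: "Egen U i * Fgen U j - Fgen U j * Egen U i
    = (if i = j then sc (1 / qdiff q (int (d i))) (Kgen U i - Kinv U i) else 0)"
proof (cases "i = j")
  case True
  have "(free_gen (gE i) * free_gen (gF i) - free_gen (gF i) * free_gen (gE i)
      - free_scale (1 / (q ^ d i - inverse (q ^ d i))) (free_gen (gK i) - free_gen (gKinv i)))
      \<in> uq_relators A d q"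
    unfolding uq_relators_def Let_def by blast
  from eval_relator[OF this] show ?thesis using True
    by (simp add: eval_simps qdiff_def power_int_minus)
next
  case False
  then have "(free_gen (gE i) * free_gen (gF j) - free_gen (gF j) * free_gen (gE i) :: ('i gen_symbol, 'k) free_alg)
      \<in> uq_relators A d q"
    unfolding uq_relators_def Let_def by blast
  from eval_relator[OF this] show ?thesis using False by (simp add: eval_simps)
qed

lemma antipode_simps:
  "\<sigma> 1 = 1" "\<sigma> (a + c) = \<sigma> a + \<sigma> c" "\<sigma> (sc r a) = sc r (\<sigma> a)" "\<sigma> (a * c) = \<sigma> c * \<sigma> a"
  "\<sigma> (Egen U i) = - (Kinv U i * Egen U i)" "\<sigma> (Fgen U i) = - (Fgen U i * Kgen U i)"
  "\<sigma> (Kgen U i) = Kinv U i"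
  using is_antipode by (auto simp: is_antipode_def Let_def)

lemma antipode_zero: "\<sigma> 0 = 0"
  using antipode_simps(2)[of 0 0] by simp

lemma antipode_Kinv: "\<sigma> (Kinv U i) = Kgen U i"
proof -
  have "\<sigma> (Kinv U i) * Kinv U i = 1"
    using antipode_simps(4)[of "Kgen U i" "Kinv U i"] by (simp add: antipode_simps(1,7))
  then have "\<sigma> (Kinv U i) * Kinv U i * Kgen U i = Kgen U i" by simp
  then show ?thesis by (simp add: mult.assoc)
qed

text \<open>The adjoint action through a list that represents a tensor; \<open>tensor_act_cong\<close> shows that the
  list may be replaced by any other representative.\<close>

definition tensor_act :: "('u \<times> 'u) list \<Rightarrow> 'u \<Rightarrow> 'u" where
  "tensor_act t v = (\<Sum>(x, y)\<leftarrow>t. x * v * \<sigma> y)"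

lemma tensor_act_simps [simp]:
  "tensor_act [] v = 0" "tensor_act ((x, y) # t) v = x * v * \<sigma> y + tensor_act t v"
  "tensor_act (s @ t) v = tensor_act s v + tensor_act t v"
  by (simp_all add: tensor_act_def)

lemma tensor_act_cong: "tensor_eq sc s t \<Longrightarrow> tensor_act s v = tensor_act t v"
proof (induction rule: tensor_eq.induct)
  case (perm s t)
  then show ?case unfolding tensor_act_def sum_mset_sum_list[symmetric] mset_map by (simp only:)
qed (simp_all add: antipode_simps antipode_zero distrib_left distrib_right sc_mult)

lemma tensor_act_add: "tensor_act t (v + w) = tensor_act t v + tensor_act t w"
  by (induction t) (auto simp: distrib_left distrib_right)

lemma tensor_act_scale: "tensor_act t (sc c v) = sc c (tensor_act t v)"
  by (induction t) (auto simp: sc_mult scale_right_distrib)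

lemma tensor_act_scale_left: "tensor_act (tensor_scale sc c t) v = sc c (tensor_act t v)"
  by (induction t) (auto simp: tensor_scale_def sc_mult scale_right_distrib)

lemma tensor_act_mult: "tensor_act (tensor_mult s t) v = tensor_act s (tensor_act t v)"
proof (induction s)
  case (Cons p s)
  obtain x y where p: "p = (x, y)" by (cases p)
  have "tensor_act (map (\<lambda>(x', y'). (x * x', y * y')) t) v = x * tensor_act t v * \<sigma> y"
    by (induction t) (auto simp: distrib_left distrib_right antipode_simps mult.assoc)
  then show ?case using Cons by (simp add: p tensor_mult_def)
qed (simp add: tensor_mult_def)

lemma comult_simps:
  "tensor_eq sc (comult U 1) [(1, 1)]"
  "tensor_eq sc (comult U (a + c)) (comult U a @ comult U c)"
  "tensor_eq sc (comult U (sc r a)) (tensor_scale sc r (comult U a))"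
  "tensor_eq sc (comult U (a * c)) (tensor_mult (comult U a) (comult U c))"
  "tensor_eq sc (comult U (Egen U i)) [(Egen U i, 1), (Kgen U i, Egen U i)]"
  "tensor_eq sc (comult U (Fgen U i)) [(Fgen U i, Kinv U i), (1, Fgen U i)]"
  "tensor_eq sc (comult U (Kgen U i)) [(Kgen U i, Kgen U i)]"
  using is_comult unfolding is_comult_def Let_def by blast+

text \<open>Multiply \<open>\<Delta>(K\<^sup>-\<^sup>1) \<Delta>(K) = 1 \<otimes> 1\<close> by \<open>K\<^sup>-\<^sup>1 \<otimes> K\<^sup>-\<^sup>1\<close> from the right.\<close>

lemma comult_Kinv: "tensor_eq sc (comult U (Kinv U i)) [(Kinv U i, Kinv U i)]"
proof -
  let ?K = "Kgen U i" and ?K' = "Kinv U i"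
  have "tensor_eq sc (tensor_mult (comult U ?K') (comult U ?K)) (comult U (?K' * ?K))"
    by (rule tensor_eq.sym[OF comult_simps(4)])
  then have "tensor_eq sc (tensor_mult (comult U ?K') (comult U ?K)) [(1, 1)]"
    using comult_simps(1) by (auto intro: tensor_eq.trans)
  moreover have "tensor_eq sc (tensor_mult (comult U ?K') [(?K, ?K)]) (tensor_mult (comult U ?K') (comult U ?K))"
    by (rule tensor_eq.sym[OF tensor_mult_cong2[OF comult_simps(7)]])
  ultimately have "tensor_eq sc (tensor_mult (comult U ?K') [(?K, ?K)]) [(1, 1)]"
    by (blast intro: tensor_eq.trans)
  from tensor_eq_map_mult_right[OF this, of ?K' ?K']
  have "tensor_eq sc (map (\<lambda>(x, y). (x * ?K', y * ?K')) (tensor_mult (comult U ?K') [(?K, ?K)])) [(?K', ?K')]"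
    by simp
  also have "map (\<lambda>(x, y). (x * ?K', y * ?K')) (tensor_mult t [(?K, ?K)]) = t" for t
    by (induction t) (auto simp: tensor_mult_def mult.assoc)
  finally show ?thesis .
qed

lemma adL_eq: "tensor_eq sc (comult U a) t \<Longrightarrow> adL U a v = tensor_act t v"
  using tensor_act_cong[of "comult U a" t v] by (simp add: adL_def tensor_act_def)

lemma adL_simps:
  "adL U 1 v = v" "adL U (a + c) v = adL U a v + adL U c v" "adL U (sc r a) v = sc r (adL U a v)"
  "adL U (a * c) v = adL U a (adL U c v)" "adL U a (v + w) = adL U a v + adL U a w"
  "adL U a (sc r v) = sc r (adL U a v)"
  "adL U (Kgen U i) v = Kgen U i * v * Kinv U i"
proof -
  have D: "adL U a v = tensor_act (comult U a) v" for a v by (rule adL_eq[OF tensor_eq_refl])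
  show "adL U 1 v = v" by (simp add: adL_eq[OF comult_simps(1)] antipode_simps)
  show "adL U (a + c) v = adL U a v + adL U c v" by (simp only: adL_eq[OF comult_simps(2)] tensor_act_simps D[symmetric])
  show "adL U (sc r a) v = sc r (adL U a v)"
    by (simp only: adL_eq[OF comult_simps(3)] tensor_act_scale_left D[symmetric])
  show "adL U (a * c) v = adL U a (adL U c v)"
    by (simp only: adL_eq[OF comult_simps(4)] tensor_act_mult D[symmetric])
  show "adL U a (v + w) = adL U a v + adL U a w" by (simp add: D tensor_act_add)
  show "adL U a (sc r v) = sc r (adL U a v)" by (simp add: D tensor_act_scale)
  show "adL U (Kgen U i) v = Kgen U i * v * Kinv U i"
    by (simp add: adL_eq[OF comult_simps(7)] antipode_simps)
qed

lemma adL_zero: "adL U a 0 = 0"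
  using adL_simps(6)[of a 0 0] by simp

lemma adL_linear: "Vector_Spaces.linear sc sc (adL U a)"
  by unfold_locales (simp_all add: adL_simps)

lemma adL_linear_left: "Vector_Spaces.linear sc sc (\<lambda>a. adL U a v)"
  by unfold_locales (simp_all add: adL_simps)

text \<open>The subalgebra generated by the generators of the Levi subalgebra. Being closed under comultiplication and
  antipode it coincides with \<open>levi U S\<close>, for which it supplies an induction principle.\<close>

inductive_set levi_span :: "'i set \<Rightarrow> 'u set" for S where
  E: "i \<in> S \<Longrightarrow> Egen U i \<in> levi_span S"
| F: "i \<in> S \<Longrightarrow> Fgen U i \<in> levi_span S"
| K: "Kgen U j \<in> levi_span S"
| Kinv: "Kinv U j \<in> levi_span S"
| one: "1 \<in> levi_span S"
| zero: "0 \<in> levi_span S"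
| add: "a \<in> levi_span S \<Longrightarrow> c \<in> levi_span S \<Longrightarrow> a + c \<in> levi_span S"
| scale: "a \<in> levi_span S \<Longrightarrow> sc r a \<in> levi_span S"
| mult: "a \<in> levi_span S \<Longrightarrow> c \<in> levi_span S \<Longrightarrow> a * c \<in> levi_span S"

lemma levi_span_uminus: "a \<in> levi_span S \<Longrightarrow> - a \<in> levi_span S"
  using levi_span.scale[of a S "- 1"] by simp

lemma levi_span_comult: "a \<in> levi_span S \<Longrightarrow> \<exists>t. set t \<subseteq> levi_span S \<times> levi_span S \<and> tensor_eq sc (comult U a) t"
proof (induction rule: levi_span.induct)
  case (E i)
  then show ?case by (intro exI conjI, rule_tac[2] comult_simps(5)) (auto intro: levi_span.intros)
next
  case (F i)
  then show ?case by (intro exI conjI, rule_tac[2] comult_simps(6)) (auto intro: levi_span.intros)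
next
  case (K j)
  show ?case by (intro exI conjI, rule_tac[2] comult_simps(7)) (auto intro: levi_span.intros)
next
  case (Kinv j)
  show ?case by (intro exI conjI, rule_tac[2] comult_Kinv) (auto intro: levi_span.intros)
next
  case one
  show ?case by (intro exI conjI, rule_tac[2] comult_simps(1)) (auto intro: levi_span.intros)
next
  case zero
  have "tensor_eq sc (comult U (sc 0 0)) (tensor_scale sc 0 [])"
  proof -
    have "tensor_eq sc (tensor_scale sc 0 t) []" for t
    proof (induction t)
      case (Cons p t)
      obtain x y where p: "p = (x, y)" by (cases p)
      have "tensor_eq sc [(0, y)] []" by (rule tensor_eq.zero_left)
      from tensor_eq_append2[OF this Cons] show ?case by (simp add: p tensor_scale_def)
    qed (simp add: tensor_scale_def tensor_eq_refl)
    then show ?thesis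
      using comult_simps(3)[of 0 0] unfolding tensor_scale_def[of _ _ "[]"] by (auto intro: tensor_eq.trans)
  qed
  then show ?case by (intro exI[of _ "[]"]) (simp add: tensor_scale_def)
next
  case (add a c)
  then obtain s t where "set s \<subseteq> levi_span S \<times> levi_span S" "tensor_eq sc (comult U a) s"
    "set t \<subseteq> levi_span S \<times> levi_span S" "tensor_eq sc (comult U c) t" by blast
  then show ?case
    by (intro exI[of _ "s @ t"]) (auto intro: tensor_eq.trans[OF comult_simps(2)] tensor_eq_append2)
next
  case (scale a r)
  then obtain s where s: "set s \<subseteq> levi_span S \<times> levi_span S" "tensor_eq sc (comult U a) s" by blast
  have "tensor_eq sc (comult U (sc r a)) (tensor_scale sc r s)"
    by (rule tensor_eq.trans[OF comult_simps(3)]) (simp add: tensor_scale_eq_mult tensor_mult_cong2 s)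
  moreover have "set (tensor_scale sc r s) \<subseteq> levi_span S \<times> levi_span S"
    using s(1) by (auto simp: tensor_scale_def intro: levi_span.scale)
  ultimately show ?case by blast
next
  case (mult a c)
  then obtain s t where s: "set s \<subseteq> levi_span S \<times> levi_span S" "tensor_eq sc (comult U a) s"
    "set t \<subseteq> levi_span S \<times> levi_span S" "tensor_eq sc (comult U c) t" by blast
  have "tensor_eq sc (comult U (a * c)) (tensor_mult s t)"
    by (rule tensor_eq.trans[OF comult_simps(4) tensor_eq.trans[OF tensor_mult_cong1[OF s(2)] tensor_mult_cong2[OF s(4)]]])
  moreover have "set (tensor_mult s t) \<subseteq> levi_span S \<times> levi_span S"
    using s(1,3) by (fastforce simp: tensor_mult_def intro: levi_span.mult)
  ultimately show ?case by blast
qed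

lemma levi_span_antipode: "a \<in> levi_span S \<Longrightarrow> \<sigma> a \<in> levi_span S"
  by (induction rule: levi_span.induct)
    (auto simp: antipode_simps antipode_zero antipode_Kinv intro!: levi_span_uminus intro: levi_span.intros)

lemma hopf_subalgebra_levi_span: "hopf_subalgebra U (levi_span S)"
  unfolding hopf_subalgebra_def subspace_def
  by (auto intro: levi_span.intros levi_span_comult levi_span_antipode)

lemma levi_subset: "levi U S \<subseteq> levi_span S"
  unfolding levi_def using hopf_subalgebra_levi_span by (intro Inter_lower) (auto intro: levi_span.intros)

lemma levi_superset: "levi_span S \<subseteq> levi U S"
proof
  fix a assume "a \<in> levi_span S"
  then show "a \<in> levi U S"
  proof (induction rule: levi_span.induct)
    case (add a c)
    then show ?case by (auto simp: levi_def hopf_subalgebra_def subspace_add)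
  next
    case (scale a r)
    then show ?case by (auto simp: levi_def hopf_subalgebra_def subspace_scale)
  qed (auto simp: levi_def hopf_subalgebra_def subspace_0)
qed

lemma levi_eq: "levi U S = levi_span S"
  using levi_subset levi_superset by blast

lemma levi_stable:
  assumes N: "subspace N"
    and E: "\<And>i x. i \<in> S \<Longrightarrow> x \<in> N \<Longrightarrow> adL U (Egen U i) x \<in> N"
    and F: "\<And>i x. i \<in> S \<Longrightarrow> x \<in> N \<Longrightarrow> adL U (Fgen U i) x \<in> N"
    and K: "\<And>j x. x \<in> N \<Longrightarrow> adL U (Kgen U j) x \<in> N" "\<And>j x. x \<in> N \<Longrightarrow> adL U (Kinv U j) x \<in> N"
    and a: "a \<in> levi U S" and x: "x \<in> N"
  shows "adL U a x \<in> N"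
  using a x unfolding levi_eq
proof (induction arbitrary: x rule: levi_span.induct)
  case zero
  have "adL U 0 x = 0" using adL_simps(3)[of 0 0 x] by simp
  then show ?case using N by (simp add: subspace_0)
qed (auto simp: adL_simps(1-4) E F K subspace_add subspace_scale N)

definition weight_space :: "('i \<Rightarrow> int) \<Rightarrow> 'u set" where
  "weight_space z = {u. \<forall>j. adL U (Kgen U j) u = sc (q powi root_pair form z j) u}"

lemma weight_space_subspace: "subspace (weight_space z)"
  by (auto simp: subspace_def weight_space_def adL_simps(5,6) adL_zero scale_right_distrib mult.commute)

lemma weight_space_one: "1 \<in> weight_space 0"
  by (simp add: weight_space_def adL_simps)

lemma weight_space_mult:
  assumes "x \<in> weight_space z" "y \<in> weight_space z'"
  shows "x * y \<in> weight_space (z + z')"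
  unfolding weight_space_def
proof (intro CollectI allI)
  fix j
  have "adL U (Kgen U j) (x * y) = Kgen U j * x * (Kinv U j * Kgen U j) * y * Kinv U j"
    by (simp only: Kinv_K) (simp add: adL_simps mult.assoc)
  also have "\<dots> = adL U (Kgen U j) x * adL U (Kgen U j) y"
    by (simp only: adL_simps mult.assoc)
  also have "\<dots> = sc (q powi root_pair form z j * q powi root_pair form z' j) (x * y)"
    using assms by (simp add: weight_space_def sc_mult mult.commute)
  finally show "adL U (Kgen U j) (x * y) = sc (q powi root_pair form (z + z') j) (x * y)"
    by (simp add: powi_add)
qed

lemma Kinv_act:
  assumes "u \<in> weight_space z"
  shows "adL U (Kinv U j) u = sc (q powi (- root_pair form z j)) u"
proof -
  have "adL U (Kinv U j) (sc (q powi root_pair form z j) u) = u"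
    using assms adL_simps(4)[of "Kinv U j" "Kgen U j" u] by (simp add: weight_space_def adL_simps(1))
  then have "sc (q powi root_pair form z j) (adL U (Kinv U j) u) = u" by (simp add: adL_simps(6))
  then have "sc (q powi (- root_pair form z j)) (sc (q powi root_pair form z j) (adL U (Kinv U j) u))
      = sc (q powi (- root_pair form z j)) u" by simp
  moreover have "q powi (- root_pair form z j) * q powi root_pair form z j = 1"
    unfolding powi_add[symmetric] by simp
  ultimately show ?thesis by simp
qed

primrec symbol_weight :: "'i gen_symbol \<Rightarrow> 'i \<Rightarrow> int" where
  "symbol_weight (gE i) = nroot i 1"
| "symbol_weight (gF i) = nroot i (- 1)"
| "symbol_weight (gK i) = 0"
| "symbol_weight (gKinv i) = 0"

lemma gen_weight: "gen U s \<in> weight_space (symbol_weight s)"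
proof -
  have "Kgen U j * gen U s * Kinv U j = sc (q powi root_pair form (symbol_weight s) j) (gen U s)" for j
  proof (cases s)
    case (gE i)
    then show ?thesis by (simp add: K_E form_sym[of j])
  next
    case (gF i)
    then show ?thesis by (simp add: K_F form_sym[of j])
  next
    case (gK i)
    then show ?thesis by (simp add: K_comm[of j] mult.assoc)
  next
    case (gKinv i)
    have "Kgen U j * Kinv U i = Kinv U i * (Kgen U i * Kgen U j) * Kinv U i"
      by (simp add: mult.assoc[symmetric])
    also have "\<dots> = Kinv U i * Kgen U j"
      by (simp only: K_comm[of i j]) (simp add: mult.assoc)
    finally show ?thesis using gKinv by (simp add: mult.assoc)
  qed
  then show ?thesis by (simp add: weight_space_def adL_simps)
qed

text \<open>Monomials in the generators are weight vectors, and they span \<open>U\<close>.\<close>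

lemma weight_decomposition:
  "\<exists>X f. finite X \<and> (\<forall>z. f z \<in> weight_space z) \<and> u = (\<Sum>z\<in>X. f z)"
proof -
  obtain p where p: "free_eval sc (gen U) p = u" using presented by (auto simp: is_presented_by_def)
  define wt where "wt = (\<lambda>w. \<Sum>s\<leftarrow>w. symbol_weight s)"
  have mono: "prod_list (map (gen U) w) \<in> weight_space (wt w)" for w
  proof (induction w)
    case (Cons s w)
    have "wt (s # w) = symbol_weight s + wt w" by (simp only: wt_def list.map sum_list.Cons)
    then show ?case unfolding list.map prod_list.Cons
      by (simp only: weight_space_mult[OF gen_weight Cons])
  next
    case Nil
    show ?case unfolding wt_def list.map sum_list.Nil prod_list.Nil by (rule weight_space_one)
  qed
  define f where "f = (\<lambda>z. \<Sum>w\<in>{w \<in> Poly_Mapping.keys p. wt w = z}.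
      sc (Poly_Mapping.lookup p w) (prod_list (map (gen U) w)))"
  have "u = (\<Sum>z\<in>wt ` Poly_Mapping.keys p. f z)"
    unfolding p[symmetric] free_eval_def f_def by (rule sum.image_gen) simp
  moreover have "f z \<in> weight_space z" for z
    unfolding f_def using mono
    by (intro subspace_sum weight_space_subspace subspace_scale) auto
  ultimately show ?thesis
    by (intro exI[of _ "wt ` Poly_Mapping.keys p"] exI[of _ f] conjI allI) simp_all
qed

lemma adL_E_weight: "u \<in> weight_space z \<Longrightarrow> adL U (Egen U i) u \<in> weight_space (z + nroot i 1)"
  and adL_F_weight: "u \<in> weight_space z \<Longrightarrow> adL U (Fgen U i) u \<in> weight_space (z - nroot i 1)"
proof -
  assume u: "u \<in> weight_space z"
  have K: "adL U (Kgen U j) (adL U (gen U s) u)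
      = sc (q powi (root_pair form z j + root_pair form (symbol_weight s) j)) (adL U (gen U s) u)" for j s
  proof -
    have "Kgen U j * gen U s = (Kgen U j * gen U s * Kinv U j) * Kgen U j" by (simp add: mult.assoc)
    also have "\<dots> = sc (q powi root_pair form (symbol_weight s) j) (gen U s * Kgen U j)"
      using gen_weight[of s] by (simp add: weight_space_def adL_simps sc_mult)
    finally have "adL U (Kgen U j * gen U s) u
        = sc (q powi root_pair form (symbol_weight s) j) (adL U (gen U s) (adL U (Kgen U j) u))"
      by (simp add: adL_simps(3,4))
    also have "adL U (Kgen U j) u = sc (q powi root_pair form z j) u" using u by (simp add: weight_space_def)
    finally show ?thesis by (simp add: adL_simps(4,6) powi_add mult.commute)
  qed
  show "adL U (Egen U i) u \<in> weight_space (z + nroot i 1)"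
    "adL U (Fgen U i) u \<in> weight_space (z - nroot i 1)"
    using K[of _ "gE i"] K[of _ "gF i"] by (simp_all add: weight_space_def)
qed

lemma adL_E_F:
  assumes u: "u \<in> weight_space z"
  shows "adL U (Egen U i) (adL U (Fgen U j) u) - adL U (Fgen U j) (adL U (Egen U i) u)
    = (if i = j then sc (qdiff q (root_pair form z i) / qdiff q (int (d i))) u else 0)"
proof -
  interpret L: Vector_Spaces.linear sc sc "\<lambda>a. adL U a u" by (rule adL_linear_left)
  have "adL U (Egen U i) (adL U (Fgen U j) u) - adL U (Fgen U j) (adL U (Egen U i) u)
      = adL U (Egen U i * Fgen U j - Fgen U j * Egen U i) u"
    by (simp add: L.diff adL_simps(4))
  also have "\<dots> = (if i = j then sc (1 / qdiff q (int (d i)))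
      (adL U (Kgen U i) u - adL U (Kinv U i) u) else 0)"
    unfolding E_F by (simp add: L.scale L.diff L.zero)
  also have "adL U (Kgen U i) u - adL U (Kinv U i) u = sc (qdiff q (root_pair form z i)) u"
    using u Kinv_act[OF u, of i] by (simp add: weight_space_def qdiff_def scale_left_diff_distrib)
  finally show ?thesis by simp
qed

end

section \<open>The locally finite part\<close>

locale finite_levi_module = quantum_group A d q U
  for A :: "'i::finite \<Rightarrow> 'i \<Rightarrow> int" and d :: "'i \<Rightarrow> nat" and q :: "'k::field"
    and U :: "('i, 'k, 'u::ring_1) quantum_algebra" +
  fixes S :: "'i set" and v :: 'u
  assumes not_root: "n > 0 \<Longrightarrow> q ^ n \<noteq> 1"
    and diag: "A i i = 2"
    and pos: "z \<noteq> 0 \<Longrightarrow> 0 < (\<Sum>i\<in>UNIV. \<Sum>j\<in>UNIV. z i * z j * form i j)"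
    and v: "v \<in> locally_finite_part U S"
begin

abbreviation M where "M \<equiv> adM U S v"

lemma levi_closed:
  "subspace (levi U S)" "1 \<in> levi U S" "a \<in> levi U S \<Longrightarrow> c \<in> levi U S \<Longrightarrow> a * c \<in> levi U S"
  "i \<in> S \<Longrightarrow> Egen U i \<in> levi U S" "i \<in> S \<Longrightarrow> Fgen U i \<in> levi U S"
  "Kgen U j \<in> levi U S" "Kinv U j \<in> levi U S"
  unfolding levi_eq by (auto simp: subspace_def intro: levi_span.intros)

lemma adM_subspace: "subspace (adM U S w)"
proof -
  interpret L: Vector_Spaces.linear sc sc "\<lambda>a. adL U a w" by (rule adL_linear_left)
  have "adM U S w = (\<lambda>a. adL U a w) ` levi U S" by (auto simp: adM_def)
  then show ?thesis using L.subspace_image[OF levi_closed(1)] by simp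
qed

lemma adM_self: "w \<in> adM U S w"
  using levi_closed(2) adL_simps(1)[of w] unfolding adM_def by force

lemma adM_closed: "a \<in> levi U S \<Longrightarrow> x \<in> adM U S w \<Longrightarrow> adL U a x \<in> adM U S w"
  unfolding adM_def using levi_closed(3) by (auto simp: adL_simps(4)[symmetric])

lemma adM_submodule: "levi_submodule U S (adM U S w)"
  by (simp add: levi_submodule_def adM_subspace adM_closed)

lemma adM_subset: "levi_submodule U S N \<Longrightarrow> w \<in> N \<Longrightarrow> adM U S w \<subseteq> N"
  by (auto simp: levi_submodule_def adM_def)

lemma adM_mono: "w \<in> adM U S w' \<Longrightarrow> adM U S w \<subseteq> adM U S w'"
  by (rule adM_subset[OF adM_submodule])



definition W :: "('i \<Rightarrow> int) \<Rightarrow> 'u set" where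
  "W z = M \<inter> weight_space z"

lemma M_finite: "\<exists>B. finite B \<and> span B = M"
  using v by (simp add: locally_finite_part_def)

text \<open>The form on the root lattice is nondegenerate and \<open>q\<close> is not a root of unity.\<close>

lemma weights_separated:
  assumes "z \<noteq> z'"
  shows "\<exists>j\<in>UNIV. q powi root_pair form z j \<noteq> q powi root_pair form z' j"
proof (rule ccontr)
  assume "\<not> ?thesis"
  then have "root_pair form z j = root_pair form z' j" for j
    using powi_eq_iff[OF q0 not_root, of "root_pair form z j" "root_pair form z' j"] by simp
  then have 0: "root_pair form (z - z') j = 0" for j by simp
  have "z - z' \<noteq> 0"
  proof
    assume "z - z' = 0"
    then have "(z - z') j = 0" for j by (simp only: zero_fun_apply)
    then have "z j = z' j" for j by (simp only: minus_apply) simp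
    then show False using assms by blast
  qed
  from pos[OF this]
  have "0 < (\<Sum>i\<in>UNIV. \<Sum>j\<in>UNIV. (z - z') i * (z - z') j * form i j)" .
  also have "\<dots> = (\<Sum>j\<in>UNIV. (z - z') j * root_pair form (z - z') j)"
    unfolding root_pair_def sum_distrib_left
    by (subst sum.swap, intro sum.cong refl) (simp only: mult_ac)
  also have "\<dots> = 0" unfolding 0 by simp
  finally show False by simp
qed

lemma K_linear: "j \<in> UNIV \<Longrightarrow> Vector_Spaces.linear sc sc (adL U (Kgen U j))"
  by (rule adL_linear)

lemma weight_components:
  assumes N: "levi_submodule U S N" and x: "x \<in> N"
  obtains X f where "finite X" "\<And>z. z \<in> X \<Longrightarrow> f z \<in> N \<inter> weight_space z" "x = (\<Sum>z\<in>X. f z)"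
proof -
  obtain X f where X: "finite X" "\<And>z. f z \<in> weight_space z" "x = (\<Sum>z\<in>X. f z)"
    using weight_decomposition[of x] by blast
  have "f z \<in> N" if z: "z \<in> X" for z
  proof (rule weight_components_in_stable_subspace[where J = UNIV and T = "\<lambda>j. adL U (Kgen U j)"
        and \<chi> = "\<lambda>z j. q powi root_pair form z j" and X = X and x = f])
    show "subspace N" using N by (simp add: levi_submodule_def)
    show "adL U (Kgen U j) y \<in> N" if "y \<in> N" for j y
      using N that levi_closed(6) by (simp add: levi_submodule_def)
    show "adL U (Kgen U j) (f z) = sc (q powi root_pair form z j) (f z)" for z j
      using X(2)[of z] by (simp add: weight_space_def)
    show "(\<Sum>z\<in>X. f z) \<in> N" using x X(3) by simp
  qed (use X(1) z K_linear weights_separated in blast)+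
  then show ?thesis using that[OF X(1) _ X(3)] X(2) by blast
qed

sublocale weight_module sc q form d S "\<lambda>i. adL U (Egen U i)" "\<lambda>i. adL U (Fgen U i)" W
proof
  show "q \<noteq> 0" by (rule q0)
  show "form i j = form j i" for i j by (rule form_sym)
  show "0 < n \<Longrightarrow> q ^ n \<noteq> 1" for n by (rule not_root)
  show "0 < d i" for i using symm by (simp add: symmetrizes_def)
  show "form i i = 2 * int (d i)" for i by (simp add: form_def diag)
  show "z \<noteq> 0 \<Longrightarrow> 0 < (\<Sum>i\<in>UNIV. \<Sum>j\<in>UNIV. z i * z j * form i j)" for z by (rule pos)
  show "subspace (W z)" for z
    unfolding W_def by (rule subspace_inter[OF adM_subspace weight_space_subspace])
  show "adL U (Egen U i) u \<in> W (z + nroot i 1)" if "i \<in> S" "u \<in> W z" for i u z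
    using that adM_closed[OF levi_closed(4)] adL_E_weight unfolding W_def by blast
  show "adL U (Fgen U i) u \<in> W (z - nroot i 1)" if "i \<in> S" "u \<in> W z" for i u z
    using that adM_closed[OF levi_closed(5)] adL_F_weight unfolding W_def by blast
  show "adL U (Egen U i) (adL U (Fgen U j) u) - adL U (Fgen U j) (adL U (Egen U i) u) =
      (if i = j then sc (qdiff q (root_pair form z i) / qdiff q (int (d i))) u else 0)"
    if "u \<in> W z" for i j u z
    using that by (intro adL_E_F) (simp add: W_def)
  show "finite {z. W z \<noteq> {0}}"
  proof -
    obtain B where B: "finite B" "span B = M" using M_finite by blast
    have "finite {z. \<exists>x\<in>span B. x \<noteq> 0 \<and> (\<forall>j\<in>UNIV. adL U (Kgen U j) x = sc (q powi root_pair form z j) x)}"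
      by (rule finite_weights[OF K_linear weights_separated B(1)])
    moreover have "0 \<in> W z" for z
      unfolding W_def by (simp add: subspace_0 adM_subspace weight_space_subspace)
    ultimately show ?thesis
      by (elim rev_finite_subset) (auto simp: W_def weight_space_def B(2))
  qed
  show "x z = 0" if X: "finite X" "\<And>z. z \<in> X \<Longrightarrow> x z \<in> W z" "(\<Sum>z\<in>X. x z) = 0" "z \<in> X" for X x z
  proof -
    have "x z \<in> {0}"
    proof (rule weight_components_in_stable_subspace[where J = UNIV and T = "\<lambda>j. adL U (Kgen U j)"
        and \<chi> = "\<lambda>z j. q powi root_pair form z j" and X = X and x = x])
      show "subspace {0}" by (rule subspace_single_0)
      show "adL U (Kgen U j) y \<in> {0}" if "y \<in> {0}" for j y
        using that by (simp add: adL_zero del: adL_simps(7))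
      show "adL U (Kgen U j) (x z) = sc (q powi root_pair form z j) (x z)" if "z \<in> X" for z j
        using X(2)[OF that] by (simp add: W_def weight_space_def)
    qed (use X K_linear weights_separated in \<open>auto\<close>)
    then show ?thesis by simp
  qed
qed (simp_all add: adL_simps(5,6))

text \<open>The span on the right is stable under the generators of the Levi subalgebra.\<close>

lemma adM_F_words:
  assumes w: "singular z w"
  shows "adM U S w \<subseteq> span {foldr (\<lambda>i. adL U (Fgen U i)) a w | a. set a \<subseteq> S}" (is "_ \<subseteq> span ?X")
proof -
  have word_weight: "foldr (\<lambda>i. adL U (Fgen U i)) a w \<in> weight_space (z - content a)" if "set a \<subseteq> S" for a
    using F_word_weight[OF that, of w z] w by (simp add: singular_def W_def)
  have stable: "f x \<in> span ?X"
    if f: "Vector_Spaces.linear sc sc f" and g: "\<And>y. y \<in> ?X \<Longrightarrow> f y \<in> span ?X" and x: "x \<in> span ?X" for f x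
  proof -
    interpret f: Vector_Spaces.linear sc sc f by fact
    have "f ` span ?X \<subseteq> span ?X" unfolding f.span_image[symmetric]
      by (rule span_minimal[OF _ subspace_span]) (use g in blast)
    then show ?thesis using x by blast
  qed
  have wX: "w \<in> span ?X" by (rule span_base) (auto intro!: exI[of _ "[]"])
  show ?thesis
  proof
    fix x assume "x \<in> adM U S w"
    then obtain a where a: "a \<in> levi U S" "x = adL U a w" by (auto simp: adM_def)
    show "x \<in> span ?X" unfolding a(2)
    proof (rule levi_stable[OF subspace_span _ _ _ _ a(1) wX])
      show "adL U (Egen U i) y \<in> span ?X" if "i \<in> S" "y \<in> span ?X" for i y
        by (rule stable[OF adL_linear _ that(2)]) (use E_F_word_in_span[OF that(1) w] in blast)
      show "adL U (Fgen U i) y \<in> span ?X" if i: "i \<in> S" and y: "y \<in> span ?X" for i y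
      proof (rule stable[OF adL_linear _ y])
        fix y assume "y \<in> ?X"
        then obtain a where "y = foldr (\<lambda>i. adL U (Fgen U i)) a w" "set a \<subseteq> S" by blast
        then have "adL U (Fgen U i) y = foldr (\<lambda>i. adL U (Fgen U i)) (i # a) w \<and> set (i # a) \<subseteq> S"
          using i by simp
        then show "adL U (Fgen U i) y \<in> span ?X" by (intro span_base) blast
      qed
      show "adL U (Kgen U j) y \<in> span ?X" if y: "y \<in> span ?X" for j y
      proof (rule stable[OF adL_linear _ y])
        fix y assume y: "y \<in> ?X"
        then obtain c where "adL U (Kgen U j) y = sc c y"
          using word_weight unfolding weight_space_def by blast
        then show "adL U (Kgen U j) y \<in> span ?X" using y by (simp add: span_scale span_base del: adL_simps)
      qed
      show "adL U (Kinv U j) y \<in> span ?X" if y: "y \<in> span ?X" for j y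
      proof (rule stable[OF adL_linear _ y])
        fix y assume y: "y \<in> ?X"
        then obtain c where "adL U (Kinv U j) y = sc c y"
          using Kinv_act[OF word_weight] by blast
        then show "adL U (Kinv U j) y \<in> span ?X" using y by (simp add: span_scale span_base)
      qed
    qed
  qed
qed

lemma singular_weight: "singular z w \<Longrightarrow> w \<in> weight_space z"
  and singular_mem: "singular z w \<Longrightarrow> w \<in> M"
  by (simp_all add: singular_def W_def)

text \<open>A nonzero submodule contains a nonzero weight vector of maximal height. It is singular, hence a multiple of \<open>w\<close>.\<close>

lemma singular_irreducible:
  assumes w: "singular z w"
  shows "irreducible_levi_submodule U S (adM U S w)"
  unfolding irreducible_levi_submodule_def
proof (intro conjI allI impI)
  show "levi_submodule U S (adM U S w)" by (rule adM_submodule)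
  show "adM U S w \<noteq> {0}" using adM_self[of w] w by (auto simp: singular_def)
  fix N assume N: "levi_submodule U S N \<and> N \<subseteq> adM U S w"
  then have sub: "subspace N" and closed: "\<And>a x. a \<in> levi U S \<Longrightarrow> x \<in> N \<Longrightarrow> adL U a x \<in> N"
    by (auto simp: levi_submodule_def)
  have NM: "N \<subseteq> M" using N adM_mono[OF singular_mem[OF w]] by blast
  show "N = {0} \<or> N = adM U S w"
  proof (cases "N = {0}")
    case False
    then obtain x where x: "x \<in> N" "x \<noteq> 0" using subspace_0[OF sub] by blast
    obtain X f where X: "finite X" "\<And>z. z \<in> X \<Longrightarrow> f z \<in> N \<inter> weight_space z" "x = (\<Sum>z\<in>X. f z)"
      using weight_components[of N x] N x(1) by blast
    have "\<exists>y\<in>X. f y \<noteq> 0" using x(2) X(3) by (meson sum.neutral)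
    then obtain y where y: "f y \<in> N \<inter> weight_space y" "f y \<noteq> 0" using X(2) by blast
    define Z where "Z = {z. \<exists>u \<in> N \<inter> weight_space z. u \<noteq> 0}"
    have "Z \<subseteq> {z. W z \<noteq> {0}}" using NM by (auto simp: Z_def W_def)
    then have "finite Z" using W_finite finite_subset by blast
    moreover have "y \<in> Z" using y by (auto simp: Z_def)
    ultimately have "Max (height ` Z) \<in> height ` Z" by (intro Max_in) auto
    then obtain m where m: "m \<in> Z" "Max (height ` Z) = height m" by blast
    obtain u where u: "u \<in> N" "u \<in> weight_space m" "u \<noteq> 0" using m(1) by (auto simp: Z_def)
    have "adL U (Egen U i) u = 0" if i: "i \<in> S" for i
    proof (rule ccontr)
      assume "adL U (Egen U i) u \<noteq> 0"
      then have "m + nroot i 1 \<in> Z"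
        using closed[OF levi_closed(4)[OF i] u(1)] adL_E_weight[OF u(2)] unfolding Z_def by blast
      from Max_ge[OF finite_imageI[OF \<open>finite Z\<close>] imageI[OF this], of height]
      have "height (m + nroot i 1) \<le> height m" unfolding m(2) .
      then show False by simp
    qed
    then have "singular m u" using u NM by (auto simp: singular_def W_def)
    moreover have "u \<in> span {foldr (\<lambda>i. adL U (Fgen U i)) a w | a. set a \<subseteq> S}"
      using u(1) N adM_F_words[OF w] by blast
    ultimately have "u \<in> span {w}" by (rule singular_vector_in_highest_weight_module[OF w])
    then obtain c where c: "u = sc c w" by (auto simp: span_singleton)
    then have "w = sc (inverse c) u" using u(3) by auto
    then have "w \<in> N" using subspace_scale[OF sub u(1)] by simp
    then show ?thesis using N adM_subset[of N w] by blast
  qed simp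
qed

lemma singular_highest_weight_vector:
  assumes w: "singular z w"
  shows "highest_weight_vector d q U S w"
  unfolding highest_weight_vector_def
proof (intro conjI)
  obtain B where B: "finite B" "span B = M" using M_finite by blast
  obtain C where C: "C \<subseteq> adM U S w" "independent C" "adM U S w \<subseteq> span C"
    using basis_exists[of "adM U S w"] by metis
  have "finite C"
    using independent_span_bound[OF B(1) C(2)] C(1) adM_mono[OF singular_mem[OF w]] B(2) by blast
  moreover have "span C = adM U S w"
    using C(1,3) span_minimal[OF C(1) adM_subspace] by blast
  ultimately show "w \<in> locally_finite_part U S" by (auto simp: locally_finite_part_def)
  show "w \<noteq> 0" "\<forall>i\<in>S. adL U (Egen U i) w = 0" using w by (auto simp: singular_def)
  have "pair_simple d (\<lambda>j. \<Sum>k\<in>UNIV. A j k * z k) j = root_pair form z j" for j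
    unfolding root_pair_def form_sym[of _ j]
    by (simp add: pair_simple_def form_def sum_distrib_left mult_ac)
  then show "\<exists>m. \<forall>j. adL U (Kgen U j) w = sc (q powi pair_simple d m j) w"
    using singular_weight[OF w] by (intro exI[of _ "\<lambda>j. \<Sum>k\<in>UNIV. A j k * z k"]) (simp add: weight_space_def)
qed

lemma v_in_singular_span: "v \<in> singular_span"
proof -
  obtain X f where X: "finite X" "\<And>z. z \<in> X \<Longrightarrow> f z \<in> M \<inter> weight_space z" "v = (\<Sum>z\<in>X. f z)"
    using weight_components[OF adM_submodule adM_self] by blast
  have "f z \<in> singular_span" if "z \<in> X" for z
    using generated_by_singular_vectors[of z] X(2)[OF that] by (auto simp: W_def)
  then have "(\<Sum>z\<in>X. f z) \<in> singular_span" unfolding singular_span_def by (rule span_sum)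
  then show ?thesis by (simp only: X(3)[symmetric])
qed

text \<open>It suffices to write the generator \<open>v\<close> as a finite sum of vectors from the \<open>M(w i)\<close>: acting by the Levi
  subalgebra extends this to the whole of \<open>M(v)\<close>.\<close>

theorem complete_reducibility:
  "\<exists>(k::nat) (w :: nat \<Rightarrow> 'u).
     (\<forall>i<k. highest_weight_vector d q U S (w i) \<and> w i \<in> M \<and> adM U S (w i) \<subseteq> M \<and>
            irreducible_levi_submodule U S (adM U S (w i))) \<and>
     M = {\<Sum>i<k. x i | x. \<forall>i<k. x i \<in> adM U S (w i)}"
proof -
  define G where "G = {foldr (\<lambda>i. adL U (Fgen U i)) a w | a w z. set a \<subseteq> S \<and> singular z w}"
  obtain t u where t: "finite t" "t \<subseteq> G" "v = (\<Sum>y\<in>t. sc (u y) y)"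
    using v_in_singular_span unfolding singular_span_def G_def[symmetric] span_explicit by blast
  have "\<exists>w z. singular z w \<and> y \<in> adM U S w" if yG: "y \<in> G" for y
  proof -
    obtain a w z where y: "y = foldr (\<lambda>i. adL U (Fgen U i)) a w" "set a \<subseteq> S" "singular z w"
      using yG unfolding G_def by blast
    have "foldr (\<lambda>i. adL U (Fgen U i)) a w \<in> adM U S w"
      using y(2) by (induction a) (auto intro: adM_self adM_closed levi_closed(5))
    then show ?thesis using y by blast
  qed
  then obtain hw where hw: "\<And>y. y \<in> G \<Longrightarrow> (\<exists>z. singular z (hw y)) \<and> y \<in> adM U S (hw y)"
    by metis
  obtain h where h: "bij_betw h {0..<card t} t" using ex_bij_betw_nat_finite[OF t(1)] by blast
  define k where "k = card t"
  define w where "w = (\<lambda>i. hw (h i))"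
  have h: "bij_betw h {..<k} t" using h by (simp add: k_def atLeast0LessThan)
  have hG: "h i \<in> G" if "i < k" for i using h that t(2) by (auto simp: bij_betw_def)
  have w: "\<exists>z. singular z (w i)" and hw_mem: "h i \<in> adM U S (w i)" if "i < k" for i
    using hw[OF hG[OF that]] by (auto simp: w_def)
  have v_sum: "v = (\<Sum>i<k. sc (u (h i)) (h i))"
    unfolding t(3) by (rule sum.reindex_bij_betw[OF h, symmetric])
  have wM: "w i \<in> M" if "i < k" for i using w[OF that] singular_mem by blast
  have "M = {\<Sum>i<k. x i | x. \<forall>i<k. x i \<in> adM U S (w i)}"
  proof (intro equalityI subsetI)
    fix y assume "y \<in> M"
    then obtain a where a: "a \<in> levi U S" "y = adL U a v" by (auto simp: adM_def)
    interpret La: Vector_Spaces.linear sc sc "adL U a" by (rule adL_linear)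
    have "y = (\<Sum>i<k. sc (u (h i)) (adL U a (h i)))" unfolding a(2) v_sum La.sum La.scale ..
    moreover have "\<forall>i<k. sc (u (h i)) (adL U a (h i)) \<in> adM U S (w i)"
      by (simp add: subspace_scale adM_subspace adM_closed a(1) hw_mem)
    ultimately show "y \<in> {\<Sum>i<k. x i | x. \<forall>i<k. x i \<in> adM U S (w i)}" by blast
  next
    fix y assume "y \<in> {\<Sum>i<k. x i | x. \<forall>i<k. x i \<in> adM U S (w i)}"
    then obtain x where "y = (\<Sum>i<k. x i)" "\<And>i. i < k \<Longrightarrow> x i \<in> adM U S (w i)" by blast
    then show "y \<in> M" using adM_mono[OF wM] by (auto intro!: subspace_sum adM_subspace)
  qed
  moreover have "\<forall>i<k. highest_weight_vector d q U S (w i) \<and> w i \<in> M \<and> adM U S (w i) \<subseteq> M \<and>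
            irreducible_levi_submodule U S (adM U S (w i))"
    using w wM adM_mono singular_highest_weight_vector singular_irreducible by blast
  ultimately show ?thesis by blast
qed

end

theorem proposition18:
  fixes sc :: "complex \<Rightarrow> 'g::ab_group_add \<Rightarrow> 'g"
    and br :: "'g \<Rightarrow> 'g \<Rightarrow> 'g"
    and H :: "'g set"
    and \<alpha> :: "'i::finite \<Rightarrow> 'g \<Rightarrow> complex"
    and A :: "'i \<Rightarrow> 'i \<Rightarrow> int"
    and d :: "'i \<Rightarrow> nat"
    and q :: "'k::field_char_0"
    and U :: "('i, 'k, 'u::ring_1) quantum_algebra"
    and S :: "'i set"
    and v :: 'u
  assumes "complex_lie_algebra sc br"
    and "complex_lie_algebra.semisimple sc br"
    and "complex_lie_algebra.cartan_subalgebra sc br H"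
    and "complex_lie_algebra.simple_roots sc br H \<alpha>"
    and "complex_lie_algebra.is_cartan_matrix sc br H \<alpha> A"
    and "symmetrizes d A"
    and "q \<noteq> 0" and "\<forall>n>0. q ^ n \<noteq> 1"
    and "is_quantized_enveloping_algebra A d q U"
    and "v \<in> locally_finite_part U S"
  shows "\<exists>(k::nat) (w :: nat \<Rightarrow> 'u).
           (\<forall>i<k. highest_weight_vector d q U S (w i) \<and> w i \<in> adM U S v \<and>
                  adM U S (w i) \<subseteq> adM U S v \<and>
                  irreducible_levi_submodule U S (adM U S (w i))) \<and>
           adM U S v = {\<Sum>i<k. x i | x. \<forall>i<k. x i \<in> adM U S (w i)}"
proof -
  interpret g: complex_lie_algebra sc br by fact
  interpret Uq: quantum_group A d q U by unfold_locales fact+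
  obtain B where B: "finite B" "g.span B = UNIV" using assms(2) by (auto simp: g.semisimple_def)
  interpret finite_levi_module A d q U S v
  proof
    show "A i i = 2" for i by (rule g.cartan_matrix_diagonal[OF assms(5)])
    show "0 < (\<Sum>i\<in>UNIV. \<Sum>j\<in>UNIV. z i * z j * Uq.form i j)" if "z \<noteq> 0" for z
      unfolding Uq.form_def by (rule g.cartan_matrix_positive_definite[OF B assms(4-6) that])
  qed (use assms in auto)
  show ?thesis by (rule complete_reducibility)
qed

end
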